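(* Let $v$ be the explicit function on $[0,\infty)^4$ defined in the context. For $\omega\in\{0,1\}^5$ put $d(\omega)=(\omega_2-\omega_1,\dots,\omega_5-\omega_4)$ and $\mathcal R_\omega[v]=v-\frac12(d(\omega)\cdot\nabla)^2v$. Let $$A=\{q_i\ge0:\ q_4\ge q_2,\ 2q_1\ge q_4-q_2\},\qquad \overline\Omega_C=\{q_i\ge0:\ q_4\ge q_2,\ 2q_1\le q_4-q_2\}.$$ Assume that $\mathcal R_\omega[v]\ge0$ on $A$ for every $\omega\in\{0,1\}^5$, including the continuous traces on the interface $\{q_4-q_2=2q_1\}$. Then, for every $\omega\in\{0,1\}^5$, $$\mathcal R_\omega[v]\ge0\qquad\text{on }\overline\Omega_C .$$ Moreover, $$\mathcal R_{00101}[v]=\mathcal R_{01001}[v]=\mathcal R_{01110}[v]=0\qquad\text{throughout }\overline\Omega_C .$$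
   Context: Controls are written as bit strings $\omega_1\omega_2\omega_3\omega_4\omega_5$. On interfaces and boundary faces, derivatives of $v$ up to order two are understood as the (existing) continuous extensions to the closed orthant. **The explicit candidate $v$ on $[0,\infty)^4$.** Values at vanishing denominators / zero arguments are understood by continuous extension. (i) For $t>0$, $$H(t)=\frac{3}{\sqrt2\sinh^5t\cosh^2t}\left(\frac t{16}-\frac{\sinh 2t}{64}-\frac{\sinh 4t}{64}+\frac{\sinh 6t}{192}\right),\qquad U(t)=\cosh t\int_t^\infty H(r)\,dr .$$ (ii) For $r>1$, $$g(r)=\frac{8-25r^2+15r^4-15r(r^2-1)^2\operatorname{arccoth}r}{16\sqrt2\,r\sqrt{r^2-1}},\qquad \operatorname{arccoth}r=\tfrac12\log\tfrac{r+1}{r-1}.$$ For $s>0,w\ge0$, $$\widetilde L(s,w)=\tfrac1{\sqrt2}\arctan(e^{-s})\cosh s+\int_1^{\coth s}(r\sinh s-\cosh s)e^{-2wr}g(r)\,dr .$$ For $y>0,z\ge0$, with $\alpha=z/3$, $\rho=y+\alpha$, $$\begin{aligned}P(y,z)={}&\frac{\sinh^3y}{\sinh^3\rho}U(\rho)+\frac34e^{-y-4\alpha}(e^{2\alpha}-1)^2\int_\rho^\infty\frac{e^{-2r}(e^{2\alpha}-e^{2r})^2U(r)}{\sinh^5r}\,dr\\&+\frac32\sinh y\,e^{-2\alpha}(e^{2\alpha}-1)\int_\rho^\infty\frac{e^{-2r}(e^{2\alpha}-e^{2r})\bigl(e^{2\alpha}-(e^{2r}+1)/2\bigr)U(r)}{\sinh^5r}\,dr.\end{aligned}$$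 (iii) For bounded smooth $\phi$ on $(0,\infty)$, $y>0$, $p\ge0$, with $d=p/2$, $t=y+d$, $J_\phi(t)=\int_t^\infty\frac{\phi(r)}{\sinh^3r}dr$, $M_\phi(t)=\int_t^\infty\frac{\cosh r\,\phi(r)}{\sinh^4r}dr$, define $$(\mathcal K_p\phi)(y)=\frac{\sinh^2y}{\sinh^2t}\phi(t)+4\sinh y\sinh d\,J_\phi(t)+6\sinh^2d\,\bigl(\cosh t\,J_\phi(t)-\sinh t\,M_\phi(t)\bigr),$$ $$(\mathcal T\phi)(y)=2\sinh^2y\int_y^\infty\frac{\phi(r)}{\sinh^3r}\,dr .$$ (iv) For $x,z\ge0$, $y>0$, put $w=x-z/2$, $p=\min\{z,2x\}$, $\phi_w(s)=\widetilde L(s,w)$ if $w\ge0$ and $\phi_w(s)=P(s,-2w)$ if $w<0$, and $$F(x,y,z)=(\mathcal K_p\phi_w)(y),\qquad R(x,y,z)=(\mathcal T\mathcal K_p\phi_w)(y).$$ Also put $b_0(s)=\frac1{2\sqrt2}(1+\frac{e^{-2s}}3)$, $b_1(s)=\frac2{3\sqrt2}e^{-s}$, $\psi_x(s)=\widetilde L(s,x)-b_0(s)$, and $$H_B(x,y,z)=(\mathcal K_z\psi_x)(y),\qquad R_B(x,y,z)=(\mathcal T\mathcal K_z\psi_x)(y).$$ (v) If $q_4\ge q_2$, set $x=\sqrt2q_1$, $y=\sqrt2(q_2+q_3)$, $z=\sqrt2(q_4-q_2)$ and $$v(q)=F(x,y,z)\frac{\sinh(\sqrt2q_3)}{\sinh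 y}+R(x,y,z)\frac{\sinh(\sqrt2q_2)}{\sinh y}.$$ If $q_4\le q_2$, set $x=\sqrt2q_1$, $y=\sqrt2(q_3+q_4)$, $z=\sqrt2(q_2-q_4)$ and $$v(q)=\bigl(H_B(x,y,z)+b_0(y)\bigr)\frac{\sinh(\sqrt2q_3)}{\sinh y}+\bigl(R_B(x,y,z)+b_1(y)\bigr)\frac{\sinh(\sqrt2q_4)}{\sinh y}.$$ On $\overline\Omega_C$ one has $p=2x$ and $w\le0$, so the datum is $P(\cdot,z-2x)$. *)

theory Defs
  imports "HOL-Analysis.Analysis"
begin

definition Hfun :: "real \<Rightarrow> real" where
  "Hfun t = 3 / (sqrt 2 * sinh t ^ 5 * cosh t ^ 2) *
     (t / 16 - sinh (2 * t) / 64 - sinh (4 * t) / 64 + sinh (6 * t) / 192)"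

definition Ufun :: "real \<Rightarrow> real" where
  "Ufun t = cosh t * integral {t..} Hfun"

definition arccoth :: "real \<Rightarrow> real" where
  "arccoth r = 1 / 2 * ln ((r + 1) / (r - 1))"

definition gfun :: "real \<Rightarrow> real" where
  "gfun r = (8 - 25 * r ^ 2 + 15 * r ^ 4 - 15 * r * (r ^ 2 - 1) ^ 2 * arccoth r) /
     (16 * sqrt 2 * r * sqrt (r ^ 2 - 1))"

definition Ltilde :: "real \<Rightarrow> real \<Rightarrow> real" where
  "Ltilde s w = 1 / sqrt 2 * arctan (exp (- s)) * cosh s +
     integral {1..cosh s / sinh s}
       (\<lambda>r. (r * sinh s - cosh s) * exp (- 2 * w * r) * gfun r)"

definition Pfun :: "real \<Rightarrow> real \<Rightarrow> real" where
  "Pfun y z = (let \<alpha> = z / 3; \<rho> = y + \<alpha> in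
     sinh y ^ 3 / sinh \<rho> ^ 3 * Ufun \<rho>
     + 3 / 4 * exp (- y - 4 * \<alpha>) * (exp (2 * \<alpha>) - 1) ^ 2 *
         integral {\<rho>..} (\<lambda>r. exp (- 2 * r) * (exp (2 * \<alpha>) - exp (2 * r)) ^ 2 * Ufun r
                            / sinh r ^ 5)
     + 3 / 2 * sinh y * exp (- 2 * \<alpha>) * (exp (2 * \<alpha>) - 1) *
         integral {\<rho>..} (\<lambda>r. exp (- 2 * r) * (exp (2 * \<alpha>) - exp (2 * r)) *
                            (exp (2 * \<alpha>) - (exp (2 * r) + 1) / 2) * Ufun r
                            / sinh r ^ 5))"

definition Jop :: "(real \<Rightarrow> real) \<Rightarrow> real \<Rightarrow> real" where
  "Jop \<phi> t = integral {t..} (\<lambda>r. \<phi> r / sinh r ^ 3)"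

definition Mop :: "(real \<Rightarrow> real) \<Rightarrow> real \<Rightarrow> real" where
  "Mop \<phi> t = integral {t..} (\<lambda>r. cosh r * \<phi> r / sinh r ^ 4)"

definition Kop :: "real \<Rightarrow> (real \<Rightarrow> real) \<Rightarrow> real \<Rightarrow> real" where
  "Kop p \<phi> y = (let d = p / 2; t = y + d in
     sinh y ^ 2 / sinh t ^ 2 * \<phi> t + 4 * sinh y * sinh d * Jop \<phi> t
     + 6 * sinh d ^ 2 * (cosh t * Jop \<phi> t - sinh t * Mop \<phi> t))"

definition Top :: "(real \<Rightarrow> real) \<Rightarrow> real \<Rightarrow> real" where
  "Top \<phi> y = 2 * sinh y ^ 2 * integral {y..} (\<lambda>r. \<phi> r / sinh r ^ 3)"

definition phi_datum :: "real \<Rightarrow> real \<Rightarrow> real" where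
  "phi_datum w s = (if w \<ge> 0 then Ltilde s w else Pfun s (- 2 * w))"

definition Ffun :: "real \<Rightarrow> real \<Rightarrow> real \<Rightarrow> real" where
  "Ffun x y z = Kop (min z (2 * x)) (phi_datum (x - z / 2)) y"

definition Rfun :: "real \<Rightarrow> real \<Rightarrow> real \<Rightarrow> real" where
  "Rfun x y z = Top (Kop (min z (2 * x)) (phi_datum (x - z / 2))) y"

definition b0 :: "real \<Rightarrow> real" where
  "b0 s = 1 / (2 * sqrt 2) * (1 + exp (- 2 * s) / 3)"

definition b1 :: "real \<Rightarrow> real" where
  "b1 s = 2 / (3 * sqrt 2) * exp (- s)"

definition psi_datum :: "real \<Rightarrow> real \<Rightarrow> real" where
  "psi_datum x s = Ltilde s x - b0 s"

definition HBfun :: "real \<Rightarrow> real \<Rightarrow> real \<Rightarrow> real" where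
  "HBfun x y z = Kop z (psi_datum x) y"

definition RBfun :: "real \<Rightarrow> real \<Rightarrow> real \<Rightarrow> real" where
  "RBfun x y z = Top (Kop z (psi_datum x)) y"

text \<open>The two chamber formulas for \<open>v\<close>. They agree at
  \<open>q\<^sub>4 = q\<^sub>2\<close>, where both data operators are \<open>Kop 0\<close>, the identity, and
  \<open>Top b0 = b1\<close>.\<close>

definition v_formula :: "real^4 \<Rightarrow> real" where
  "v_formula q =
     (if q$4 \<ge> q$2 then
        let x = sqrt 2 * q$1; y = sqrt 2 * (q$2 + q$3); z = sqrt 2 * (q$4 - q$2) in
          Ffun x y z * (sinh (sqrt 2 * q$3) / sinh y) + Rfun x y z * (sinh (sqrt 2 * q$2) / sinh y)
      else
        let x = sqrt 2 * q$1; y = sqrt 2 * (q$3 + q$4); z = sqrt 2 * (q$2 - q$4) in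
          (HBfun x y z + b0 y) * (sinh (sqrt 2 * q$3) / sinh y)
          + (RBfun x y z + b1 y) * (sinh (sqrt 2 * q$4) / sinh y))"

definition orthant :: "(real^4) set" where
  "orthant = {q. \<forall>i. 0 \<le> q$i}"

text \<open>In both chambers \<open>y = sqrt 2 * (q\<^sub>3 + min q\<^sub>2 q\<^sub>4)\<close>, so \<open>orthant_pos\<close> is the part of the
  orthant where \<open>y > 0\<close>; there every quantity in the formulas is defined. On the rest
  (\<open>y = 0\<close>) \<open>v\<close> is the continuous extension. In type \<open>4\<close> the index \<open>4\<close> is \<open>0\<close>, so
  \<open>q$1, q$2, q$3, q$4\<close> are exactly the four coordinates.\<close>

definition orthant_pos :: "(real^4) set" where
  "orthant_pos = {q \<in> orthant. 0 < q$3 + min (q$2) (q$4)}"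

definition v :: "real^4 \<Rightarrow> real" where
  "v q = (if q \<in> orthant_pos then v_formula q else Lim (at q within orthant_pos) v_formula)"

text \<open>\<open>dir_deriv d f\<close> is \<open>(d \<cdot> \<nabla>) f\<close>. Second derivatives are taken classically on
  \<open>regular_points\<close>, the open orthant without the interfaces \<open>q\<^sub>4 = q\<^sub>2\<close> and
  \<open>q\<^sub>4 - q\<^sub>2 = 2 q\<^sub>1\<close>. On the interfaces and the boundary faces they are the continuous
  extension from \<open>regular_points\<close>. \<^const>\<open>Lim\<close> is a definite description, so a claim about a
  value there needs the extension to exist, with the same limit from every adjacent chamber.\<close>

definition dir_deriv :: "real^4 \<Rightarrow> (real^4 \<Rightarrow> real) \<Rightarrow> real^4 \<Rightarrow> real" where
  "dir_deriv d f q = deriv (\<lambda>t. f (q + t *\<^sub>R d)) 0"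

definition regular_points :: "(real^4) set" where
  "regular_points = {q. (\<forall>i. 0 < q$i) \<and> q$4 \<noteq> q$2 \<and> q$4 - q$2 \<noteq> 2 * q$1}"

definition second_dir_deriv :: "real^4 \<Rightarrow> (real^4 \<Rightarrow> real) \<Rightarrow> real^4 \<Rightarrow> real" where
  "second_dir_deriv d f q =
     (if q \<in> regular_points then dir_deriv d (dir_deriv d f) q
      else Lim (at q within regular_points) (dir_deriv d (dir_deriv d f)))"

definition controls :: "(real^5) set" where
  "controls = {\<omega>. \<forall>i. \<omega>$i \<in> {0, 1}}"

definition dvec :: "real^5 \<Rightarrow> real^4" where
  "dvec \<omega> = vector [\<omega>$2 - \<omega>$1, \<omega>$3 - \<omega>$2, \<omega>$4 - \<omega>$3, \<omega>$5 - \<omega>$4]"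

definition residual :: "real^5 \<Rightarrow> (real^4 \<Rightarrow> real) \<Rightarrow> real^4 \<Rightarrow> real" where
  "residual \<omega> f q = f q - 1 / 2 * second_dir_deriv (dvec \<omega>) f q"

definition region_A :: "(real^4) set" where
  "region_A = {q \<in> orthant. q$4 \<ge> q$2 \<and> 2 * q$1 \<ge> q$4 - q$2}"

definition region_C :: "(real^4) set" where
  "region_C = {q \<in> orthant. q$4 \<ge> q$2 \<and> 2 * q$1 \<le> q$4 - q$2}"

end

theory Submission
  imports Defs "HOL-Real_Asymp.Real_Asymp"
begin

text \<open>In each chamber \<open>v\<close> is a combination of products of hyperbolic sines and cosines in shifted
  coordinates. Its coefficients \<open>kf j\<close> arise from one data function by iterating the operator
  \<open>\<phi> \<mapsto> - coth \<cdot> \<phi> + Top \<phi> / sinh\<close>. In coordinates \<open>0 \<le> z \<le> y \<le> x \<le> r\<close> on \<open>region_C\<close>, \<open>v\<close> is a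
  symmetric form, linear in \<open>(cosh, sinh)\<close> of each of \<open>x\<close>, \<open>y\<close>, \<open>z\<close>, and permuting the
  coordinates permutes the controls. So is every residual. Since \<open>a cosh x + b sinh x\<close> is
  nonnegative on \<open>[0, r]\<close> as soon as it is so at both ends, it suffices to treat the vertices
  \<open>x, y, z \<in> {0, r}\<close>. A vertex with a zero coordinate lies, up to a permutation, on the interface
  \<open>z = 0\<close>, where the Hessians from both sides agree and the hypothesis applies. At the remaining vertex
  the claim reduces to two scalar inequalities, proved by monotonicity.

  The three vanishing residuals come from directions that move a single one of \<open>x\<close>, \<open>y\<close>, \<open>z\<close>, in which
  \<open>v\<close> reproduces itself under the second derivative. On the interface, including the origin, the
  second derivatives from the other two chambers must be shown to have the same limit.\<close>

text \<open>What makes the scheme computable is that the kernel \<open>gam\<close> solves a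
  first-order linear differential equation with hyperbolic coefficients (\<open>gam_deriv\<close>).
  Hence at \<open>w = 0\<close> the moments \<open>Xint 1\<close> to \<open>Xint 5\<close> are
  combinations of \<open>gam\<close>, \<open>theta\<close>, \<open>Lam\<close>,
  \<open>Xint 0\<close> and elementary terms, with coefficients rational in \<open>cosh t\<close>
  and \<open>sinh t\<close>, and the matching identities on the interface become polynomial
  identities modulo \<open>cosh ^ 2 = 1 + sinh ^ 2\<close>. The vertex inequalities use the same
  closed class: dividing by the coefficient of one transcendental function and differentiating
  removes that function, and after two rounds the sign can be decided. The obstacle at the origin is
  that the kernel integrals at \<open>w = 0\<close> stay bounded near 0 only for
  \<open>j \<le> 2\<close>; from \<open>j = 3\<close> on they blow up, the third one
  logarithmically. So each singular coefficient has to be paired with the hyperbolic sines that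
  multiply it, and the constant terms cancel only through one relation between the limits,
  \<open>alp_2\<close>.\<close>

section \<open>Improper integrals and exponentially decaying integrands\<close>

text \<open>For the gauge integral a pointwise primitive and its limit at infinity suffice: on every
  interval containing a large ball the truncated integrand has integral \<open>F b - F t\<close>.
  The half-line integrals in \<open>Ufun\<close>, \<open>Jop\<close>, \<open>Mop\<close>,
  \<open>Top\<close> and \<open>Pfun\<close> are all evaluated in this way.\<close>

lemma has_integral_atLeast_antiderivative:
  fixes F f :: "real \<Rightarrow> real"
  assumes der: "\<And>x. x \<ge> t \<Longrightarrow> (F has_real_derivative f x) (at x)"
    and lim: "(F \<longlongrightarrow> L) at_top"
  shows "(f has_integral (L - F t)) {t..}"
proof -
  have ftc: "(f has_integral (F b - F t)) {t..b}" if "b \<ge> t" for b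
    using that der
    by (intro fundamental_theorem_of_calculus)
      (auto simp flip: has_real_derivative_iff_has_vector_derivative
        intro: has_field_derivative_at_within)
  have restr: "((\<lambda>x. if x \<in> {t..} then f x else 0) has_integral (F b - F t)) (cbox a b)"
    if "a \<le> t" "t \<le> b" for a b
  proof -
    have "((\<lambda>x. if x \<in> {t..b} then f x else 0) has_integral (F b - F t)) (cbox a b)"
      using ftc[OF \<open>t \<le> b\<close>] that by (subst has_integral_restrict) auto
    then show ?thesis
      by (rule has_integral_eq[rotated]) auto
  qed
  show ?thesis
  proof (subst has_integral_alt', intro conjI allI impI)
    fix a b :: real
    have "(\<lambda>x. if x \<in> {t..} then f x else 0) integrable_on cbox (min a t) (max b t)"
      using restr[of "min a t" "max b t"] by (auto simp: integrable_on_def)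
    then show "(\<lambda>x. if x \<in> {t..} then f x else 0) integrable_on cbox a b"
      by (rule integrable_on_subcbox) auto
  next
    fix e :: real assume "e > 0"
    then have "eventually (\<lambda>b. dist (F b) L < e) at_top"
      using lim tendstoD by blast
    then obtain N where N: "\<And>b. b \<ge> N \<Longrightarrow> dist (F b) L < e"
      by (auto simp: eventually_at_top_linorder)
    show "\<exists>B>0. \<forall>a b. ball 0 B \<subseteq> cbox a b \<longrightarrow>
        norm (integral (cbox a b) (\<lambda>x. if x \<in> {t..} then f x else 0) - (L - F t)) < e"
    proof (intro exI[of _ "max 1 (max \<bar>N\<bar> \<bar>t\<bar>) + 1"] conjI allI impI)
      fix a b :: real
      let ?B = "max 1 (max \<bar>N\<bar> \<bar>t\<bar>) + 1"
      assume sub: "ball 0 ?B \<subseteq> cbox a b"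
      define c where "c = max 1 (max \<bar>N\<bar> \<bar>t\<bar>)"
      have "c \<in> ball 0 ?B" "- c \<in> ball 0 ?B"
        by (auto simp: c_def dist_real_def)
      with sub have "c \<in> cbox a b" "- c \<in> cbox a b" by blast+
      then have "c \<le> b" "a \<le> - c" by auto
      then have "a \<le> t" "t \<le> b" "N \<le> b"
        by (auto simp: c_def)
      then have "integral (cbox a b) (\<lambda>x. if x \<in> {t..} then f x else 0) = F b - F t"
        using restr by (intro integral_unique) auto
      then show "norm (integral (cbox a b) (\<lambda>x. if x \<in> {t..} then f x else 0) - (L - F t)) < e"
        using N[OF \<open>N \<le> b\<close>] by (simp add: dist_real_def)
    qed auto
  qed
qed

text \<open>The functions in the vertex inequalities have terms with poles at 0, so they are
  anchored at infinity, where every term tends to 0.\<close>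

lemma nonneg_if_decreasing_to_0:
  fixes f f' :: "real \<Rightarrow> real"
  assumes der: "\<And>x. x > 0 \<Longrightarrow> (f has_real_derivative f' x) (at x)"
    and nonpos: "\<And>x. x > 0 \<Longrightarrow> f' x \<le> 0"
    and lim: "(f \<longlongrightarrow> 0) at_top" and "t > 0"
  shows "f t \<ge> 0"
proof -
  have "f x \<le> f t" if "x \<ge> t" for x
    using that \<open>t > 0\<close> der nonpos
    by (intro DERIV_nonpos_imp_nonincreasing[of t x f]) (metis order.strict_trans2)+
  then show ?thesis
    using lim by (intro tendsto_upperbound[OF lim]) (auto simp: eventually_at_top_linorder)
qed

lemma zero_if_deriv_zero_tendsto_0:
  fixes f :: "real \<Rightarrow> real"
  assumes der: "\<And>x. x > 0 \<Longrightarrow> (f has_real_derivative 0) (at x)"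
    and lim: "(f \<longlongrightarrow> 0) at_top" and "t > 0"
  shows "f t = 0"
proof -
  have "f t \<ge> 0"
    by (rule nonneg_if_decreasing_to_0[OF der _ lim \<open>t > 0\<close>]) auto
  moreover have "- f t \<ge> 0"
    using der lim \<open>t > 0\<close>
    by (intro nonneg_if_decreasing_to_0[of "\<lambda>x. - f x" "\<lambda>_. 0"])
      (auto intro!: derivative_eq_intros tendsto_eq_intros)
  ultimately show ?thesis by simp
qed

text \<open>The constant may depend on \<open>s\<close>, because \<open>Akern j\<close> contains a
  power of \<open>coth\<close>, and for \<open>w < 0\<close> also a growing exponential of
  \<open>coth\<close>, and both are unbounded at 0.\<close>

definition decaying :: "(real \<Rightarrow> real) \<Rightarrow> bool" where
  "decaying f \<longleftrightarrow> continuous_on {0<..} f \<and> (\<forall>s>0. \<exists>K\<ge>0. \<forall>m\<ge>s. \<bar>f m\<bar> \<le> K * exp (- m))"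

lemma decaying_integrable:
  assumes "decaying f" "s > 0"
  shows "f absolutely_integrable_on {s..}"
proof -
  obtain K where K: "\<And>m. m \<ge> s \<Longrightarrow> \<bar>f m\<bar> \<le> K * exp (- m)"
    using assms by (auto simp: decaying_def)
  have "continuous_on {s..} f"
    using assms by (auto simp: decaying_def intro: continuous_on_subset)
  then have "f \<in> borel_measurable (lebesgue_on {s..})"
    by (intro continuous_imp_measurable_on_sets_lebesgue) auto
  moreover have "(\<lambda>m. K * exp (- m)) integrable_on {s..}"
    using integrable_on_exp_minus_to_infinity[of 1 s] by (intro integrable_on_mult_right) simp
  ultimately show ?thesis
    using K by (intro measurable_bounded_by_integrable_imp_absolutely_integrable) auto
qed

lemma decaying_integral_bound:
  assumes "decaying f" "s > 0" and K: "\<And>m. m \<ge> s \<Longrightarrow> \<bar>f m\<bar> \<le> K * exp (- m)"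
  shows "\<bar>integral {s..} f\<bar> \<le> K * exp (- s)"
proof -
  have e: "((\<lambda>m. K * exp (- m)) has_integral K * exp (- s)) {s..}"
    using has_integral_exp_minus_to_infinity[of 1 s] by (intro has_integral_mult_right) simp
  have "norm (integral {s..} f) \<le> integral {s..} (\<lambda>m. K * exp (- m))"
    using decaying_integrable[OF assms(1,2)] e K
    by (intro integral_norm_bound_integral) (auto simp: absolutely_integrable_on_def integrable_on_def)
  then show ?thesis by (simp only: integral_unique[OF e] real_norm_def)
qed

lemma decaying_integral_deriv:
  assumes "decaying f" "s > 0"
  shows "((\<lambda>s. integral {s..} f) has_real_derivative - f s) (at s)"
proof -
  \<comment> \<open>A base point strictly to the left of \<open>s\<close>: near \<open>s\<close> the
    tail integral is then a constant minus a proper integral.\<close>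
  define a where "a = s / 2"
  have a: "0 < a" "a < s" using assms by (auto simp: a_def)
  have cont: "continuous_on {a..s + 1} f"
    using assms a by (auto simp: decaying_def intro: continuous_on_subset)
  have split: "integral {x..} f = integral {a..} f - integral {a..x} f" if "x > a" for x
  proof -
    have "f integrable_on {x..}" "f integrable_on {a..}"
      using decaying_integrable[OF assms(1)] a that by (auto simp: absolutely_integrable_on_def)
    moreover have "f integrable_on {a..x}"
      using \<open>f integrable_on {a..}\<close> by (rule integrable_on_subinterval) auto
    moreover have "{a..x} \<inter> {x..} = {x}" "{a..x} \<union> {x..} = {a..}" using that by auto
    ultimately have "integral {a..} f = integral {a..x} f + integral {x..} f"
      using integral_Un[of f "{a..x}" "{x..}"] by simp
    then show ?thesis by simp
  qed
  have "((\<lambda>x. integral {a..x} f) has_real_derivative f s) (at s within {a..s + 1})"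
    using cont a by (intro integral_has_real_derivative) auto
  moreover have "at s within {a..s + 1} = at s"
    using a by (intro at_within_interior) auto
  ultimately have "((\<lambda>x. integral {a..} f - integral {a..x} f) has_real_derivative - f s) (at s)"
    by (auto intro!: derivative_eq_intros)
  then show ?thesis
    by (rule DERIV_cong_ev[THEN iffD1, rotated -1])
      (use a split in \<open>auto intro!: eventually_nhds_in_open[of "{a<..}", THEN eventually_mono]\<close>)
qed

lemma decaying_integral_tendsto_0:
  assumes "decaying f"
  shows "((\<lambda>s. integral {s..} f) \<longlongrightarrow> 0) at_top"
proof -
  obtain K where K: "K \<ge> 0" "\<And>m. m \<ge> 1 \<Longrightarrow> \<bar>f m\<bar> \<le> K * exp (- m)"
    using assms unfolding decaying_def by (metis zero_less_one)
  show ?thesis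
  proof (rule Lim_null_comparison)
    show "\<forall>\<^sub>F s in at_top. norm (integral {s..} f) \<le> K * exp (- s)"
      using eventually_ge_at_top[of 1]
      by eventually_elim (use K assms in \<open>auto intro!: decaying_integral_bound\<close>)
    show "((\<lambda>s. K * exp (- s)) \<longlongrightarrow> 0) at_top"
      by real_asymp
  qed
qed

lemma abs_exp_taylor2:
  fixes x :: real
  assumes "\<bar>x\<bar> \<le> 1"
  shows "\<bar>exp x - 1 - x\<bar> \<le> x\<^sup>2"
proof -
  have "exp x \<le> 1 + x + x\<^sup>2"
  proof (cases "x \<ge> 0")
    case True
    then show ?thesis using exp_bound[of x] assms by simp
  next
    case False
    have "exp x = 1 / exp (- x)" by (simp add: exp_minus field_simps)
    also have "\<dots> \<le> 1 / (1 - x)"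
      using exp_ge_add_one_self[of "-x"] False by (intro divide_left_mono) auto
    also have "\<dots> \<le> 1 + x + x\<^sup>2"
    proof -
      have "(1 + x + x\<^sup>2) * (1 - x) = 1 - x ^ 3" by (simp add: algebra_simps power2_eq_square power3_eq_cube)
      moreover have "x ^ 3 \<le> 0" using False using mult_nonneg_nonpos[of "x * x" x] by (simp add: power3_eq_cube)
      ultimately show ?thesis using False by (simp add: divide_le_eq)
    qed
    finally show ?thesis .
  qed
  with exp_ge_add_one_self[of x] zero_le_power2[of x] show ?thesis by linarith
qed

section \<open>The kernel of the data function\<close>

definition cth :: "real \<Rightarrow> real" where "cth m = cosh m / sinh m"

lemma cth_gt_1: "m > 0 \<Longrightarrow> cth m > 1"
  by (simp add: cth_def sinh_less_cosh_real)

lemma cth_pos [simp]: "m > 0 \<Longrightarrow> cth m > 0" and cth_nonneg [simp]: "m > 0 \<Longrightarrow> cth m \<ge> 0"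
  by (simp_all add: cth_def)

lemma cth_antimono: "0 < s \<Longrightarrow> s \<le> m \<Longrightarrow> cth m \<le> cth s"
proof -
  assume "0 < s" "s \<le> m"
  then have "sinh (m - s) \<ge> 0" by simp
  then show ?thesis using \<open>0 < s\<close> \<open>s \<le> m\<close>
    by (simp add: cth_def sinh_diff field_simps)
qed

lemma cth_deriv [derivative_intros]:
  "m > 0 \<Longrightarrow> (cth has_real_derivative 1 - cth m ^ 2) (at m)"
  unfolding cth_def[abs_def]
  by (auto intro!: derivative_eq_intros simp: field_simps power2_eq_square)

lemma cosh_sq: "cosh (x::real) ^ 2 = 1 + sinh x ^ 2"
  by (simp add: cosh_square_eq)

definition kap :: real where "kap = 1 / (2 * sqrt 2)"

lemma kap_pos [simp]: "kap > 0" and kap_nonneg [simp]: "kap \<ge> 0" by (simp_all add: kap_def)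

text \<open>This is the primitive of \<open>kap * sinh m ^ 6 / cosh m ^ 2\<close> that vanishes at
  0. That description yields the sign of \<open>gam\<close>, its differential equation and its upper
  bound.\<close>

definition gam_num :: "real \<Rightarrow> real" where
  "gam_num m = kap * (15 * m + 25 * cosh m * sinh m ^ 3 - 8 * sinh m ^ 5 / cosh m
     - 15 * cosh m ^ 3 * sinh m) / 8"

text \<open>The substitution \<open>r = coth m\<close> turns the kernel of \<open>Ltilde\<close> into \<open>gam m = - g (coth m) / sinh m ^ 3\<close>.\<close>

definition gam :: "real \<Rightarrow> real" where "gam m = gam_num m / sinh m ^ 6"

lemma gam_num_deriv:
  "(gam_num has_real_derivative kap * sinh m ^ 6 / cosh m ^ 2) (at m)"
proof -
  have "(gam_num has_real_derivative kap * (15 + 25 * (sinh m ^ 4 + 3 * cosh m ^ 2 * sinh m ^ 2)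
     - 8 * (5 * sinh m ^ 4 - sinh m ^ 6 / cosh m ^ 2)
     - 15 * (3 * cosh m ^ 2 * sinh m ^ 2 + cosh m ^ 4)) / 8) (at m)"
    unfolding gam_num_def[abs_def]
    by (rule DERIV_cong, (rule derivative_intros | simp)+) (simp add: divide_simps, algebra)
  moreover have "15 + 25 * (sinh m ^ 4 + 3 * cosh m ^ 2 * sinh m ^ 2)
     - 40 * sinh m ^ 4 - 15 * (3 * cosh m ^ 2 * sinh m ^ 2 + cosh m ^ 4) = 0"
    using cosh_sq[of m] by algebra
  then have "kap * (15 + 25 * (sinh m ^ 4 + 3 * cosh m ^ 2 * sinh m ^ 2)
     - 8 * (5 * sinh m ^ 4 - sinh m ^ 6 / cosh m ^ 2)
     - 15 * (3 * cosh m ^ 2 * sinh m ^ 2 + cosh m ^ 4)) / 8 = kap * sinh m ^ 6 / cosh m ^ 2"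
    by (simp add: divide_simps) algebra
  ultimately show ?thesis by (rule DERIV_cong)
qed

lemma gam_num_0 [simp]: "gam_num 0 = 0" by (simp add: gam_num_def)

lemma gam_deriv:
  assumes "m > 0"
  shows "(gam has_real_derivative kap / cosh m ^ 2 - 6 * cth m * gam m) (at m)"
proof -
  define C S N where "C = cosh m" and "S = sinh m" and "N = gam_num m"
  have S: "S \<noteq> 0" and C: "C \<noteq> 0" using assms by (auto simp: S_def C_def)
  have S6: "S ^ 6 = S * S ^ 5" by (simp add: eval_nat_numeral)
  have "(gam has_real_derivative
      (kap * S ^ 6 / C ^ 2 * S ^ 6 - N * (6 * S ^ 5 * C)) / (S ^ 6 * S ^ 6)) (at m)"
    unfolding gam_def[abs_def] C_def S_def N_def
    using assms by (auto intro!: derivative_eq_intros gam_num_deriv)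
  moreover have "(kap * S ^ 6 / C ^ 2 * S ^ 6 - N * (6 * S ^ 5 * C)) / (S ^ 6 * S ^ 6)
      = kap / C ^ 2 - 6 * (C / S) * (N / S ^ 6)"
  proof -
    have "kap * S ^ 6 / C ^ 2 * S ^ 6 / (S ^ 6 * S ^ 6) = kap / C ^ 2"
    proof -
      have "k * T / c * T / (T * T) = k / c" if "T \<noteq> 0" for k T c :: real
        using that by simp
      moreover have "S ^ 6 \<noteq> 0" using S by simp
      ultimately show ?thesis by blast
    qed
    moreover have "N * (6 * S ^ 5 * C) / (S ^ 6 * S ^ 6) = 6 * (C / S) * (N / S ^ 6)"
      using S by (simp add: S6 del: power_Suc flip: power_add)
    ultimately show ?thesis by (simp only: diff_divide_distrib)
  qed
  ultimately show ?thesis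
    by (simp add: C_def S_def N_def gam_def cth_def)
qed

lemmas gam_deriv' [derivative_intros] = DERIV_chain2[OF gam_deriv]

lemma gam_nonneg: "m > 0 \<Longrightarrow> gam m \<ge> 0"
  unfolding gam_def
  using DERIV_nonneg_imp_nondecreasing[of 0 m gam_num] gam_num_deriv
  by (force intro!: divide_nonneg_nonneg)

text \<open>Multiplication by \<open>sinh m ^ 6\<close> leaves two functions that vanish at 0 and
  whose derivatives differ by
  \<open>kap * S ^ 6 * (10 * S ^ 2 + 10) / (C * (4 * S ^ 2 + 5)) ^ 2\<close>, which is nonnegative.
  At infinity both sides behave like \<open>kap * exp (- 2 * m)\<close>, so the bound is sharp to
  leading order.\<close>

lemma gam_le: 
  assumes "m > 0" shows "gam m \<le> kap * sinh m / (cosh m * (4 * sinh m ^ 2 + 5))"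
proof -
  define h where "h m = kap * (sinh m ^ 7 / (cosh m * (4 * sinh m ^ 2 + 5))) - gam_num m" for m :: real
  have pos: "4 * sinh x ^ 2 + 5 > 0" for x :: real by (simp add: add_nonneg_pos)
  have hd: "\<exists>y. (h has_real_derivative y) (at x) \<and> y \<ge> 0" if "x \<ge> 0" for x
  proof -
    define C S where "C = cosh x" and "S = sinh x"
    have CS: "C ^ 2 = 1 + S ^ 2" "C > 0" "S \<ge> 0" using that by (auto simp: C_def S_def cosh_sq)
    have "((\<lambda>m. sinh m ^ 7) has_real_derivative 7 * S ^ 6 * C) (at x)"
      by (auto intro!: derivative_eq_intros simp: S_def C_def)
    moreover have "((\<lambda>m. cosh m * (4 * sinh m ^ 2 + 5)) has_real_derivative
        S * (4 * S ^ 2 + 5) + C * (8 * S * C)) (at x)"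
      by (auto intro!: derivative_eq_intros simp: S_def C_def)
    ultimately have "((\<lambda>m. sinh m ^ 7 / (cosh m * (4 * sinh m ^ 2 + 5))) has_real_derivative
        (7 * S ^ 6 * C * (C * (4 * S ^ 2 + 5)) - S ^ 7 * (S * (4 * S ^ 2 + 5) + C * (8 * S * C)))
           / (C * (4 * S ^ 2 + 5)) ^ 2) (at x)"
      using DERIV_divide pos[of x] by (fastforce simp: S_def C_def power2_eq_square)
    from DERIV_diff[OF DERIV_cmult[OF this, of kap] gam_num_deriv]
    have "(h has_real_derivative
        kap * ((7 * S ^ 6 * C * (C * (4 * S ^ 2 + 5)) - S ^ 7 * (S * (4 * S ^ 2 + 5) + C * (8 * S * C)))
           / (C * (4 * S ^ 2 + 5)) ^ 2 - S ^ 6 / C ^ 2)) (at x)"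
      by (simp add: h_def[abs_def] S_def C_def algebra_simps)
    moreover have "(7 * S ^ 6 * C * (C * (4 * S ^ 2 + 5)) - S ^ 7 * (S * (4 * S ^ 2 + 5) + C * (8 * S * C)))
           / (C * (4 * S ^ 2 + 5)) ^ 2 - S ^ 6 / C ^ 2
        = S ^ 6 * (10 * S ^ 2 + 10) / (C * (4 * S ^ 2 + 5)) ^ 2"
    proof -
      have "7 * S ^ 6 * C * (C * (4 * S ^ 2 + 5)) - S ^ 7 * (S * (4 * S ^ 2 + 5) + C * (8 * S * C))
          = S ^ 6 * (10 * S ^ 2 + 10) + S ^ 6 * (4 * S ^ 2 + 5) ^ 2"
        using CS(1) by algebra
      moreover have "S ^ 6 / C ^ 2 = S ^ 6 * (4 * S ^ 2 + 5) ^ 2 / (C * (4 * S ^ 2 + 5)) ^ 2"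
        using CS pos[of x] by (simp add: power_mult_distrib S_def)
      ultimately show ?thesis by (simp add: add_divide_distrib)
    qed
    moreover have "kap * (S ^ 6 * (10 * S ^ 2 + 10) / (C * (4 * S ^ 2 + 5)) ^ 2) \<ge> 0"
      using CS by (intro mult_nonneg_nonneg divide_nonneg_nonneg) auto
    ultimately show ?thesis by metis
  qed
  have "h 0 \<le> h m"
    by (rule DERIV_nonneg_imp_nondecreasing) (use assms in simp, rule hd)
  then have "gam_num m \<le> kap * (sinh m ^ 7 / (cosh m * (4 * sinh m ^ 2 + 5)))"
    by (simp add: h_def)
  then have "gam m \<le> kap * (sinh m ^ 7 / (cosh m * (4 * sinh m ^ 2 + 5))) / sinh m ^ 6"
    unfolding gam_def using assms by (intro divide_right_mono) auto
  also have "\<dots> = kap * sinh m / (cosh m * (4 * sinh m ^ 2 + 5))"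
    using assms by (simp add: divide_simps) algebra
  finally show ?thesis .
qed

lemma exp_le_2_cosh: "exp x \<le> 2 * cosh (x::real)"
  by (simp add: cosh_def)

lemma gam_tendsto_0_at_0: "(gam \<longlongrightarrow> 0) (at_right 0)"
proof (rule tendsto_sandwich)
  show "\<forall>\<^sub>F m in at_right 0. 0 \<le> gam m"
    "\<forall>\<^sub>F m in at_right 0. gam m \<le> kap * sinh m / (cosh m * (4 * sinh m ^ 2 + 5))"
    using gam_nonneg gam_le by (auto simp: eventually_at_filter)
  have "isCont (\<lambda>m. kap * sinh m / (cosh m * (4 * sinh m ^ 2 + 5))) 0"
    by (intro continuous_intros) auto
  then show "((\<lambda>m. kap * sinh m / (cosh m * (4 * sinh m ^ 2 + 5))) \<longlongrightarrow> 0) (at_right 0)"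
    by (auto simp: isCont_def intro: filterlim_at_split[THEN iffD1, THEN conjunct2])
qed auto

text \<open>Two factors \<open>cth m\<close> are absorbed uniformly down to \<open>m = 0\<close>,
  since \<open>gam\<close> vanishes there to first order. This is the source of the threshold
  \<open>j \<le> 2\<close> in the estimates at the origin.\<close>

lemma cth2_gam_le: 
  assumes "m > 0" shows "sinh m * cth m ^ 2 * gam m \<le> kap * exp (- m)"
proof -
  have "sinh m * cth m ^ 2 * gam m \<le> sinh m * cth m ^ 2 * (kap * sinh m / (cosh m * (4 * sinh m ^ 2 + 5)))"
    using assms gam_le by (intro mult_left_mono) auto
  also have "\<dots> = kap * cosh m / (4 * sinh m ^ 2 + 5)"
  proof -
    have "S * (C / S) ^ 2 * (k * S / (C * Q)) = k * C / Q" if "S \<noteq> 0" "C \<noteq> 0" for S C Q k :: real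
      using that by (simp add: power2_eq_square)
    then show ?thesis using assms by (simp add: cth_def)
  qed
  also have "\<dots> \<le> kap * exp (- m)"
  proof -
    have "cosh m * exp m \<le> 2 * cosh m ^ 2"
      using mult_left_mono[OF exp_le_2_cosh[of m], of "cosh m"] by (simp add: power2_eq_square)
    also have "\<dots> \<le> 4 * sinh m ^ 2 + 5" by (simp add: cosh_sq)
    finally have "cosh m * exp m \<le> 4 * sinh m ^ 2 + 5" .
    then have "cosh m / (4 * sinh m ^ 2 + 5) \<le> exp (- m)"
      by (simp add: exp_minus divide_simps add_nonneg_pos mult.commute)
         
    then show ?thesis using mult_left_mono[of _ _ kap] by fastforce
  qed
  finally show ?thesis .
qed

text \<open>Raising \<open>j\<close> corresponds both to differentiation in \<open>w\<close> and to one more application of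
  \<open>\<phi> \<mapsto> - coth \<cdot> \<phi> + Top \<phi> / sinh\<close>.\<close>

definition Akern :: "nat \<Rightarrow> real \<Rightarrow> real \<Rightarrow> real" where
  "Akern j w m = sinh m * (- cth m) ^ j * gam m * exp (- 2 * w * cth m)"

definition Aint :: "nat \<Rightarrow> real \<Rightarrow> real \<Rightarrow> real" where
  "Aint j s w = integral {s..} (Akern j w)"

lemma Akern_bound:
  assumes "0 < s" "s \<le> m" shows "\<bar>Akern j w m\<bar> \<le> kap * cth s ^ j * exp (2 * \<bar>w\<bar> * cth s) * exp (- m)"
proof -
  have m: "m > 0" using assms by simp
  have "sinh m * gam m \<le> sinh m * cth m ^ 2 * gam m"
    using gam_nonneg[OF m] m mult_right_mono[of 1 "cth m ^ 2" "sinh m * gam m"] cth_gt_1[OF m]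
    by (simp add: one_le_power mult_ac)
  also note cth2_gam_le[OF m]
  finally have g: "sinh m * gam m \<le> kap * exp (- m)" .
  have "- (w * cth m) \<le> \<bar>w\<bar> * cth m"
    using m by (metis abs_ge_minus_self abs_mult abs_of_pos cth_pos)
  also have "\<dots> \<le> \<bar>w\<bar> * cth s"
    using cth_antimono[OF assms] by (intro mult_left_mono) auto
  finally have w: "exp (- 2 * w * cth m) \<le> exp (2 * \<bar>w\<bar> * cth s)" by simp
  have "\<bar>Akern j w m\<bar> = cth m ^ j * (sinh m * gam m) * exp (- 2 * w * cth m)"
    using m gam_nonneg[OF m] abs_of_pos[OF cth_pos[OF m]] by (simp add: Akern_def abs_mult power_abs)
  also have "\<dots> \<le> cth s ^ j * (kap * exp (- m)) * exp (2 * \<bar>w\<bar> * cth s)"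
  proof -
    have c: "cth m ^ j \<le> cth s ^ j" using m cth_antimono[OF assms] by (intro power_mono) auto
    have "cth m ^ j * (sinh m * gam m) \<le> cth s ^ j * (kap * exp (- m))"
      by (rule mult_mono[OF c g]) (use m assms gam_nonneg[OF m] in auto)
    then show ?thesis by (rule mult_mono[OF _ w]) (use assms in auto)
  qed
  finally show ?thesis by (simp add: mult_ac)
qed

text \<open>In contrast to \<open>Akern_bound\<close> the constant does not deteriorate near 0. This
  makes \<open>Aint j\<close> Lipschitz up to 0 for \<open>j \<le> 2\<close>.\<close>

lemma Akern_bound_2:
  assumes "0 < m" "0 \<le> w" "j \<le> 2" shows "\<bar>Akern j w m\<bar> \<le> kap * exp (- m)"
proof -
  have "\<bar>Akern j w m\<bar> = cth m ^ j * (sinh m * gam m) * exp (- 2 * w * cth m)"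
    using assms gam_nonneg abs_of_pos[OF cth_pos[OF assms(1)]] by (simp add: Akern_def abs_mult power_abs)
  also have "\<dots> \<le> cth m ^ 2 * (sinh m * gam m) * 1"
    using assms gam_nonneg cth_gt_1[of m]
    using mult_right_mono[of "cth m ^ j" "cth m ^ 2" "sinh m * gam m"]
      mult_mono[of "cth m ^ j * (sinh m * gam m)" "cth m ^ 2 * (sinh m * gam m)" "exp (- 2 * w * cth m)" 1]
    by (simp add: power_increasing)
  also have "\<dots> \<le> kap * exp (- m)"
    using cth2_gam_le[OF assms(1)] by (simp add: mult_ac)
  finally show ?thesis .
qed

lemma gam_continuous: "continuous_on {0<..} gam"
  by (auto intro!: DERIV_atLeastAtMost_imp_continuous_on continuous_at_imp_continuous_on DERIV_isCont gam_deriv)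

lemma cth_continuous: "continuous_on {0<..} cth"
  by (auto intro!: continuous_at_imp_continuous_on DERIV_isCont cth_deriv)

lemma Akern_decaying: "decaying (Akern j w)"
  unfolding decaying_def
proof (intro conjI allI impI)
  show "continuous_on {0<..} (Akern j w)"
    unfolding Akern_def[abs_def] 
    by (intro continuous_intros gam_continuous cth_continuous)
  fix s :: real assume "0 < s"
  then show "\<exists>K\<ge>0. \<forall>m\<ge>s. \<bar>Akern j w m\<bar> \<le> K * exp (- m)"
    using Akern_bound by (intro exI[of _ "kap * cth s ^ j * exp (2 * \<bar>w\<bar> * cth s)"]) (auto simp: less_imp_le)
qed

lemma Aint_deriv_s: "s > 0 \<Longrightarrow> ((\<lambda>s. Aint j s w) has_real_derivative - Akern j w s) (at s)"
  unfolding Aint_def by (rule decaying_integral_deriv[OF Akern_decaying])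

lemma Aint_tendsto_0: "((\<lambda>s. Aint j s w) \<longlongrightarrow> 0) at_top"
  unfolding Aint_def by (rule decaying_integral_tendsto_0[OF Akern_decaying])

text \<open>Changing \<open>w\<close> by \<open>h\<close> multiplies the kernel by
  \<open>exp x\<close> with \<open>x = - 2 * h * cth m\<close>. On \<open>{s..}\<close> the factor
  \<open>cth m\<close> is at most \<open>cth s\<close>, so \<open>x\<close> is uniformly small and
  the quadratic Taylor remainder can be integrated. The linear term is \<open>2 * h\<close> times
  the kernel of index \<open>Suc j\<close>, because the base of the power is
  \<open>- cth m\<close>.\<close>

lemma Aint_deriv_w:
  assumes "s > 0" shows "((\<lambda>w. Aint j s w) has_real_derivative 2 * Aint (Suc j) s w) (at w)"
proof -
  define c where "c = cth s"
  have c: "c > 0" using assms by (simp add: c_def)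
  define I where "I = integral {s..} (\<lambda>m. \<bar>Akern j w m\<bar>)"
  have int: "Akern i u integrable_on {s..}" for i u
    using decaying_integrable[OF Akern_decaying assms] by (simp add: absolutely_integrable_on_def)
  have absint: "(\<lambda>m. \<bar>Akern j w m\<bar>) integrable_on {s..}"
    using decaying_integrable[OF Akern_decaying assms] by (simp add: absolutely_integrable_on_def)
  have key: "\<bar>Aint j s (w + h) - Aint j s w - h * (2 * Aint (Suc j) s w)\<bar> \<le> (4 * h\<^sup>2 * c\<^sup>2) * I"
    if h: "\<bar>2 * h * c\<bar> \<le> 1" for h
  proof -
    have "Aint j s (w + h) - Aint j s w - h * (2 * Aint (Suc j) s w) =
        integral {s..} (\<lambda>m. Akern j (w + h) m - Akern j w m - h * (2 * Akern (Suc j) w m))"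
      unfolding Aint_def
      by (rule integral_unique[symmetric]) (intro has_integral_diff has_integral_mult_right integrable_integral int)
    moreover have "norm \<dots> \<le> integral {s..} (\<lambda>m. (4 * h\<^sup>2 * c\<^sup>2) * \<bar>Akern j w m\<bar>)"
    proof (rule integral_norm_bound_integral)
      show "(\<lambda>m. Akern j (w + h) m - Akern j w m - h * (2 * Akern (Suc j) w m)) integrable_on {s..}"
        using int by (intro integrable_diff integrable_on_mult_right) auto
      show "(\<lambda>m. 4 * h\<^sup>2 * c\<^sup>2 * \<bar>Akern j w m\<bar>) integrable_on {s..}"
        using absint by (intro integrable_on_mult_right)
      fix m assume m: "m \<in> {s..}"
      define x where "x = - 2 * h * cth m"
      have cm: "0 < cth m" "cth m \<le> c" using m assms cth_antimono[of s m] by (auto simp: c_def)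
      have "\<bar>x\<bar> = \<bar>2 * h\<bar> * cth m" using cm by (simp add: x_def abs_mult)
      also have "\<dots> \<le> \<bar>2 * h\<bar> * c" using cm by (intro mult_left_mono) auto
      finally have xc: "\<bar>x\<bar> \<le> \<bar>2 * h * c\<bar>" using c by (simp add: abs_mult)
      then have x1: "\<bar>x\<bar> \<le> 1" using h by simp
      have "x\<^sup>2 \<le> (2 * h * c)\<^sup>2" using xc by (simp add: abs_le_square_iff)
      then have x2: "\<bar>exp x - 1 - x\<bar> \<le> 4 * h\<^sup>2 * c\<^sup>2"
        using abs_exp_taylor2[OF x1] by (simp add: power_mult_distrib)
      have "Akern j (w + h) m = Akern j w m * exp x"
        by (simp add: Akern_def x_def algebra_simps flip: exp_add)
      moreover have "h * (2 * Akern (Suc j) w m) = Akern j w m * x"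
        by (simp add: Akern_def x_def)
      ultimately have "norm (Akern j (w + h) m - Akern j w m - h * (2 * Akern (Suc j) w m)) =
          \<bar>(exp x - 1 - x) * Akern j w m\<bar>"
        by (simp add: algebra_simps)
      also have "\<dots> = \<bar>exp x - 1 - x\<bar> * \<bar>Akern j w m\<bar>"
        by (rule abs_mult)
      also have "\<dots> \<le> 4 * h\<^sup>2 * c\<^sup>2 * \<bar>Akern j w m\<bar>"
        using x2 by (intro mult_right_mono) auto
      finally show "norm (Akern j (w + h) m - Akern j w m - h * (2 * Akern (Suc j) w m))
          \<le> 4 * h\<^sup>2 * c\<^sup>2 * \<bar>Akern j w m\<bar>" .
    qed
    ultimately show ?thesis by (simp add: I_def)
  qed
  show ?thesis
    unfolding DERIV_def
  proof (rule LIM_zero_cancel, rule Lim_null_comparison)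
    have "\<forall>\<^sub>F h in at 0. \<bar>h\<bar> < 1 / (2 * c)"
      using c by (auto simp: eventually_at intro!: exI[of _ "1 / (2 * c)"])
    then show "\<forall>\<^sub>F h in at 0. norm ((Aint j s (w + h) - Aint j s w) / h - 2 * Aint (Suc j) s w)
        \<le> \<bar>h\<bar> * (4 * c\<^sup>2 * I)"
      using eventually_neq_at_within[of 0 0 UNIV]
    proof eventually_elim
      case (elim h)
      then have "\<bar>2 * h * c\<bar> \<le> 1" using c by (simp add: abs_mult field_simps)
      note key[OF this]
      moreover have "norm ((Aint j s (w + h) - Aint j s w) / h - 2 * Aint (Suc j) s w) =
         \<bar>Aint j s (w + h) - Aint j s w - h * (2 * Aint (Suc j) s w)\<bar> / \<bar>h\<bar>"
        using elim by (simp add: diff_divide_distrib flip: abs_divide)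
      moreover have "4 * h\<^sup>2 * c\<^sup>2 * I / \<bar>h\<bar> = \<bar>h\<bar> * (4 * c\<^sup>2 * I)"
      proof -
        have "4 * h\<^sup>2 * c\<^sup>2 * I / \<bar>h\<bar> = \<bar>h\<bar> * (\<bar>h\<bar> * (4 * c\<^sup>2 * I)) / \<bar>h\<bar>"
          by (simp add: power2_eq_square flip: mult.assoc)
        then show ?thesis using elim by simp
      qed
      ultimately show ?case
        by (metis abs_ge_zero divide_right_mono)
    qed
    show "((\<lambda>h. \<bar>h\<bar> * (4 * c\<^sup>2 * I)) \<longlongrightarrow> 0) (at 0)"
      by (auto intro!: tendsto_eq_intros)
  qed
qed

section \<open>Closed forms and the coefficient functions\<close>

lemma Akern_continuous:
  assumes "s0 > 0" shows "continuous (at (w0, s0)) (\<lambda>(w, s). Akern j w s)"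
proof -
  have "isCont gam s0" "isCont cth s0"
    using assms by (auto intro!: DERIV_isCont gam_deriv cth_deriv)
  then have "isCont (\<lambda>x. gam (snd x)) (w0, s0)" "isCont (\<lambda>x. cth (snd x)) (w0, s0)"
    using isCont_o2[of "(w0, s0)" snd gam] isCont_o2[of "(w0, s0)" snd cth] by (simp_all add: continuous_intros)
  then show ?thesis
    unfolding Akern_def case_prod_beta by (intro continuous_intros) auto
qed

text \<open>Joint differentiability, from the partial derivative in \<open>w\<close> and a jointly
  continuous partial derivative in \<open>s\<close>. It lets both arguments move together along a
  line, as the coordinates of \<open>VA\<close> and \<open>VB\<close> require.\<close>

lemma Aint_has_derivative:
  assumes "s > 0"
  shows "((\<lambda>(w, s). Aint j s w) has_derivative
    (\<lambda>(tw, ts). 2 * Aint (Suc j) s w * tw + - Akern j w s * ts)) (at (w, s))"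
proof -
  have "((\<lambda>(w, s). Aint j s w) has_derivative
    (\<lambda>(tw, ts). 2 * Aint (Suc j) s w * tw + blinfun_apply (blinfun_mult_right (- Akern j w s)) ts))
    (at (w, s) within UNIV \<times> {0<..})"
  proof (rule has_derivative_partialsI)
    show "((\<lambda>w. Aint j s w) has_derivative (\<lambda>tw. 2 * Aint (Suc j) s w * tw)) (at w)"
      using Aint_deriv_w[OF assms] by (simp add: has_field_derivative_def)
    show "((\<lambda>s. Aint j s w) has_derivative blinfun_apply (blinfun_mult_right (- Akern j w s)))
      (at s within {0<..})" if "s \<in> {0<..}" for w s
      using Aint_deriv_s[of s j w] that
      by (auto simp: has_field_derivative_def intro: has_derivative_at_withinI)
    have "continuous (at (w, s)) (\<lambda>(w, s). Akern j w s)"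
      by (rule Akern_continuous[OF assms])
    then have "continuous (at (w, s)) (\<lambda>(w, s). blinfun_mult_right (- Akern j w s))"
      unfolding case_prod_beta by (intro continuous_intros) auto
    then show "continuous (at (w, s) within UNIV \<times> {0<..})
        (\<lambda>(w, s). blinfun_mult_right (- Akern j w s))"
      by (rule continuous_at_imp_continuous_at_within)
  qed (use assms in auto)
  moreover have "at (w, s) within UNIV \<times> {0<..} = at (w, s)"
    using assms by (intro at_within_open open_Times) auto
  ultimately show ?thesis by (simp add: case_prod_beta)
qed

lemma Aint_deriv_curve:
  assumes "s x > 0" "(s has_real_derivative s') (at x)" "(w has_real_derivative w') (at x)"
  shows "((\<lambda>x. Aint j (s x) (w x)) has_real_derivative
    2 * Aint (Suc j) (s x) (w x) * w' - Akern j (w x) (s x) * s') (at x)"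
proof -
  have "((\<lambda>x. (w x, s x)) has_derivative (\<lambda>h. (w' * h, s' * h))) (at x)"
    using assms(2,3) by (auto simp: has_field_derivative_def intro!: has_derivative_Pair)
  from has_derivative_compose[OF this Aint_has_derivative[OF assms(1)]]
  have "((\<lambda>x. Aint j (s x) (w x)) has_derivative
      (\<lambda>h. 2 * Aint (Suc j) (s x) (w x) * (w' * h) + - Akern j (w x) (s x) * (s' * h))) (at x)"
    by (simp only: prod.case)
  then show ?thesis
    unfolding has_field_derivative_def by (rule has_derivative_eq_rhs) (auto simp: algebra_simps)
qed

lemma tendsto_Aint [tendsto_intros]:
  assumes "(s \<longlongrightarrow> s0) F" "(w \<longlongrightarrow> w0) F" "s0 > 0"
  shows "((\<lambda>x. Aint j (s x) (w x)) \<longlongrightarrow> Aint j s0 w0) F"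
proof -
  have "isCont (\<lambda>(w, s). Aint j s w) (w0, s0)"
    using Aint_has_derivative[OF assms(3)] by (rule has_derivative_continuous)
  from isCont_tendsto_compose[OF this tendsto_Pair[OF assms(2,1)]]
  show ?thesis by simp
qed

text \<open>\<open>theta\<close> and \<open>Lam\<close> are the primitives of
  \<open>- 1 / (2 * cosh s)\<close> and \<open>- 1 / sinh s\<close> that vanish at infinity;
  \<open>Lam t\<close> is the logarithm of \<open>coth (t / 2)\<close>. Both arise when the moments
  are integrated by parts.\<close>

definition theta :: "real \<Rightarrow> real" where "theta s = arctan (exp (- s))"

definition Lam :: "real \<Rightarrow> real" where "Lam t = ln ((1 + exp (- t)) / (1 - exp (- t)))"

lemma theta_deriv: "(theta has_real_derivative - 1 / (2 * cosh s)) (at s)"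
proof -
  have "(theta has_real_derivative - exp (- s) / (1 + exp (- s) ^ 2)) (at s)"
    unfolding theta_def[abs_def] by (auto intro!: derivative_eq_intros simp: divide_inverse)
  moreover have "exp (- s) / (1 + exp (- s) ^ 2) = 1 / (2 * cosh s)"
  proof -
    have "exp s \<noteq> 0" "1 + exp s ^ 2 \<noteq> 0" by (auto simp: add_pos_nonneg add_nonneg_eq_0_iff)
    then show ?thesis by (simp add: cosh_def exp_minus divide_simps) (simp add: algebra_simps power2_eq_square)
  qed
  ultimately show ?thesis by simp
qed

lemma Lam_deriv: "s > 0 \<Longrightarrow> (Lam has_real_derivative - 1 / sinh s) (at s)"
proof -
  assume s: "s > 0"
  define e where "e = exp (- s)"
  have e: "0 < e" "e < 1" using s by (auto simp: e_def)
  have "(Lam has_real_derivative 1 / ((1 + e) / (1 - e)) *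
      ((- e * (1 - e) - (1 + e) * e) / ((1 - e) * (1 - e)))) (at s)"
    unfolding Lam_def[abs_def] e_def using s
    by (auto intro!: derivative_eq_intros simp: add_pos_pos)
  moreover have "1 / ((1 + e) / (1 - e)) * ((- e * (1 - e) - (1 + e) * e) / ((1 - e) * (1 - e)))
      = - 2 * e / ((1 + e) * (1 - e))"
    using e by (simp add: divide_simps) (simp add: algebra_simps)
  moreover have "sinh s = (1 + e) * (1 - e) / (2 * e)"
  proof -
    have "exp s = 1 / e" by (simp add: e_def exp_minus inverse_eq_divide)
    then have "sinh s = (1 / e - e) / 2" by (simp add: sinh_def e_def)
    then show ?thesis using e by (simp add: field_simps)
  qed
  ultimately show ?thesis using e by simp
qed

lemmas theta_deriv' [derivative_intros] = DERIV_chain2[OF theta_deriv]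
lemmas Lam_deriv' [derivative_intros] = DERIV_chain2[OF Lam_deriv]

lemma theta_tendsto_0: "(theta \<longlongrightarrow> 0) at_top"
  unfolding theta_def[abs_def] by real_asymp

lemma Lam_tendsto_0: "(Lam \<longlongrightarrow> 0) at_top"
  unfolding Lam_def[abs_def] by real_asymp

section \<open>Moments of the kernel at \<open>w = 0\<close> and their recurrence\<close>

text \<open>The sign turns the integrand into the nonnegative
  \<open>sinh m * cth m ^ j * gam m\<close>.\<close>

definition Xint :: "nat \<Rightarrow> real \<Rightarrow> real" where "Xint j s = (-1) ^ j * Aint j s 0"

lemma Xint_deriv [derivative_intros]:
  assumes "s > 0" shows "(Xint j has_real_derivative - (sinh s * cth s ^ j * gam s)) (at s)"
proof -
  have "(Xint j has_real_derivative (-1) ^ j * - Akern j 0 s) (at s)"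
    unfolding Xint_def[abs_def] by (intro DERIV_cmult Aint_deriv_s assms)
  moreover have "(-1) ^ j * (- cth s) ^ j = cth s ^ j"
    by (simp flip: power_mult_distrib)
  ultimately show ?thesis by (simp add: Akern_def mult_ac)
qed

lemma Xint_tendsto_0: "(Xint j \<longlongrightarrow> 0) at_top"
  unfolding Xint_def[abs_def] by (rule tendsto_mult_right_zero[OF Aint_tendsto_0])

lemma gam_term_tendsto_0: "((\<lambda>s. sinh s * cth s ^ n * gam s) \<longlongrightarrow> 0) at_top"
proof (rule Lim_null_comparison)
  show "\<forall>\<^sub>F s in at_top. norm (sinh s * cth s ^ n * gam s) \<le> kap * cth 1 ^ n * exp (- s)"
    using eventually_ge_at_top[of 1]
  proof eventually_elim
    case (elim s)
    then show ?case using Akern_bound[of 1 s n 0] abs_of_pos[OF cth_pos[of s]]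
      by (simp add: Akern_def abs_mult power_abs)
  qed
  show "((\<lambda>s. kap * cth 1 ^ n * exp (- s)) \<longlongrightarrow> 0) at_top"
    by real_asymp
qed

text \<open>Integration by parts, using the linear differential equation of \<^const>\<open>gam\<close>.\<close>

lemma Xint_rec:
  assumes R: "\<And>s. s > 0 \<Longrightarrow> (R has_real_derivative - (sinh s * cth s ^ n / cosh s ^ 2)) (at s)"
    and R0: "(R \<longlongrightarrow> 0) at_top" and "s > 0"
  shows "sinh s * cth s ^ n * gam s + kap * R s = (n + 5) * Xint (n + 1) s - n * Xint (n - 1) s"
proof -
  define D where "D s = sinh s * cth s ^ n * gam s + kap * R s - (n + 5) * Xint (n + 1) s + n * Xint (n - 1) s" for s
  have "D s = 0"
  proof (rule zero_if_deriv_zero_tendsto_0[OF _ _ \<open>s > 0\<close>])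
    fix x :: real assume x: "x > 0"
    define C S c g where "C = cosh x" and "S = sinh x" and "c = cth x" and "g = gam x"
    have C: "C = S * c" using x by (simp add: C_def S_def c_def cth_def)
    have "((\<lambda>s. sinh s * cth s ^ n * gam s) has_real_derivative
        (C * c ^ n * g + S * (n * c ^ (n - 1) * (1 - c ^ 2)) * g + S * c ^ n * (kap / C ^ 2 - 6 * c * g))) (at x)"
      using x unfolding C_def S_def c_def g_def
      by (auto intro!: derivative_eq_intros gam_deriv cth_deriv simp: algebra_simps)
    then have "(D has_real_derivative
        (C * c ^ n * g + S * (n * c ^ (n - 1) * (1 - c ^ 2)) * g + S * c ^ n * (kap / C ^ 2 - 6 * c * g))
        + kap * (- (S * c ^ n / C ^ 2)) - (n + 5) * (- (S * c ^ (n + 1) * g)) + n * (- (S * c ^ (n - 1) * g))) (at x)"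
      unfolding D_def[abs_def] C_def S_def c_def g_def
      by (intro DERIV_add DERIV_diff DERIV_cmult R Xint_deriv x)
    also have "(C * c ^ n * g + S * (n * c ^ (n - 1) * (1 - c ^ 2)) * g + S * c ^ n * (kap / C ^ 2 - 6 * c * g))
        + kap * (- (S * c ^ n / C ^ 2)) - (n + 5) * (- (S * c ^ (n + 1) * g)) + n * (- (S * c ^ (n - 1) * g)) = 0"
      \<comment> \<open>The truncated \<open>n - 1\<close> at \<open>n = 0\<close> is harmless,
        since it always comes with the factor \<open>n\<close>.\<close>
      unfolding C by (cases n) (simp_all add: algebra_simps power2_eq_square)
    finally show "(D has_real_derivative 0) (at x)" .
  next
    have "(D \<longlongrightarrow> 0 + kap * 0 - real (n + 5) * 0 + real n * 0) at_top"
      unfolding D_def[abs_def]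
      by (intro tendsto_intros R0 Xint_tendsto_0 gam_term_tendsto_0)
    then show "(D \<longlongrightarrow> 0) at_top" by simp
  qed
  then show ?thesis by (simp add: D_def)
qed

lemma inverse_cosh_tendsto_0: "((\<lambda>s::real. 1 / cosh s) \<longlongrightarrow> 0) at_top"
  unfolding cosh_def by (simp, real_asymp)

lemma inverse_sinh_tendsto_0: "((\<lambda>s::real. 1 / sinh s) \<longlongrightarrow> 0) at_top"
  unfolding sinh_def by (simp, real_asymp)

text \<open>The recurrence needs a primitive of \<open>- sinh s * cth s ^ n / cosh s ^ 2\<close>
  vanishing at infinity. For \<open>n = 0, 1, 2, 3\<close> this is \<open>1 / cosh s\<close>,
  \<open>2 * theta s\<close>, \<open>Lam s\<close>, \<open>1 / sinh s\<close>. So, up to elementary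
  terms, odd moments reduce to \<open>gam\<close> and \<open>Lam\<close>, even ones to
  \<open>gam\<close>, \<open>theta\<close> and \<open>Xint 0\<close>.\<close>

lemma Xint_1: "s > 0 \<Longrightarrow> 5 * Xint 1 s = sinh s * gam s + kap / cosh s"
  using Xint_rec[of "\<lambda>s. 1 / cosh s" 0 s] inverse_cosh_tendsto_0
  by (force intro!: derivative_eq_intros simp: power2_eq_square)

lemma Xint_2: "s > 0 \<Longrightarrow> 6 * Xint 2 s = cosh s * gam s + 2 * kap * theta s + Xint 0 s"
  using Xint_rec[of "\<lambda>s. 2 * theta s" 1 s] tendsto_mult_right_zero[OF theta_tendsto_0, of 2]
  by (force intro!: derivative_eq_intros simp: power2_eq_square cth_def numeral_2_eq_2)

lemma Xint_3: "s > 0 \<Longrightarrow> 7 * Xint 3 s = sinh s * cth s ^ 2 * gam s + kap * Lam s + 2 * Xint 1 s"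
  using Xint_rec[of Lam 2 s] Lam_tendsto_0
  by (force intro!: derivative_eq_intros Lam_deriv simp: power2_eq_square cth_def numeral_3_eq_3 numeral_2_eq_2)

lemma Xint_4: "s > 0 \<Longrightarrow> 8 * Xint 4 s = sinh s * cth s ^ 3 * gam s + kap / sinh s + 3 * Xint 2 s"
  using Xint_rec[of "\<lambda>s. 1 / sinh s" 3 s] inverse_sinh_tendsto_0
  by (force intro!: derivative_eq_intros simp: power2_eq_square power3_eq_cube cth_def eval_nat_numeral)

lemma Xint_5: "s > 0 \<Longrightarrow> 9 * Xint 5 s = sinh s * cth s ^ 4 * gam s
    + kap * (cosh s / (2 * sinh s ^ 2) + Lam s / 2) + 4 * Xint 3 s"
proof -
  assume s: "s > 0"
  have "((\<lambda>s. cosh s / (2 * sinh s ^ 2) + Lam s / 2) has_real_derivative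
      - (sinh x * cth x ^ 4 / cosh x ^ 2)) (at x)" if x: "x > 0" for x
  proof -
    define C S where "C = cosh x" and "S = sinh x"
    have S: "S \<noteq> 0" "C \<noteq> 0" using x by (auto simp: S_def C_def)
    have "((\<lambda>s. cosh s / (2 * sinh s ^ 2) + Lam s / 2) has_real_derivative
      (S * (2 * S ^ 2) - C * (2 * (2 * S * C))) / ((2 * S ^ 2) * (2 * S ^ 2)) + (- 1 / S) / 2) (at x)"
      using x unfolding C_def S_def by (auto intro!: derivative_eq_intros Lam_deriv simp: mult_ac)
    moreover have "(S * (2 * S ^ 2) - C * (2 * (2 * S * C))) / ((2 * S ^ 2) * (2 * S ^ 2)) + (- 1 / S) / 2
        = - (S * (C / S) ^ 4 / C ^ 2)"
    proof -
      have "(S * (2 * S ^ 2) - C * (2 * (2 * S * C))) / ((2 * S ^ 2) * (2 * S ^ 2)) + (- 1 / S) / 2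
         = - (C ^ 2) / S ^ 3"
        using S by (simp add: divide_simps) algebra
      then show ?thesis using S by (simp add: field_simps power2_eq_square power3_eq_cube power4_eq_xxxx)
    qed
    ultimately show ?thesis by (simp add: cth_def C_def S_def)
  qed
  moreover have "((\<lambda>s. cosh s / (2 * sinh s ^ 2) + Lam s / 2) \<longlongrightarrow> 0) at_top"
    unfolding cosh_def sinh_def Lam_def by (simp, real_asymp)
  ultimately show ?thesis using Xint_rec[of "\<lambda>s. cosh s / (2 * sinh s ^ 2) + Lam s / 2" 4 s] s by simp
qed

section \<open>The coefficient functions and their partial derivatives\<close>

text \<open>By the subtraction formula, \<open>Iint j t w\<close> is the integral over
  \<open>m \<ge> t\<close> of
  \<open>sinh (m - t) * (- cth m) ^ j * gam m * exp (- 2 * w * cth m)\<close>. Its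
  \<open>t\<close>-derivative \<open>Jint\<close> has \<open>- cosh (m - t)\<close> in place of
  \<open>sinh (m - t)\<close>.\<close>

definition Iint :: "nat \<Rightarrow> real \<Rightarrow> real \<Rightarrow> real" where
  "Iint j t w = cosh t * Aint j t w + sinh t * Aint (Suc j) t w"

definition Jint :: "nat \<Rightarrow> real \<Rightarrow> real \<Rightarrow> real" where
  "Jint j t w = sinh t * Aint j t w + cosh t * Aint (Suc j) t w"

text \<open>The boundary term at \<open>m = t\<close> in the \<open>t\<close>-derivative of
  \<open>Jint\<close>.\<close>

definition Fk :: "nat \<Rightarrow> real \<Rightarrow> real \<Rightarrow> real" where
  "Fk j t w = (- cth t) ^ j * gam t * exp (- 2 * w * cth t)"

lemma Akern_eq: "Akern j w t = sinh t * Fk j t w"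
  by (simp add: Akern_def Fk_def)

lemma sinh_Fk_Suc: "t > 0 \<Longrightarrow> sinh t * Fk (Suc j) t w = - cosh t * Fk j t w"
  by (simp add: Fk_def cth_def)

lemma Iint_deriv_curve:
  assumes "s x > 0" "(s has_real_derivative s') (at x)" "(w has_real_derivative w') (at x)"
  shows "((\<lambda>x. Iint j (s x) (w x)) has_real_derivative
    Jint j (s x) (w x) * s' + 2 * Iint (Suc j) (s x) (w x) * w') (at x)"
  unfolding Iint_def Jint_def
  by (rule derivative_eq_intros assms Aint_deriv_curve refl)+
    (use assms(1) in \<open>simp add: Akern_eq sinh_Fk_Suc algebra_simps\<close>)

lemma Jint_deriv_curve:
  assumes "s x > 0" "(s has_real_derivative s') (at x)" "(w has_real_derivative w') (at x)"
  shows "((\<lambda>x. Jint j (s x) (w x)) has_real_derivative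
    (Iint j (s x) (w x) + Fk j (s x) (w x)) * s' + 2 * Jint (Suc j) (s x) (w x) * w') (at x)"
proof -
  have "cosh (s x) * (cosh (s x) * (s' * Fk j (s x) (w x)))
      = s' * Fk j (s x) (w x) + sinh (s x) * (sinh (s x) * (s' * Fk j (s x) (w x)))"
    using cosh_sq[of "s x"] by algebra
  then show ?thesis
    unfolding Iint_def Jint_def
    by - ((rule derivative_eq_intros assms Aint_deriv_curve refl)+,
      use assms(1) in \<open>simp add: Akern_eq sinh_Fk_Suc algebra_simps\<close>)
qed

text \<open>Index 0 is the arctangent term of \<open>Ltilde\<close>. Each later index solves the
  relation later called \<open>neumann\<close> with its predecessor; the free multiple of
  \<open>sinh\<close> is fixed by requiring that the quotient by \<open>sinh\<close> tends to 0. The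
  catch-all clause stands for index 3.\<close>

fun aco :: "nat \<Rightarrow> real \<Rightarrow> real" where
  "aco 0 t = 2 * kap * theta t * cosh t"
| "aco (Suc 0) t = - kap"
| "aco (Suc (Suc 0)) t = kap * sinh t * Lam t"
| "aco _ t = kap * (cosh t * Lam t - 2)"

fun aco' :: "nat \<Rightarrow> real \<Rightarrow> real" where
  "aco' 0 t = 2 * kap * theta t * sinh t - kap"
| "aco' (Suc 0) t = 0"
| "aco' (Suc (Suc 0)) t = kap * (cosh t * Lam t - 1)"
| "aco' _ t = kap * (sinh t * Lam t - cosh t / sinh t)"

fun aco'' :: "nat \<Rightarrow> real \<Rightarrow> real" where
  "aco'' 0 t = 2 * kap * theta t * cosh t - kap * (sinh t / cosh t)"
| "aco'' (Suc 0) t = 0"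
| "aco'' (Suc (Suc 0)) t = kap * (sinh t * Lam t - cosh t / sinh t)"
| "aco'' _ t = kap * (cosh t * Lam t - 1 + 1 / sinh t ^ 2)"

lemma aco_deriv: "t > 0 \<Longrightarrow> (aco j has_real_derivative aco' j t) (at t)"
  by (cases "(j, t)" rule: aco.cases)
    (auto simp: aco.simps[abs_def] field_simps intro!: derivative_eq_intros theta_deriv Lam_deriv)

lemma aco'_deriv: "t > 0 \<Longrightarrow> (aco' j has_real_derivative aco'' j t) (at t)"
  by (cases "(j, t)" rule: aco.cases)
    ((auto simp: aco'.simps[abs_def] field_simps cosh_sq power2_eq_square[of "cosh t", symmetric]
      intro!: derivative_eq_intros theta_deriv Lam_deriv)[1],
     (simp add: power2_eq_square power4_eq_xxxx)?)+

text \<open>\<open>kf 0 t w = Ltilde t w\<close>, and in particular \<open>kf 0 t 0 = Ufun t\<close>. The subscripts in \<open>kt\<close>, \<open>kw\<close>, \<open>ktt\<close>, \<open>ktw\<close>,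
  \<open>kww\<close> denote partial derivatives.\<close>

definition "kf j t w = aco j t + Iint j t w"
definition "kt j t w = aco' j t + Jint j t w"
definition "ktt j t w = aco'' j t + Iint j t w + Fk j t w"
definition "kw j t w = 2 * Iint (Suc j) t w"
definition "ktw j t w = 2 * Jint (Suc j) t w"
definition "kww j t w = 4 * Iint (Suc (Suc j)) t w"

lemma kf_deriv_curve:
  assumes "s x > 0" "(s has_real_derivative s') (at x)" "(w has_real_derivative w') (at x)"
  shows "((\<lambda>x. kf j (s x) (w x)) has_real_derivative kt j (s x) (w x) * s' + kw j (s x) (w x) * w') (at x)"
    and "((\<lambda>x. kt j (s x) (w x)) has_real_derivative ktt j (s x) (w x) * s' + ktw j (s x) (w x) * w') (at x)"
    and "((\<lambda>x. kw j (s x) (w x)) has_real_derivative ktw j (s x) (w x) * s' + kww j (s x) (w x) * w') (at x)"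
  unfolding kf_def kt_def ktt_def kw_def ktw_def kww_def
  by (rule derivative_eq_intros Iint_deriv_curve Jint_deriv_curve
      DERIV_chain2[OF aco_deriv] DERIV_chain2[OF aco'_deriv] assms refl
      | simp add: algebra_simps)+

section \<open>The two data functions\<close>

lemma arccoth_deriv:
  assumes "r > 1" shows "(arccoth has_real_derivative - 1 / (r ^ 2 - 1)) (at r)"
proof -
  have "(arccoth has_real_derivative 1 / 2 * (1 / ((r + 1) / (r - 1)) * (((r - 1) - (r + 1)) / ((r - 1) * (r - 1))))) (at r)"
    unfolding arccoth_def[abs_def] using assms
    by (auto intro!: derivative_eq_intros) (simp add: divide_simps, algebra?)
  moreover have "1 / 2 * (1 / ((r + 1) / (r - 1)) * (((r - 1) - (r + 1)) / ((r - 1) * (r - 1)))) = - 1 / (r ^ 2 - 1)"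
  proof -
    have "r ^ 2 - 1 = (r + 1) * (r - 1)" by (simp add: algebra_simps power2_eq_square)
    then show ?thesis using assms by (simp add: divide_simps)
  qed
  ultimately show ?thesis by simp
qed

lemma arccoth_cth: "m > 0 \<Longrightarrow> arccoth (cth m) = m"
proof -
  assume m: "m > 0"
  have "(cth m + 1) / (cth m - 1) = exp m / exp (- m)"
  proof -
    have "cosh m + sinh m = exp m" "cosh m - sinh m = exp (- m)"
      by (rule cosh_plus_sinh cosh_minus_sinh)+
    moreover have "(cth m + 1) / (cth m - 1) = (cosh m + sinh m) / (cosh m - sinh m)"
      using m by (simp add: cth_def divide_simps)
    ultimately show ?thesis by simp
  qed
  also have "\<dots> = exp (2 * m)" by (simp flip: exp_diff)
  finally show ?thesis by (simp add: arccoth_def)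
qed

lemma arccoth_pos: "r > 1 \<Longrightarrow> arccoth r > 0"
  unfolding arccoth_def by (intro mult_pos_pos ln_gt_zero) (auto simp: divide_simps)

lemma cth_arccoth: "r > 1 \<Longrightarrow> cth (arccoth r) = r"
proof -
  assume r: "r > 1"
  define m where "m = arccoth r"
  have "exp m ^ 2 = exp (ln ((r + 1) / (r - 1)))"
    by (simp add: m_def arccoth_def flip: exp_double)
  also have "\<dots> = (r + 1) / (r - 1)"
    using r by (intro exp_ln) auto
  finally have "exp m ^ 2 = (r + 1) / (r - 1)" .
  then have e: "exp m ^ 2 * (r - 1) = r + 1" using r by simp
  have "cosh m = r * sinh m"
  proof -
    have "exp m * (2 * cosh m) = exp m ^ 2 + 1" "exp m * (2 * sinh m) = exp m ^ 2 - 1"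
      by (simp_all add: cosh_def sinh_def algebra_simps power2_eq_square flip: exp_add)
    then have "exp m * (2 * cosh m) = exp m * (2 * (r * sinh m))"
      using e by algebra
    then show ?thesis by simp
  qed
  moreover have "sinh m \<noteq> 0" using arccoth_pos[OF r] by (simp add: m_def)
  ultimately show ?thesis by (simp add: cth_def m_def)
qed

lemma gfun_cth:
  assumes "m > 0" shows "gfun (cth m) = - gam m * sinh m ^ 3"
proof -
  define C S where "C = cosh m" and "S = sinh m"
  have S: "S > 0" "C > 0" using assms by (auto simp: S_def C_def)
  have CS: "C ^ 2 = 1 + S ^ 2" by (simp add: C_def S_def cosh_sq)
  have x: "(C / S) ^ 2 - 1 = (1 / S) ^ 2" using S CS by (simp add: divide_simps)
  have sq: "sqrt ((C / S) ^ 2 - 1) = 1 / S" unfolding x using S by simp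
  have k: "1 / (16 * sqrt 2) = kap / 8" by (simp add: kap_def)
  have "gfun (cth m) = (8 - 25 * (C / S) ^ 2 + 15 * (C / S) ^ 4 - 15 * (C / S) * ((1 / S) ^ 2) ^ 2 * m) /
     (16 * sqrt 2 * (C / S) * (1 / S))"
    unfolding gfun_def arccoth_cth[OF assms] using x sq by (simp add: cth_def C_def S_def)
  also have "\<dots> = kap / 8 * ((8 - 25 * (C / S) ^ 2 + 15 * (C / S) ^ 4 - 15 * (C / S) * ((1 / S) ^ 2) ^ 2 * m) /
     ((C / S) * (1 / S)))"
    unfolding k[symmetric] by simp
  also have "(8 - 25 * (C / S) ^ 2 + 15 * (C / S) ^ 4 - 15 * (C / S) * ((1 / S) ^ 2) ^ 2 * m) / ((C / S) * (1 / S))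
    = - (15 * m + 25 * C * S ^ 3 - 8 * S ^ 5 / C - 15 * C ^ 3 * S) / S ^ 3"
    using S by (simp add: divide_simps) algebra
  also have "kap / 8 * \<dots> = - gam m * S ^ 3"
    using S by (simp add: gam_def gam_num_def C_def[symmetric] S_def[symmetric] divide_simps)
  finally show ?thesis by (simp add: S_def)
qed

text \<open>Under \<open>r = coth m\<close> the integral runs over \<open>m \<ge> s\<close>, and a
  primitive in \<open>r\<close> is a combination \<open>G\<close> of the tail integrals
  \<open>Aint\<close>. The singular end \<open>r = 1\<close> corresponds to \<open>m\<close> at
  infinity, where \<open>G\<close> vanishes.\<close>

lemma Ltilde_eq:
  assumes "s > 0" shows "Ltilde s w = kf 0 s w"
proof -
  define G where "G r = cosh s * Aint 0 (arccoth r) w + sinh s * Aint 1 (arccoth r) w" for r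
  \<comment> \<open>At \<open>r = 1\<close> the formulas for \<open>arccoth\<close> and
    \<open>gfun\<close> divide by 0. The continuous extension by 0 allows the version of the
    fundamental theorem that asks for a derivative only in the open interval.\<close>
  define P where "P r = (if r \<le> 1 then 0 else G r)" for r
  define X where "X = cosh s / sinh s"
  have X: "X > 1" using cth_gt_1[OF assms] by (simp add: X_def cth_def)
  have derG: "(G has_real_derivative (r * sinh s - cosh s) * exp (- 2 * w * r) * gfun r) (at r)" if r: "r > 1" for r
  proof -
    define m where "m = arccoth r"
    have m: "m > 0" "cth m = r" using arccoth_pos[OF r] cth_arccoth[OF r] by (auto simp: m_def)
    define C S where "C = cosh m" and "S = sinh m"
    have S: "S > 0" "C = r * S" "C ^ 2 = 1 + S ^ 2" using m by (auto simp: S_def C_def cth_def cosh_sq)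
    have S2: "(r ^ 2 - 1) * S ^ 2 = 1" using S(2,3) by (simp add: algebra_simps power_mult_distrib)
    then have r2: "1 / (r ^ 2 - 1) = S ^ 2" using S(1) by (metis mult_zero_left nonzero_mult_div_cancel_left zero_neq_one)
    have "(G has_real_derivative cosh s * (- Akern 0 w m * (- 1 / (r ^ 2 - 1)))
       + sinh s * (- Akern 1 w m * (- 1 / (r ^ 2 - 1)))) (at r)"
      unfolding G_def[abs_def] m_def
      using r m unfolding m_def
      by (intro DERIV_add DERIV_cmult DERIV_chain2[OF Aint_deriv_s arccoth_deriv])
    moreover have "cosh s * (- Akern 0 w m * (- 1 / (r ^ 2 - 1))) + sinh s * (- Akern 1 w m * (- 1 / (r ^ 2 - 1)))
      = (r * sinh s - cosh s) * exp (- 2 * w * r) * gfun r"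
    proof -
      have "gfun r = - gam m * S ^ 3" using gfun_cth[OF m(1)] m(2) by (simp add: S_def)
      moreover have "- 1 / (r ^ 2 - 1) = - (S ^ 2)" using r2 by simp
      ultimately show ?thesis
        by (simp add: Akern_def m(2) S_def[symmetric] algebra_simps power2_eq_square power3_eq_cube)
    qed
    ultimately show ?thesis by simp
  qed
  have lim: "(G \<longlongrightarrow> 0) (at_right 1)"
  proof -
    have "filterlim arccoth at_top (at_right 1)"
      unfolding arccoth_def[abs_def] by real_asymp
    from filterlim_compose[OF Aint_tendsto_0 this]
    have "((\<lambda>r. cosh s * Aint 0 (arccoth r) w + sinh s * Aint 1 (arccoth r) w) \<longlongrightarrow> cosh s * 0 + sinh s * 0) (at_right 1)"
      by (intro tendsto_intros)
    then show ?thesis by (simp add: G_def[abs_def])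
  qed
  have "((\<lambda>r. (r * sinh s - cosh s) * exp (- 2 * w * r) * gfun r) has_integral (P X - P 1)) {1..X}"
  proof (rule fundamental_theorem_of_calculus_interior)
    have der: "(P has_real_derivative (r * sinh s - cosh s) * exp (- 2 * w * r) * gfun r) (at r)" if "r > 1" for r
      by (rule DERIV_cong_ev[THEN iffD2, OF refl _ refl derG[OF that]])
        (use that in \<open>auto simp: P_def intro: eventually_mono[OF eventually_nhds_in_open[of "{1<..}"]]\<close>)
    then show "(P has_vector_derivative (r * sinh s - cosh s) * exp (- 2 * w * r) * gfun r) (at r)"
      if "r \<in> {1<..<X}" for r
      using that by (simp add: has_real_derivative_iff_has_vector_derivative)
    show "continuous_on {1..X} P"
    proof (subst continuous_on_eq_continuous_within, intro ballI)
      fix r assume "r \<in> {1..X}"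
      then consider "r = 1" | "r > 1" by fastforce
      then show "continuous (at r within {1..X}) P"
      proof cases
        case 1
        have "(P \<longlongrightarrow> 0) (at_right 1)"
          by (rule tendsto_cong[THEN iffD2, OF _ lim]) (auto simp: P_def eventually_at_filter)
        moreover have "at 1 within {1..X} = at_right 1"
          using X by (simp add: at_within_Icc_at_right)
        ultimately show ?thesis by (simp add: continuous_within 1 P_def)
      next
        case 2
        then show ?thesis using der DERIV_isCont continuous_at_imp_continuous_at_within by blast
      qed
    qed
  qed (use X in auto)
  moreover have "P X - P 1 = Iint 0 s w"
    using X arccoth_cth[OF assms] by (simp add: P_def G_def Iint_def X_def cth_def)
  ultimately have "integral {1..X} (\<lambda>r. (r * sinh s - cosh s) * exp (- 2 * w * r) * gfun r) = Iint 0 s w"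
    by (simp add: integral_unique)
  moreover have "1 / sqrt 2 = 2 * kap" by (simp add: kap_def)
  ultimately show ?thesis
    unfolding Ltilde_def X_def by (simp add: kf_def theta_def)
qed

lemma kt_0_0: "t > 0 \<Longrightarrow> kt 0 t 0 * cosh t - kf 0 t 0 * sinh t = - (kap * cosh t) - Xint 1 t"
  using cosh_sq[of t]
  by (simp add: kt_def kf_def Iint_def Jint_def Xint_def) algebra

text \<open>Expanding the multiple angles shows that the bracket in \<open>Hfun\<close> is the
  closed form of \<open>Xint 1\<close> in disguise. Together with \<open>kt_0_0\<close> this makes
  \<open>Hfun\<close> minus the derivative of \<open>kf 0 t 0 / cosh t\<close>.\<close>

lemma Hfun_eq:
  assumes "t > 0" shows "Hfun t = (kap * cosh t + Xint 1 t) / cosh t ^ 2"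
proof -
  define C S where "C = cosh t" and "S = sinh t"
  have S: "S > 0" "C > 0" using assms by (auto simp: S_def C_def)
  have CS: "C ^ 2 = 1 + S ^ 2" by (simp add: C_def S_def cosh_sq)
  have d2: "sinh (2 * t) = 2 * S * C" unfolding S_def C_def by (rule sinh_double)
  have c2: "cosh (2 * t) = 1 + 2 * S ^ 2" unfolding S_def by (simp add: cosh_double cosh_sq)
  have d4: "sinh (4 * t) = 2 * (2 * S * C) * (1 + 2 * S ^ 2)"
    using sinh_double[of "2 * t"] d2 c2 by simp
  have d6: "sinh (6 * t) = 2 * S * C * (2 * (1 + 2 * S ^ 2) ^ 2 - 1) + (1 + 2 * S ^ 2) * (2 * (2 * S * C) * (1 + 2 * S ^ 2))"
  proof -
    have "sinh (6 * t) = sinh (2 * t + 4 * t)" by simp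
    also have "\<dots> = sinh (2 * t) * cosh (4 * t) + cosh (2 * t) * sinh (4 * t)"
      by (rule sinh_add)
    also have "cosh (4 * t) = 2 * (1 + 2 * S ^ 2) ^ 2 - 1"
      using cosh_double_cosh[of "2 * t"] c2 by simp
    finally show ?thesis by (simp add: d2 c2 d4)
  qed
  have k: "3 / sqrt 2 = 6 * kap" by (simp add: kap_def)
  have "Hfun t = (3 / sqrt 2) / (S ^ 5 * C ^ 2) * (t / 16 - sinh (2 * t) / 64 - sinh (4 * t) / 64 + sinh (6 * t) / 192)"
    unfolding Hfun_def S_def C_def by simp
  also have "\<dots> = 6 * kap / (S ^ 5 * C ^ 2) * (t / 16 - 3 / 48 * S * C + S ^ 3 * C / 24 + S ^ 5 * C / 6)"
  proof -
    have "t / 16 - sinh (2 * t) / 64 - sinh (4 * t) / 64 + sinh (6 * t) / 192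
        = t / 16 - 3 / 48 * S * C + S ^ 3 * C / 24 + S ^ 5 * C / 6"
      unfolding d2 d4 d6 by (simp add: field_simps eval_nat_numeral)
    then show ?thesis unfolding k by simp
  qed
  also have "\<dots> = (kap * C + (S * gam t + kap / C) / 5) / C ^ 2"
  proof -
    have g: "S ^ 6 * gam t = kap * (15 * t + 25 * C * S ^ 3 - 8 * S ^ 5 / C - 15 * C ^ 3 * S) / 8"
      using S by (simp add: gam_def gam_num_def C_def[symmetric] S_def[symmetric])
    have "S ^ 5 * (kap * C + (S * gam t + kap / C) / 5) = kap * C * S ^ 5 + S ^ 6 * gam t / 5 + S ^ 5 * kap / (5 * C)"
      by (simp add: algebra_simps eval_nat_numeral)
    also have "\<dots> = 6 * kap * (t / 16 - 3 / 48 * S * C + S ^ 3 * C / 24 + S ^ 5 * C / 6)"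
    proof -
      have "C ^ 3 = C * (1 + S ^ 2)" using CS by (simp add: power3_eq_cube power2_eq_square)
      then show ?thesis unfolding g using S by (simp add: field_simps) (simp add: algebra_simps eval_nat_numeral)
    qed
    finally have "kap * C + (S * gam t + kap / C) / 5 =
        6 * kap * (t / 16 - 3 / 48 * S * C + S ^ 3 * C / 24 + S ^ 5 * C / 6) / S ^ 5"
      using S by (simp add: eq_divide_eq mult.commute)
    then show ?thesis by simp
  qed
  finally show ?thesis using Xint_1[OF assms] by (simp add: C_def S_def)
qed

lemma inv_sinh_lims:
  "((\<lambda>t::real. cosh t / sinh t) \<longlongrightarrow> 1) at_top"
  unfolding cosh_def sinh_def by (simp, real_asymp)

lemma Ufun_eq:
  assumes "t > 0" shows "Ufun t = kf 0 t 0"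
proof -
  have "(Hfun has_integral (0 - - (kf 0 t 0 / cosh t))) {t..}"
  proof (rule has_integral_atLeast_antiderivative)
    fix x assume "x \<ge> t"
    then have x: "x > 0" using assms by simp
    have "((\<lambda>x. kf 0 x 0) has_real_derivative kt 0 x 0) (at x)"
      using kf_deriv_curve(1)[of "\<lambda>x. x" x 1 "\<lambda>_. 0" 0 0] x by simp
    then have "((\<lambda>t. - (kf 0 t 0 / cosh t)) has_real_derivative
        - ((kt 0 x 0 * cosh x - kf 0 x 0 * sinh x) / (cosh x * cosh x))) (at x)"
      by (auto intro!: derivative_eq_intros)
    then show "((\<lambda>t. - (kf 0 t 0 / cosh t)) has_real_derivative Hfun x) (at x)"
      unfolding kt_0_0[OF x] Hfun_eq[OF x]
      by (rule DERIV_cong) (simp only: power2_eq_square minus_divide_left, simp)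
  next
    have t: "((\<lambda>x::real. sinh x / cosh x) \<longlongrightarrow> 1) at_top"
      unfolding cosh_def sinh_def by (simp, real_asymp)
    have "((\<lambda>x. - (2 * kap * theta x + Aint 0 x 0 + sinh x / cosh x * Aint 1 x 0)) \<longlongrightarrow>
       - (2 * kap * 0 + 0 + 1 * 0)) at_top"
      by (intro tendsto_intros theta_tendsto_0 Aint_tendsto_0 t)
    moreover have "kf 0 x 0 / cosh x = 2 * kap * theta x + Aint 0 x 0 + sinh x / cosh x * Aint 1 x 0" for x
      by (simp add: kf_def Iint_def add_divide_distrib)
    ultimately show "((\<lambda>x. - (kf 0 x 0 / cosh x)) \<longlongrightarrow> 0) at_top"
      by simp
  qed
  then have "integral {t..} Hfun = kf 0 t 0 / cosh t"
    by (simp add: integral_unique)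
  then show ?thesis by (simp add: Ufun_def)
qed

section \<open>The reflection operator\<close>

text \<open>\<open>neumann k l\<close> expresses \<open>l = - coth k + Top k / sinh\<close> as a differential relation. It says
  that \<open>k t cosh \<sigma> + l t sinh \<sigma>\<close> satisfies the reflection condition on \<open>\<sigma> = t\<close>.\<close>

definition neumann :: "(real \<Rightarrow> real) \<Rightarrow> (real \<Rightarrow> real) \<Rightarrow> bool" where
  "neumann k l \<longleftrightarrow>
     (\<exists>k' l'. \<forall>t>0. (k has_real_derivative k' t) (at t) \<and> (l has_real_derivative l' t) (at t) \<and>
        k' t * cosh t + l' t * sinh t = k t * sinh t + l t * cosh t) \<and>
     ((\<lambda>t. k t / sinh t) \<longlongrightarrow> 0) at_top \<and> ((\<lambda>t. l t / sinh t) \<longlongrightarrow> 0) at_top"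

lemma neumannI:
  assumes "\<And>t. t > 0 \<Longrightarrow> (k has_real_derivative k' t) (at t)"
    "\<And>t. t > 0 \<Longrightarrow> (l has_real_derivative l' t) (at t)"
    "\<And>t. t > 0 \<Longrightarrow> k' t * cosh t + l' t * sinh t = k t * sinh t + l t * cosh t"
    "((\<lambda>t. k t / sinh t) \<longlongrightarrow> 0) at_top" "((\<lambda>t. l t / sinh t) \<longlongrightarrow> 0) at_top"
  shows "neumann k l"
  unfolding neumann_def using assms by blast

lemma neumannE:
  assumes "neumann k l" "t > 0"
  obtains k' l' where "(k has_real_derivative k') (at t)" "(l has_real_derivative l') (at t)"
    "k' * cosh t + l' * sinh t = k t * sinh t + l t * cosh t" "l' = k t + cth t * l t - cth t * k'"
proof -
  obtain k' l' where 1: "(k has_real_derivative k' t) (at t)" "(l has_real_derivative l' t) (at t)"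
    "k' t * cosh t + l' t * sinh t = k t * sinh t + l t * cosh t"
    using assms by (auto simp: neumann_def)
  then have "l' t = k t + cth t * l t - cth t * k' t"
    using assms(2) by (simp add: cth_def divide_simps) (simp add: algebra_simps)
  with 1 that show ?thesis by blast
qed

lemma neumann_combine:
  assumes "neumann k l" "neumann m n"
  shows "neumann (\<lambda>t. a * k t + b * m t) (\<lambda>t. a * l t + b * n t)"
proof -
  obtain k' l' where 1: "\<And>t. t > 0 \<Longrightarrow> (k has_real_derivative k' t) (at t) \<and> (l has_real_derivative l' t) (at t) \<and>
        k' t * cosh t + l' t * sinh t = k t * sinh t + l t * cosh t"
    using assms(1) by (auto simp: neumann_def)
  obtain m' n' where 2: "\<And>t. t > 0 \<Longrightarrow> (m has_real_derivative m' t) (at t) \<and> (n has_real_derivative n' t) (at t) \<and>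
        m' t * cosh t + n' t * sinh t = m t * sinh t + n t * cosh t"
    using assms(2) by (auto simp: neumann_def)
  show ?thesis
  proof (rule neumannI[of _ "\<lambda>t. a * k' t + b * m' t" _ "\<lambda>t. a * l' t + b * n' t"])
    fix t :: real assume t: "t > 0"
    show "((\<lambda>t. a * k t + b * m t) has_real_derivative a * k' t + b * m' t) (at t)"
      "((\<lambda>t. a * l t + b * n t) has_real_derivative a * l' t + b * n' t) (at t)"
      using 1[OF t] 2[OF t] by (auto intro!: DERIV_add DERIV_cmult)
    show "(a * k' t + b * m' t) * cosh t + (a * l' t + b * n' t) * sinh t =
       (a * k t + b * m t) * sinh t + (a * l t + b * n t) * cosh t"
      using 1[OF t] 2[OF t] by algebra
  next
    have *: "((\<lambda>t. a * (f t / sinh t) + b * (g t / sinh t)) \<longlongrightarrow> a * 0 + b * 0) at_top"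
      if "((\<lambda>t. f t / sinh t) \<longlongrightarrow> 0) at_top" "((\<lambda>t. g t / sinh t) \<longlongrightarrow> 0) at_top" for f g :: "real \<Rightarrow> real"
      by (intro tendsto_intros that)
    show "((\<lambda>t. (a * k t + b * m t) / sinh t) \<longlongrightarrow> 0) at_top"
      "((\<lambda>t. (a * l t + b * n t) / sinh t) \<longlongrightarrow> 0) at_top"
      using *[of k m] *[of l n] assms by (simp_all add: neumann_def add_divide_distrib)
  qed
qed

text \<open>The new pair consists of the coefficients of \<open>cosh \<sigma>\<close> and
  \<open>sinh \<sigma>\<close> in \<open>k (t + d) * cosh (\<sigma> + d) + l (t + d) * sinh
  (\<sigma> + d)\<close>. The reflection condition at \<open>\<sigma> = t\<close> is invariant under
  shifting both variables by \<open>d\<close>.\<close>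

lemma neumann_shift:
  assumes "neumann k l" "d \<ge> 0"
  shows "neumann (\<lambda>t. k (t + d) * cosh d + l (t + d) * sinh d) (\<lambda>t. k (t + d) * sinh d + l (t + d) * cosh d)"
proof -
  obtain k' l' where 1: "\<And>t. t > 0 \<Longrightarrow> (k has_real_derivative k' t) (at t) \<and> (l has_real_derivative l' t) (at t) \<and>
        k' t * cosh t + l' t * sinh t = k t * sinh t + l t * cosh t"
    using assms(1) by (auto simp: neumann_def)
  show ?thesis
  proof (rule neumannI[of _ "\<lambda>t. k' (t + d) * cosh d + l' (t + d) * sinh d" _
      "\<lambda>t. k' (t + d) * sinh d + l' (t + d) * cosh d"])
    fix t :: real assume t: "t > 0"
    then have td: "t + d > 0" using assms by simp
    have k: "((\<lambda>t. k (t + d)) has_real_derivative k' (t + d)) (at t)"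
      and l: "((\<lambda>t. l (t + d)) has_real_derivative l' (t + d)) (at t)"
      using 1[OF td] by (simp_all add: DERIV_shift)
    show "((\<lambda>t. k (t + d) * cosh d + l (t + d) * sinh d) has_real_derivative
        k' (t + d) * cosh d + l' (t + d) * sinh d) (at t)"
      "((\<lambda>t. k (t + d) * sinh d + l (t + d) * cosh d) has_real_derivative
        k' (t + d) * sinh d + l' (t + d) * cosh d) (at t)"
      by (auto intro!: DERIV_add DERIV_cmult_right k l)
    show "(k' (t + d) * cosh d + l' (t + d) * sinh d) * cosh t + (k' (t + d) * sinh d + l' (t + d) * cosh d) * sinh t =
       (k (t + d) * cosh d + l (t + d) * sinh d) * sinh t + (k (t + d) * sinh d + l (t + d) * cosh d) * cosh t"
      using 1[OF td] by (simp add: cosh_add sinh_add algebra_simps)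
  next
    have sh: "filterlim (\<lambda>t. t + d) at_top at_top" by real_asymp
    have kl: "((\<lambda>t. k (t + d) / sinh (t + d)) \<longlongrightarrow> 0) at_top" "((\<lambda>t. l (t + d) / sinh (t + d)) \<longlongrightarrow> 0) at_top"
      using filterlim_compose[OF _ sh, of "\<lambda>t. k t / sinh t"] filterlim_compose[OF _ sh, of "\<lambda>t. l t / sinh t"] assms
      by (auto simp: neumann_def)
    have q: "((\<lambda>t::real. sinh (t + d) / sinh t) \<longlongrightarrow> cosh d + 1 * sinh d) at_top"
    proof -
      have "((\<lambda>t::real. cosh d + cosh t / sinh t * sinh d) \<longlongrightarrow> cosh d + 1 * sinh d) at_top"
        by (intro tendsto_intros inv_sinh_lims)
      then show ?thesis
        by (rule tendsto_cong[THEN iffD1, rotated])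
          (auto simp: eventually_at_top_dense sinh_add field_simps intro!: exI[of _ 0])
    qed
    have *: "((\<lambda>t. (k (t + d) * a + l (t + d) * b) / sinh t) \<longlongrightarrow> 0) at_top" for a b
    proof -
      have "((\<lambda>t. (k (t + d) / sinh (t + d) * a + l (t + d) / sinh (t + d) * b) * (sinh (t + d) / sinh t))
         \<longlongrightarrow> (0 * a + 0 * b) * (cosh d + 1 * sinh d)) at_top"
        by (intro tendsto_intros kl q)
      then have "((\<lambda>t. (k (t + d) / sinh (t + d) * a + l (t + d) / sinh (t + d) * b) * (sinh (t + d) / sinh t))
         \<longlongrightarrow> 0) at_top" by simp
      then show ?thesis
        by (rule tendsto_cong[THEN iffD1, rotated])
          (use assms in \<open>auto simp: eventually_at_top_dense field_simps intro!: exI[of _ 0]\<close>)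
    qed
    show "((\<lambda>t. (k (t + d) * cosh d + l (t + d) * sinh d) / sinh t) \<longlongrightarrow> 0) at_top"
      "((\<lambda>t. (k (t + d) * sinh d + l (t + d) * cosh d) / sinh t) \<longlongrightarrow> 0) at_top"
      by (rule *)+
  qed
qed

text \<open>The relation splits: for the parts \<open>Iint\<close> and \<open>Jint\<close> it is an
  identity in the tail integrals for every \<open>j\<close>, and for \<open>aco\<close> it holds
  along the indices 0 to 3, whence the bound on \<open>j\<close>.\<close>

lemma neumann_kf:
  assumes "j \<le> 2" shows "neumann (\<lambda>t. kf j t w) (\<lambda>t. kf (Suc j) t w)"
proof (rule neumannI[of _ "\<lambda>t. kt j t w" _ "\<lambda>t. kt (Suc j) t w"])
  fix t :: real assume t: "t > 0"
  show "((\<lambda>t. kf j t w) has_real_derivative kt j t w) (at t)"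
    "((\<lambda>t. kf (Suc j) t w) has_real_derivative kt (Suc j) t w) (at t)"
    using kf_deriv_curve(1)[of "\<lambda>x. x" t 1 "\<lambda>_. w" 0] t by simp_all
  have c: "j = 0 \<or> j = 1 \<or> j = 2" using assms by auto
  show "kt j t w * cosh t + kt (Suc j) t w * sinh t = kf j t w * sinh t + kf (Suc j) t w * cosh t"
    using t c cosh_sq[of t]
    by (auto simp: kt_def kf_def Iint_def Jint_def numeral_2_eq_2 field_simps power2_eq_square)
next
  have *: "((\<lambda>t. kf j t w / sinh t) \<longlongrightarrow> 0) at_top" if "j \<le> 3" for j
  proof -
    have "((\<lambda>t. aco j t / sinh t) \<longlongrightarrow> 0) at_top"
    proof -
      have "j = 0 \<or> j = 1 \<or> j = 2 \<or> j = 3" using that by auto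
      moreover have "((\<lambda>t. 2 * kap * (theta t * (cosh t / sinh t))) \<longlongrightarrow> 2 * kap * (0 * 1)) at_top"
        "((\<lambda>t::real. - kap * (1 / sinh t)) \<longlongrightarrow> - kap * 0) at_top"
        "((\<lambda>t. kap * (Lam t * (cosh t / sinh t) - 2 * (1 / sinh t))) \<longlongrightarrow> kap * (0 * 1 - 2 * 0)) at_top"
        by (intro tendsto_intros inv_sinh_lims theta_tendsto_0 Lam_tendsto_0 inverse_sinh_tendsto_0)+
      moreover have "((\<lambda>t. kap * sinh t * Lam t / sinh t) \<longlongrightarrow> 0) at_top"
      proof (rule tendsto_cong[THEN iffD1])
        show "((\<lambda>t. kap * Lam t) \<longlongrightarrow> 0) at_top"
          using tendsto_mult_right_zero[OF Lam_tendsto_0] by simp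
      qed (auto simp: eventually_at_top_dense intro!: exI[of _ 0])
      ultimately show ?thesis
        by (auto simp: numeral_2_eq_2 numeral_3_eq_3 algebra_simps diff_divide_distrib)
    qed
    moreover have "((\<lambda>t. Iint j t w / sinh t) \<longlongrightarrow> 0) at_top"
    proof (rule tendsto_cong[THEN iffD1])
      have "((\<lambda>t. cosh t / sinh t * Aint j t w + Aint (Suc j) t w) \<longlongrightarrow> 1 * 0 + 0) at_top"
        by (intro tendsto_intros inv_sinh_lims Aint_tendsto_0)
      then show "((\<lambda>t. cosh t / sinh t * Aint j t w + Aint (Suc j) t w) \<longlongrightarrow> 0) at_top" by simp
    qed (auto simp: eventually_at_top_dense Iint_def field_simps intro!: exI[of _ 0])
    ultimately have "((\<lambda>t. aco j t / sinh t + Iint j t w / sinh t) \<longlongrightarrow> 0 + 0) at_top"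
      by (intro tendsto_intros)
    then show ?thesis by (simp add: kf_def add_divide_distrib)
  qed
  show "((\<lambda>t. kf j t w / sinh t) \<longlongrightarrow> 0) at_top" "((\<lambda>t. kf (Suc j) t w / sinh t) \<longlongrightarrow> 0) at_top"
    using assms by (auto intro!: *)
qed

text \<open>With \<open>c = coth\<close>, the numerator \<open>N = l + c * k\<close> satisfies
  \<open>N' - c * N = - 2 * k / sinh ^ 2\<close>, so \<open>- N / (2 * sinh)\<close> is a primitive
  of the integrand. This ties the integral operator \<open>Top\<close> to the differential
  relation.\<close>

lemma neumann_has_integral_J:
  assumes "neumann k l" "t > 0"
  shows "((\<lambda>r. k r / sinh r ^ 3) has_integral (l t + cth t * k t) / (2 * sinh t)) {t..}"
proof -
  let ?F = "\<lambda>t. (l t + cth t * k t) / (2 * sinh t)"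
  have "((\<lambda>r. k r / sinh r ^ 3) has_integral (0 - - ?F t)) {t..}"
  proof (rule has_integral_atLeast_antiderivative)
    fix x assume "x \<ge> t"
    then have x: "x > 0" using assms by simp
    obtain k' l' where 1: "(k has_real_derivative k') (at x)" "(l has_real_derivative l') (at x)"
        and l': "l' = k x + cth x * l x - cth x * k'"
      using neumannE[OF assms(1) x] by metis
    define S c where "S = sinh x" and "c = cth x"
    have S: "S > 0" and C: "cosh x = c * S" and cs: "c ^ 2 - 1 = 1 / S ^ 2"
      using x cosh_sq[of x] by (auto simp: S_def c_def cth_def divide_simps)
    define N D where "N = l x + c * k x" and "D = l' + ((1 - c ^ 2) * k x + c * k')"
    have "((\<lambda>t. - ?F t) has_real_derivative - ((D * (2 * S) - N * (2 * (c * S))) / ((2 * S) * (2 * S)))) (at x)"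
      unfolding N_def D_def S_def c_def using x
      by (auto intro!: derivative_eq_intros cth_deriv 1 simp: C[unfolded S_def c_def] algebra_simps)
    moreover have "- ((D * (2 * S) - N * (2 * (c * S))) / ((2 * S) * (2 * S))) = k x / S ^ 3"
    proof -
      have "D - N * c = - 2 * k x * (c ^ 2 - 1)"
        unfolding D_def N_def l' c_def by algebra
      then have "(D - N * c) / (2 * S) = - k x / S ^ 3"
        unfolding cs using S by (simp add: power2_eq_square power3_eq_cube)
      moreover have "- ((D * (2 * S) - N * (2 * (c * S))) / ((2 * S) * (2 * S))) = - ((D - N * c) / (2 * S))"
        using S by (simp add: field_simps)
      ultimately show ?thesis by simp
    qed
    ultimately show "((\<lambda>t. - ?F t) has_real_derivative k x / sinh x ^ 3) (at x)"
      by (simp add: S_def)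
  next
    have "((\<lambda>t. - (l t / sinh t + cosh t / sinh t * (k t / sinh t)) / 2) \<longlongrightarrow> - (0 + 1 * 0) / 2) at_top"
      using assms(1) unfolding neumann_def by (intro tendsto_intros inv_sinh_lims) auto
    then show "((\<lambda>t. - ?F t) \<longlongrightarrow> 0) at_top"
      by (simp add: cth_def add_divide_distrib diff_divide_distrib mult_ac)
  qed
  then show ?thesis by simp
qed

text \<open>After eliminating \<open>l'\<close> and \<open>m'\<close> by the two relations,
  \<open>k'\<close> cancels and the numerator satisfies
  \<open>N' - c * N = - 6 * c * k / sinh ^ 2\<close>.\<close>

lemma neumann_has_integral_M:
  assumes "neumann k l" "neumann l m" "t > 0"
  shows "((\<lambda>r. cosh r * k r / sinh r ^ 4) has_integral (2 * cth t ^ 2 * k t + cth t * l t - m t) / (6 * sinh t)) {t..}"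
proof -
  let ?F = "\<lambda>t. (2 * cth t ^ 2 * k t + cth t * l t - m t) / (6 * sinh t)"
  have "((\<lambda>r. cosh r * k r / sinh r ^ 4) has_integral (0 - - ?F t)) {t..}"
  proof (rule has_integral_atLeast_antiderivative)
    fix x assume "x \<ge> t"
    then have x: "x > 0" using assms by simp
    obtain k' l' where 1: "(k has_real_derivative k') (at x)" "(l has_real_derivative l') (at x)"
        and l': "l' = k x + cth x * l x - cth x * k'"
      using neumannE[OF assms(1) x] by metis
    obtain m' where 2: "(m has_real_derivative m') (at x)"
        and m': "m' = l x + cth x * m x - cth x * l'"
      using neumannE[OF assms(2) x] DERIV_unique[OF 1(2)] by metis
    define S c where "S = sinh x" and "c = cth x"
    have S: "S > 0" and C: "cosh x = c * S" and cs: "c ^ 2 - 1 = 1 / S ^ 2"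
      using x cosh_sq[of x] by (auto simp: S_def c_def cth_def divide_simps)
    define N D where "N = 2 * c ^ 2 * k x + c * l x - m x"
      and "D = 2 * (2 * c * (1 - c ^ 2)) * k x + 2 * c ^ 2 * k' + ((1 - c ^ 2) * l x + c * l') - m'"
    have "((\<lambda>t. - ?F t) has_real_derivative - ((D * (6 * S) - N * (6 * (c * S))) / ((6 * S) * (6 * S)))) (at x)"
      unfolding N_def D_def S_def c_def using x
      by (auto intro!: derivative_eq_intros cth_deriv 1 2 simp: C[unfolded S_def c_def] algebra_simps)
    moreover have "- ((D * (6 * S) - N * (6 * (c * S))) / ((6 * S) * (6 * S))) = c * S * k x / S ^ 4"
    proof -
      have "D - N * c = - 6 * c * k x * (c ^ 2 - 1)"
        unfolding D_def N_def m' unfolding l' c_def by algebra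
      then have "(D - N * c) / (6 * S) = - (c * S * k x / S ^ 4)"
        unfolding cs using S by (simp add: power2_eq_square power4_eq_xxxx)
      moreover have "- ((D * (6 * S) - N * (6 * (c * S))) / ((6 * S) * (6 * S))) = - ((D - N * c) / (6 * S))"
        using S by (simp add: field_simps)
      ultimately show ?thesis by simp
    qed
    ultimately show "((\<lambda>t. - ?F t) has_real_derivative cosh x * k x / sinh x ^ 4) (at x)"
      unfolding C by (simp add: S_def)
  next
    have "((\<lambda>t. - (2 * (cosh t / sinh t) ^ 2 * (k t / sinh t) + cosh t / sinh t * (l t / sinh t) - m t / sinh t) / 6)
       \<longlongrightarrow> - (2 * 1 ^ 2 * 0 + 1 * 0 - 0) / 6) at_top"
      using assms(1,2) unfolding neumann_def by (intro tendsto_intros inv_sinh_lims) auto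
    then show "((\<lambda>t. - ?F t) \<longlongrightarrow> 0) at_top"
      by (simp add: cth_def add_divide_distrib diff_divide_distrib mult_ac)
  qed
  then show ?thesis by simp
qed

text \<open>Here the numerator satisfies \<open>N' - c * N = - 12 * k / sinh ^ 4\<close>; the
  additional factor takes a fourth member of the chain.\<close>

lemma neumann_has_integral_Z:
  assumes "neumann k l" "neumann l m" "neumann m n" "t > 0"
  shows "((\<lambda>r. k r / sinh r ^ 5) has_integral
    (n t - cth t * m t + (cth t ^ 2 - 6) * l t + (3 * cth t ^ 3 - 6 * cth t) * k t) / (12 * sinh t)) {t..}"
proof -
  let ?F = "\<lambda>t. (n t - cth t * m t + (cth t ^ 2 - 6) * l t + (3 * cth t ^ 3 - 6 * cth t) * k t) / (12 * sinh t)"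
  have "((\<lambda>r. k r / sinh r ^ 5) has_integral (0 - - ?F t)) {t..}"
  proof (rule has_integral_atLeast_antiderivative)
    fix x assume "x \<ge> t"
    then have x: "x > 0" using assms by simp
    obtain k' l' where 1: "(k has_real_derivative k') (at x)" "(l has_real_derivative l') (at x)"
        and l': "l' = k x + cth x * l x - cth x * k'"
      using neumannE[OF assms(1) x] by metis
    obtain m' where 2: "(m has_real_derivative m') (at x)"
        and m': "m' = l x + cth x * m x - cth x * l'"
      using neumannE[OF assms(2) x] DERIV_unique[OF 1(2)] by metis
    obtain n' where 3: "(n has_real_derivative n') (at x)"
        and n': "n' = m x + cth x * n x - cth x * m'"
      using neumannE[OF assms(3) x] DERIV_unique[OF 2] by metis
    define S c where "S = sinh x" and "c = cth x"
    have S: "S > 0" and C: "cosh x = c * S" and cs: "c ^ 2 - 1 = 1 / S ^ 2"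
      using x cosh_sq[of x] by (auto simp: S_def c_def cth_def divide_simps)
    define N D where "N = n x - c * m x + (c ^ 2 - 6) * l x + (3 * c ^ 3 - 6 * c) * k x"
      and "D = n' - ((1 - c ^ 2) * m x + c * m') + (2 * c * (1 - c ^ 2) * l x + (c ^ 2 - 6) * l')
        + ((9 * c ^ 2 * (1 - c ^ 2) - 6 * (1 - c ^ 2)) * k x + (3 * c ^ 3 - 6 * c) * k')"
    have "((\<lambda>t. - ?F t) has_real_derivative - ((D * (12 * S) - N * (12 * (c * S))) / ((12 * S) * (12 * S)))) (at x)"
      unfolding N_def D_def S_def c_def using x
      by (auto intro!: derivative_eq_intros cth_deriv 1 2 3 simp: C[unfolded S_def c_def] algebra_simps)
    moreover have "- ((D * (12 * S) - N * (12 * (c * S))) / ((12 * S) * (12 * S))) = k x / S ^ 5"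
    proof -
      have "D - N * c = - 12 * k x * (c ^ 2 - 1) ^ 2"
        unfolding D_def N_def n' unfolding m' unfolding l' c_def by algebra
      then have "(D - N * c) / (12 * S) = - (k x / S ^ 5)"
        unfolding cs using S by (simp add: power_divide flip: power_mult power_Suc2)
      moreover have "- ((D * (12 * S) - N * (12 * (c * S))) / ((12 * S) * (12 * S))) = - ((D - N * c) / (12 * S))"
        using S by (simp add: field_simps)
      ultimately show ?thesis by simp
    qed
    ultimately show "((\<lambda>t. - ?F t) has_real_derivative k x / sinh x ^ 5) (at x)"
      by (simp add: S_def)
  next
    have "((\<lambda>t. - (n t / sinh t - cosh t / sinh t * (m t / sinh t) + ((cosh t / sinh t) ^ 2 - 6) * (l t / sinh t)
         + (3 * (cosh t / sinh t) ^ 3 - 6 * (cosh t / sinh t)) * (k t / sinh t)) / 12)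
       \<longlongrightarrow> - (0 - 1 * 0 + (1 ^ 2 - 6) * 0 + (3 * 1 ^ 3 - 6 * 1) * 0) / 12) at_top"
      using assms(1-3) unfolding neumann_def by (intro tendsto_intros inv_sinh_lims) auto
    then show "((\<lambda>t. - ?F t) \<longlongrightarrow> 0) at_top"
      by (simp add: cth_def add_divide_distrib diff_divide_distrib mult_ac)
  qed
  then show ?thesis by simp
qed

section \<open>The chamber formulas\<close>

definition VV2 :: "real \<Rightarrow> real \<Rightarrow> real \<Rightarrow> real \<Rightarrow> real \<Rightarrow> real" where
  "VV2 k l m x y = k * (cosh x * cosh y) + l * (sinh x * cosh y + cosh x * sinh y) + m * (sinh x * sinh y)"

definition VV3 :: "real \<Rightarrow> real \<Rightarrow> real \<Rightarrow> real \<Rightarrow> real \<Rightarrow> real \<Rightarrow> real \<Rightarrow> real" where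
  "VV3 k l m n x y z =
     VV2 (k * cosh z + l * sinh z) (l * cosh z + m * sinh z) (m * cosh z + n * sinh z) x y"

text \<open>With \<open>t = y + d\<close> one has \<open>sinh y = sinh (t - d)\<close>, and in
  combination with the closed forms of \<open>Jop\<close> and \<open>Mop\<close> every power of
  \<open>coth t\<close> cancels.\<close>

lemma Kop_eq:
  assumes N: "neumann k l" "neumann l m" and \<phi>: "\<And>s. s > 0 \<Longrightarrow> \<phi> s = k s" and "y > 0" "d \<ge> 0"
  shows "Kop (2 * d) \<phi> y = VV2 (k (y + d)) (l (y + d)) (m (y + d)) d d"
proof -
  define t where "t = y + d"
  have t: "t > 0" using assms by (simp add: t_def)
  have J: "Jop \<phi> t = (l t + cth t * k t) / (2 * sinh t)"
  proof -
    have "Jop \<phi> t = integral {t..} (\<lambda>r. k r / sinh r ^ 3)"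
      unfolding Jop_def using t by (intro integral_cong) (simp add: \<phi>)
    then show ?thesis using neumann_has_integral_J[OF N(1) t] by (simp add: integral_unique)
  qed
  have M: "Mop \<phi> t = (2 * cth t ^ 2 * k t + cth t * l t - m t) / (6 * sinh t)"
  proof -
    have "Mop \<phi> t = integral {t..} (\<lambda>r. cosh r * k r / sinh r ^ 4)"
      unfolding Mop_def using t by (intro integral_cong) (simp add: \<phi>)
    then show ?thesis using neumann_has_integral_M[OF N t] by (simp add: integral_unique)
  qed
  define S c where "S = sinh t" and "c = cth t"
  have S: "S > 0" and C: "cosh t = c * S"
    using t by (auto simp: S_def c_def cth_def)
  define p q where "p = cosh d" and "q = sinh d"
  have "sinh y = sinh (t - d)" by (simp add: t_def)
  then have y: "sinh y = S * (p - c * q)"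
    by (simp add: sinh_diff C p_def q_def S_def algebra_simps)
  have "Kop (2 * d) \<phi> y = (sinh y) ^ 2 / S ^ 2 * k t + 4 * sinh y * q * ((l t + c * k t) / (2 * S))
    + 6 * q ^ 2 * (c * S * ((l t + c * k t) / (2 * S)) - S * ((2 * c ^ 2 * k t + c * l t - m t) / (6 * S)))"
    using t by (simp add: Kop_def Let_def t_def[symmetric] J M \<phi> q_def S_def[symmetric] c_def[symmetric] C)
  also have "\<dots> = (p - c * q) ^ 2 * k t + 2 * (p - c * q) * q * (l t + c * k t)
     + (3 * q ^ 2 * c * (l t + c * k t) - q ^ 2 * (2 * c ^ 2 * k t + c * l t - m t))"
    unfolding y using S by (simp add: power_mult_distrib) (simp add: field_simps)
  also have "\<dots> = VV2 (k t) (l t) (m t) d d"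
    unfolding VV2_def p_def[symmetric] q_def[symmetric] by algebra
  finally show ?thesis by (simp add: t_def)
qed

text \<open>Fixing one argument of the form at \<open>d\<close> leaves a Neumann pair
  \<open>K\<close>, \<open>L\<close>, which \<open>neumann_shift\<close> moves by \<open>d\<close>.
  Applying \<open>Top\<close> then replaces the other argument \<open>d\<close> by
  \<open>y + d\<close>.\<close>

lemma Top_eq:
  assumes N: "neumann k l" "neumann l m" and "y > 0" "d \<ge> 0"
    and \<psi>: "\<And>s. s > 0 \<Longrightarrow> \<psi> s = VV2 (k (s + d)) (l (s + d)) (m (s + d)) d d"
  shows "Top \<psi> y = VV2 (k (y + d)) (l (y + d)) (m (y + d)) (y + d) d"
proof -
  define K where "K t = cosh d * k t + sinh d * l t" for t
  define L where "L t = cosh d * l t + sinh d * m t" for t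
  have "neumann K L"
    unfolding K_def[abs_def] L_def[abs_def] by (rule neumann_combine[OF N])
  note sh = neumann_shift[OF this \<open>d \<ge> 0\<close>]
  have "Top \<psi> y = 2 * sinh y ^ 2 * integral {y..} (\<lambda>r. (K (r + d) * cosh d + L (r + d) * sinh d) / sinh r ^ 3)"
    unfolding Top_def using \<open>y > 0\<close>
    by (intro arg_cong2[of _ _ _ _ "(*)"] refl integral_cong) (simp add: \<psi> K_def L_def VV2_def algebra_simps)
  also have "\<dots> = sinh y * (K (y + d) * sinh d + L (y + d) * cosh d) + cosh y * (K (y + d) * cosh d + L (y + d) * sinh d)"
    using integral_unique[OF neumann_has_integral_J[OF sh \<open>y > 0\<close>]] \<open>y > 0\<close>
    by (simp add: cth_def field_simps power2_eq_square)
  also have "\<dots> = VV2 (k (y + d)) (l (y + d)) (m (y + d)) (y + d) d"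
    unfolding VV2_def K_def L_def cosh_add[of y d] sinh_add[of y d] by algebra
  finally show ?thesis .
qed

text \<open>A function linear in \<open>(cosh, sinh)\<close> is determined by two values, and the
  quotients of hyperbolic sines are the weights that interpolate from the points \<open>d\<close>
  and \<open>b + c + d\<close> to \<open>b + d\<close>. \<open>Kop\<close> and \<open>Top\<close>
  supply the two values.\<close>

lemma chamber_formula:
  assumes N: "neumann k l" "neumann l m" and \<phi>: "\<And>s. s > 0 \<Longrightarrow> \<phi> s = k s"
    and "b + c > 0" "d \<ge> 0"
  shows "Kop (2 * d) \<phi> (b + c) * (sinh c / sinh (b + c)) + Top (Kop (2 * d) \<phi>) (b + c) * (sinh b / sinh (b + c))
    = VV2 (k (b + c + d)) (l (b + c + d)) (m (b + c + d)) (b + d) d"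
proof -
  have K': "Kop (2 * d) \<phi> s = VV2 (k (s + d)) (l (s + d)) (m (s + d)) d d" if "s > 0" for s
    by (rule Kop_eq[OF N \<phi> that \<open>d \<ge> 0\<close>])
  note K = K'[OF \<open>b + c > 0\<close>]
  have T: "Top (Kop (2 * d) \<phi>) (b + c) = VV2 (k (b + c + d)) (l (b + c + d)) (m (b + c + d)) (b + c + d) d"
    by (rule Top_eq[OF N \<open>b + c > 0\<close> \<open>d \<ge> 0\<close> K'])
  define u v w where "u = k (b + c + d)" and "v = l (b + c + d)" and "w = m (b + c + d)"
  have "sinh (b + c) \<noteq> 0" using assms by simp
  moreover have "VV2 u v w d d * sinh c + VV2 u v w (b + c + d) d * sinh b = VV2 u v w (b + d) d * sinh (b + c)"
  proof -
    have "sinh d * sinh c + sinh (b + c + d) * sinh b = sinh (b + d) * sinh (b + c)"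
      "cosh d * sinh c + cosh (b + c + d) * sinh b = cosh (b + d) * sinh (b + c)"
      using cosh_sq[of b] by (simp_all add: sinh_add cosh_add) algebra+
    then show ?thesis unfolding VV2_def by algebra
  qed
  ultimately show ?thesis
    unfolding K T u_def v_def w_def by (simp add: field_simps)
qed

text \<open>The exponential weights in \<open>Pfun\<close> expand into 1, \<open>sinh r ^ 2\<close>
  and \<open>cosh r * sinh r\<close> over \<open>sinh r ^ 5\<close>, that is, into the three
  integrals just evaluated. The third part \<open>\<alpha>\<close> of the second argument becomes
  each of the three arguments of the form.\<close>

lemma Pfun_eq:
  assumes "y > 0" "\<alpha> \<ge> 0"
  shows "Pfun y (3 * \<alpha>) = VV3 (kf 0 (y + \<alpha>) 0) (kf 1 (y + \<alpha>) 0) (kf 2 (y + \<alpha>) 0) (kf 3 (y + \<alpha>) 0) \<alpha> \<alpha> \<alpha>"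
proof -
  define \<rho> where "\<rho> = y + \<alpha>"
  have \<rho>: "\<rho> > 0" using assms by (simp add: \<rho>_def)
  define c0 c1 c2 c3 where "c0 = kf 0 \<rho> 0" and "c1 = kf 1 \<rho> 0" and "c2 = kf 2 \<rho> 0" and "c3 = kf 3 \<rho> 0"
  define S x where "S = sinh \<rho>" and "x = cth \<rho>"
  have S: "S > 0" and C: "cosh \<rho> = x * S" using \<rho> by (auto simp: S_def x_def cth_def)
  define p q where "p = cosh \<alpha>" and "q = sinh \<alpha>"
  have pq: "p ^ 2 = 1 + q ^ 2" by (simp add: p_def q_def cosh_sq)
  define E where "E = exp (2 * \<alpha>)"
  have e: "exp \<alpha> = p + q" "exp (- \<alpha>) = p - q"
    by (simp_all add: p_def q_def cosh_plus_sinh cosh_minus_sinh)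
  have E: "E = (p + q) ^ 2" unfolding E_def exp_double e ..
  have N: "neumann (\<lambda>t. kf 0 t 0) (\<lambda>t. kf 1 t 0)" "neumann (\<lambda>t. kf 1 t 0) (\<lambda>t. kf 2 t 0)" "neumann (\<lambda>t. kf 2 t 0) (\<lambda>t. kf 3 t 0)"
    using neumann_kf[of 0 0] neumann_kf[of 1 0] neumann_kf[of 2 0] by (simp_all add: numeral_2_eq_2 numeral_3_eq_3)
  define X Y Z where "X = (c1 + x * c0) / (2 * S)" and "Y = (2 * x ^ 2 * c0 + x * c1 - c2) / (6 * S)"
    and "Z = (c3 - x * c2 + (x ^ 2 - 6) * c1 + (3 * x ^ 3 - 6 * x) * c0) / (12 * S)"
  have ints: "((\<lambda>r. kf 0 r 0 / sinh r ^ 3) has_integral X) {\<rho>..}"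
    "((\<lambda>r. cosh r * kf 0 r 0 / sinh r ^ 4) has_integral Y) {\<rho>..}"
    "((\<lambda>r. kf 0 r 0 / sinh r ^ 5) has_integral Z) {\<rho>..}"
    using neumann_has_integral_J[OF N(1) \<rho>] neumann_has_integral_M[OF N(1,2) \<rho>] neumann_has_integral_Z[OF N \<rho>]
    by (simp_all add: X_def Y_def Z_def c0_def c1_def c2_def c3_def x_def S_def)
  have lin: "integral {\<rho>..} f = A * Z + B * X + D * Y"
    if "\<And>r. r > 0 \<Longrightarrow> f r = (A + B * sinh r ^ 2 + D * (cosh r * sinh r)) * Ufun r / sinh r ^ 5" for f A B D
  proof (rule integral_unique)
    have "((\<lambda>r. A * (kf 0 r 0 / sinh r ^ 5) + B * (kf 0 r 0 / sinh r ^ 3) + D * (cosh r * kf 0 r 0 / sinh r ^ 4))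
        has_integral A * Z + B * X + D * Y) {\<rho>..}"
      by (intro has_integral_add has_integral_mult_right ints)
    then show "(f has_integral A * Z + B * X + D * Y) {\<rho>..}"
    proof (rule has_integral_eq[rotated])
      fix r assume "r \<in> {\<rho>..}"
      then have r: "r > 0" using \<rho> by simp
      define T where "T = sinh r"
      have T: "T \<noteq> 0" using r by (simp add: T_def)
      have "B * (kf 0 r 0 / T ^ 3) = B * T ^ 2 * kf 0 r 0 / T ^ 5"
        "D * (cosh r * kf 0 r 0 / T ^ 4) = D * (cosh r * T) * kf 0 r 0 / T ^ 5"
        using T by (simp_all add: field_simps eval_nat_numeral)
      then show "A * (kf 0 r 0 / sinh r ^ 5) + B * (kf 0 r 0 / sinh r ^ 3) + D * (cosh r * kf 0 r 0 / sinh r ^ 4) = f r"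
        unfolding that[OF r] Ufun_eq[OF r] T_def[symmetric]
        by (simp add: add_divide_distrib distrib_right)
    qed
  qed
  have er: "exp (- 2 * r) = (cosh r - sinh r) ^ 2" "exp (2 * r) = (cosh r + sinh r) ^ 2" for r :: real
    unfolding cosh_minus_sinh cosh_plus_sinh by (simp_all flip: exp_double)
  have I1: "integral {\<rho>..} (\<lambda>r. exp (- 2 * r) * (E - exp (2 * r)) ^ 2 * Ufun r / sinh r ^ 5)
      = (E - 1) ^ 2 * Z + 2 * (E ^ 2 + 1) * X + 2 * (1 - E ^ 2) * Y"
  proof (rule lin)
    fix r :: real
    have "exp (- 2 * r) * (E - exp (2 * r)) ^ 2 =
      (E - 1) ^ 2 + 2 * (E ^ 2 + 1) * sinh r ^ 2 + 2 * (1 - E ^ 2) * (cosh r * sinh r)"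
      unfolding er using cosh_sq[of r] by algebra
    then show "exp (- 2 * r) * (E - exp (2 * r)) ^ 2 * Ufun r / sinh r ^ 5 =
      ((E - 1) ^ 2 + 2 * (E ^ 2 + 1) * sinh r ^ 2 + 2 * (1 - E ^ 2) * (cosh r * sinh r)) * Ufun r / sinh r ^ 5"
      by (simp only:)
  qed
  have I2: "integral {\<rho>..} (\<lambda>r. exp (- 2 * r) * (E - exp (2 * r)) * (E - (exp (2 * r) + 1) / 2) * Ufun r / sinh r ^ 5)
      = (E - 1) ^ 2 * Z + (2 * E ^ 2 - E + 1) * X + (- 2 * E ^ 2 + E + 1) * Y"
  proof (rule lin)
    fix r :: real
    \<comment> \<open>Doubling clears the inner fraction and leaves an identity that is polynomial
      in \<open>cosh r\<close>, \<open>sinh r\<close> and \<open>E\<close>.\<close>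
    have "2 * (exp (- 2 * r) * (E - exp (2 * r)) * (E - (exp (2 * r) + 1) / 2)) =
      2 * ((E - 1) ^ 2 + (2 * E ^ 2 - E + 1) * sinh r ^ 2 + (- 2 * E ^ 2 + E + 1) * (cosh r * sinh r))"
    proof -
      have "2 * (exp (- 2 * r) * (E - exp (2 * r)) * (E - (exp (2 * r) + 1) / 2))
        = exp (- 2 * r) * (E - exp (2 * r)) * (2 * (E - (exp (2 * r) + 1) / 2))" by (simp only: mult_ac)
      also have "2 * (E - (exp (2 * r) + 1) / 2) = 2 * E - (exp (2 * r) + 1)" by (simp add: field_simps)
      also have "exp (- 2 * r) * (E - exp (2 * r)) * (2 * E - (exp (2 * r) + 1))
        = 2 * ((E - 1) ^ 2 + (2 * E ^ 2 - E + 1) * sinh r ^ 2 + (- 2 * E ^ 2 + E + 1) * (cosh r * sinh r))"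
        unfolding er using cosh_sq[of r] by algebra
      finally show ?thesis .
    qed
    then show "exp (- 2 * r) * (E - exp (2 * r)) * (E - (exp (2 * r) + 1) / 2) * Ufun r / sinh r ^ 5 =
      ((E - 1) ^ 2 + (2 * E ^ 2 - E + 1) * sinh r ^ 2 + (- 2 * E ^ 2 + E + 1) * (cosh r * sinh r)) * Ufun r / sinh r ^ 5"
      by (simp only: mult_cancel_left) simp
  qed
  have y: "sinh y = S * (p - x * q)"
  proof -
    have "sinh y = sinh (\<rho> - \<alpha>)" by (simp add: \<rho>_def)
    then show ?thesis by (simp add: sinh_diff C p_def q_def S_def algebra_simps)
  qed
  have ey: "exp (- y - 4 * \<alpha>) = S * (x - 1) * (p + q) * (p - q) ^ 4"
  proof -
    have "exp (- y - 4 * \<alpha>) = exp (- \<rho>) * exp \<alpha> * exp (- \<alpha>) ^ 4"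
      by (simp add: \<rho>_def flip: exp_add exp_of_nat_mult)
    moreover have "exp (- \<rho>) = S * (x - 1)"
      by (simp add: C S_def algebra_simps flip: cosh_minus_sinh[of \<rho>])
    ultimately show ?thesis unfolding e by simp
  qed
  have e2: "exp (- (2 * \<alpha>)) = (p - q) ^ 2"
    by (simp flip: e(2) exp_double)
  have "Pfun y (3 * \<alpha>) = sinh y ^ 3 / S ^ 3 * c0
     + 3 / 4 * (S * (x - 1) * (p + q) * (p - q) ^ 4) * (E - 1) ^ 2 *
         ((E - 1) ^ 2 * Z + 2 * (E ^ 2 + 1) * X + 2 * (1 - E ^ 2) * Y)
     + 3 / 2 * sinh y * (p - q) ^ 2 * (E - 1) *
         ((E - 1) ^ 2 * Z + (2 * E ^ 2 - E + 1) * X + (- 2 * E ^ 2 + E + 1) * Y)"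
    using I1 I2 Ufun_eq[OF \<rho>]
    by (simp add: Pfun_def Let_def \<rho>_def[symmetric] E_def[symmetric] S_def[symmetric] c0_def ey e2)
  also have "sinh y ^ 3 / S ^ 3 = (p - x * q) ^ 3"
    using S by (simp add: y power_mult_distrib)
  also have "3 / 4 * (S * (x - 1) * (p + q) * (p - q) ^ 4) * (E - 1) ^ 2 *
         ((E - 1) ^ 2 * Z + 2 * (E ^ 2 + 1) * X + 2 * (1 - E ^ 2) * Y)
     = 12 * q ^ 2 * (x - 1) * (p + q) * (q ^ 2 * (S * Z) + (1 + 2 * q ^ 2) * (S * X) - 2 * p * q * (S * Y))"
  proof -
    have "(p + q) * (p - q) ^ 4 * (E - 1) ^ 2 = 4 * q ^ 2 * (p - q)"
      unfolding E using pq by algebra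
    moreover have "(p - q) * ((E - 1) ^ 2 * Z + 2 * (E ^ 2 + 1) * X + 2 * (1 - E ^ 2) * Y)
        = 4 * (p + q) * (q ^ 2 * Z + (1 + 2 * q ^ 2) * X - 2 * p * q * Y)"
      unfolding E using pq by algebra
    ultimately show ?thesis by algebra
  qed
  also have "3 / 2 * sinh y * (p - q) ^ 2 * (E - 1) *
         ((E - 1) ^ 2 * Z + (2 * E ^ 2 - E + 1) * X + (- 2 * E ^ 2 + E + 1) * Y)
     = 3 * (p - x * q) * q * (4 * q ^ 2 * (p + q) * (S * Z) + (2 * (p - q) + 6 * q + 8 * q ^ 2 * (p + q)) * (S * X)
        - (6 * q + 8 * q ^ 2 * (p + q)) * (S * Y))"
  proof -
    have "(p - q) ^ 2 * (E - 1) = 2 * q * (p - q)"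
      unfolding E using pq by algebra
    moreover have "(p - q) * ((E - 1) ^ 2 * Z + (2 * E ^ 2 - E + 1) * X + (- 2 * E ^ 2 + E + 1) * Y)
        = 4 * q ^ 2 * (p + q) * Z + (2 * (p - q) + 6 * q + 8 * q ^ 2 * (p + q)) * X
        - (6 * q + 8 * q ^ 2 * (p + q)) * Y"
      unfolding E using pq by algebra
    ultimately show ?thesis unfolding y by algebra
  qed
  also have "(p - x * q) ^ 3 * c0
    + 12 * q ^ 2 * (x - 1) * (p + q) * (q ^ 2 * (S * Z) + (1 + 2 * q ^ 2) * (S * X) - 2 * p * q * (S * Y))
    + 3 * (p - x * q) * q * (4 * q ^ 2 * (p + q) * (S * Z) + (2 * (p - q) + 6 * q + 8 * q ^ 2 * (p + q)) * (S * X)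
        - (6 * q + 8 * q ^ 2 * (p + q)) * (S * Y))
    = VV3 c0 c1 c2 c3 \<alpha> \<alpha> \<alpha>"
  proof -
    have "2 * (S * X) = c1 + x * c0" "6 * (S * Y) = 2 * x ^ 2 * c0 + x * c1 - c2"
      "12 * (S * Z) = c3 - x * c2 + (x ^ 2 - 6) * c1 + (3 * x ^ 3 - 6 * x) * c0"
      using S by (simp_all add: X_def Y_def Z_def)
    then show ?thesis
      unfolding VV3_def VV2_def p_def[symmetric] q_def[symmetric] using pq by algebra
  qed
  finally show ?thesis by (simp add: c0_def c1_def c2_def c3_def \<rho>_def)
qed

text \<open>\<open>VA\<close> and \<open>VC\<close> represent \<open>v\<close> on \<open>q\<^sub>4 \<ge> q\<^sub>2\<close>, below and above the interface; \<open>VB\<close> is for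
  \<open>q\<^sub>4 \<le> q\<^sub>2\<close>, where the coefficients \<open>be\<close> generated by \<open>b0\<close> are split off.\<close>

definition VA :: "real \<Rightarrow> real \<Rightarrow> real \<Rightarrow> real \<Rightarrow> real" where
  "VA t w x y = VV2 (kf 0 t w) (kf 1 t w) (kf 2 t w) x y"

definition VC :: "real \<Rightarrow> real \<Rightarrow> real \<Rightarrow> real \<Rightarrow> real" where
  "VC r x y z = VV3 (kf 0 r 0) (kf 1 r 0) (kf 2 r 0) (kf 3 r 0) x y z"

fun be :: "nat \<Rightarrow> real \<Rightarrow> real" where
  "be 0 t = kap * (1 + exp (- 2 * t) / 3)"
| "be (Suc 0) t = kap * (- 1 + exp (- 2 * t) / 3)"
| "be _ t = kap * (- 1 + exp (- 2 * t) / 3) + 2 * kap * sinh t * Lam t"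

definition VB :: "real \<Rightarrow> real \<Rightarrow> real \<Rightarrow> real \<Rightarrow> real" where
  "VB t w x y = VV2 (kf 0 t w - be 0 t) (kf 1 t w - be 1 t) (kf 2 t w - be 2 t) x y
     + kap * (exp (y - x) + exp (x + y - 2 * t) / 3)"

lemma neumann_kf012:
  "neumann (\<lambda>t. kf 0 t w) (\<lambda>t. kf 1 t w)" "neumann (\<lambda>t. kf 1 t w) (\<lambda>t. kf 2 t w)" "neumann (\<lambda>t. kf 2 t w) (\<lambda>t. kf 3 t w)"
  using neumann_kf[of 0 w] neumann_kf[of 1 w] neumann_kf[of 2 w] by (simp_all add: numeral_2_eq_2 numeral_3_eq_3)

lemma formula_A:
  assumes "b \<ge> 0" "c \<ge> 0" "b + c > 0" "e \<ge> b" "2 * a \<ge> e - b"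
  shows "Ffun a (b + c) (e - b) * (sinh c / sinh (b + c)) + Rfun a (b + c) (e - b) * (sinh b / sinh (b + c))
    = VA (c + (b + e) / 2) (a - (e - b) / 2) ((e + b) / 2) ((e - b) / 2)"
proof -
  define d where "d = (e - b) / 2"
  have e: "e - b = 2 * d" "(e + b) / 2 = b + d" "c + (b + e) / 2 = b + c + d" and d: "d \<ge> 0"
    using assms by (simp_all add: d_def field_simps)
  have "phi_datum (a - d) s = kf 0 s (a - d)" if "s > 0" for s
    using assms Ltilde_eq[OF that] by (simp add: phi_datum_def d_def)
  note chamber_formula[OF neumann_kf012(1,2) this assms(3) d]
  moreover have "min (2 * d) (2 * a) = 2 * d" using assms by (simp add: d_def)
  ultimately show ?thesis
    by (simp add: Ffun_def Rfun_def VA_def e)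
qed

text \<open>The datum \<open>Pfun\<close> is itself a threefold contraction of the chain, so
  \<open>chamber_formula\<close> is applied to the contracted pairs \<open>(k, l)\<close> and
  \<open>(l, m)\<close>; the addition theorems then merge \<open>\<alpha>\<close> with the arguments
  \<open>a\<close> and \<open>a + b\<close>. The strict inequality selects the branch
  \<open>w < 0\<close> of \<open>phi_datum\<close>.\<close>

lemma formula_C:
  assumes "a \<ge> 0" "b \<ge> 0" "c \<ge> 0" "b + c > 0" "2 * a < e - b"
  defines "\<alpha> \<equiv> (e - b - 2 * a) / 3"
  shows "Ffun a (b + c) (e - b) * (sinh c / sinh (b + c)) + Rfun a (b + c) (e - b) * (sinh b / sinh (b + c))
    = VC (a + b + c + \<alpha>) (a + b + \<alpha>) (a + \<alpha>) \<alpha>"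
proof -
  have \<alpha>: "\<alpha> \<ge> 0" using assms by simp
  define p q where "p = cosh \<alpha>" and "q = sinh \<alpha>"
  define M where "M j t = p * kf j t 0 + q * kf (Suc j) t 0" for j t
  have M: "neumann (M 0) (M 1)" "neumann (M 1) (M 2)"
    unfolding M_def[abs_def] using neumann_kf012[of 0]
    by (auto intro!: neumann_combine simp: numeral_2_eq_2 numeral_3_eq_3)
  define K where "K t = p * M 0 t + q * M 1 t" for t
  define L where "L t = p * M 1 t + q * M 2 t" for t
  \<comment> \<open>\<open>K'\<close> and \<open>L'\<close> contract with
    \<open>cosh \<alpha>\<close> and \<open>sinh \<alpha>\<close> exchanged. Their shift by
    \<open>\<alpha>\<close> has first component \<open>l\<close>, which exhibits
    \<open>(l, m)\<close> as a Neumann pair.\<close>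
  define K' where "K' t = q * M 0 t + p * M 1 t" for t
  define L' where "L' t = q * M 1 t + p * M 2 t" for t
  define k where "k t = K (t + \<alpha>) * cosh \<alpha> + L (t + \<alpha>) * sinh \<alpha>" for t
  define l where "l t = K (t + \<alpha>) * sinh \<alpha> + L (t + \<alpha>) * cosh \<alpha>" for t
  define m where "m t = K' (t + \<alpha>) * sinh \<alpha> + L' (t + \<alpha>) * cosh \<alpha>" for t
  have "neumann K L" unfolding K_def[abs_def] L_def[abs_def] by (rule neumann_combine[OF M])
  from neumann_shift[OF this \<alpha>] have kl: "neumann k l"
    unfolding k_def[abs_def] l_def[abs_def] .
  have "neumann K' L'" unfolding K'_def[abs_def] L'_def[abs_def] by (rule neumann_combine[OF M])
  from neumann_shift[OF this \<alpha>]
  have "neumann (\<lambda>t. K' (t + \<alpha>) * cosh \<alpha> + L' (t + \<alpha>) * sinh \<alpha>) m"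
    unfolding m_def[abs_def] .
  moreover have "(\<lambda>t. K' (t + \<alpha>) * cosh \<alpha> + L' (t + \<alpha>) * sinh \<alpha>) = l"
    by (simp add: fun_eq_iff l_def K_def L_def K'_def L'_def p_def q_def algebra_simps)
  ultimately have lm: "neumann l m" by simp
  have w: "a - (e - b) / 2 < 0" "- 2 * (a - (e - b) / 2) = 3 * \<alpha>"
    using assms by (simp_all add: \<alpha>_def)
  have "phi_datum (a - (e - b) / 2) s = k s" if "s > 0" for s
    using w Pfun_eq[OF that \<alpha>]
    by (simp add: phi_datum_def k_def K_def L_def M_def p_def q_def VV3_def VV2_def algebra_simps numeral_2_eq_2 numeral_3_eq_3)
  note chamber_formula[OF kl lm this, where b = b and c = c and d = a]
  moreover have "min (e - b) (2 * a) = 2 * a" using assms by simp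
  moreover have "VV2 (k (b + c + a)) (l (b + c + a)) (m (b + c + a)) (b + a) a = VC (a + b + c + \<alpha>) (a + b + \<alpha>) (a + \<alpha>) \<alpha>"
  proof -
    define h where "h j = kf j (b + c + a + \<alpha>) 0" for j
    have r: "a + b + c + \<alpha> = b + c + a + \<alpha>" by simp
    show ?thesis
      unfolding VC_def r h_def[symmetric] cosh_add[of "a + b" \<alpha>] sinh_add[of "a + b" \<alpha>] cosh_add[of a \<alpha>] sinh_add[of a \<alpha>]
        k_def l_def m_def K_def L_def K'_def L'_def M_def p_def q_def VV3_def VV2_def add.commute[of b a] h_def[symmetric]
      by (simp add: numeral_2_eq_2 numeral_3_eq_3) algebra
  qed
  ultimately show ?thesis
    using assms by (simp add: Ffun_def Rfun_def)
qed

lemma neumann_be: "neumann (be 0) (be 1)" "neumann (be 1) (be 2)"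
proof -
  define b' where "b' t = - (2 / 3) * kap * exp (- 2 * t)" for t :: real
  have ex: "exp (- 2 * t) * (cosh t + sinh t) = cosh t - sinh t" for t :: real
    unfolding cosh_plus_sinh cosh_minus_sinh by (simp flip: exp_add)
  have d: "(be 0 has_real_derivative b' t) (at t)" "(be 1 has_real_derivative b' t) (at t)" for t
    unfolding b'_def One_nat_def be.simps[abs_def]
    by (auto intro!: derivative_eq_intros)
  have d2: "(be 2 has_real_derivative b' t + 2 * kap * (cosh t * Lam t - 1)) (at t)" if "t > 0" for t
    using that unfolding b'_def numeral_2_eq_2 be.simps[abs_def]
    by (auto intro!: derivative_eq_intros Lam_deriv simp: algebra_simps)
  have l: "((\<lambda>t. be 0 t / sinh t) \<longlongrightarrow> 0) at_top" "((\<lambda>t. be 1 t / sinh t) \<longlongrightarrow> 0) at_top"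
    unfolding One_nat_def be.simps sinh_def by (simp, real_asymp)+
  have "((\<lambda>t. be 1 t / sinh t + 2 * kap * Lam t) \<longlongrightarrow> 0 + 2 * kap * 0) at_top"
    by (intro tendsto_intros l Lam_tendsto_0)
  then have "((\<lambda>t. be 2 t / sinh t) \<longlongrightarrow> 0 + 2 * kap * 0) at_top"
  proof (rule Lim_transform_eventually)
    show "\<forall>\<^sub>F t in at_top. be 1 t / sinh t + 2 * kap * Lam t = be 2 t / sinh t"
      using eventually_gt_at_top[of 0]
      by eventually_elim (simp add: numeral_2_eq_2 add_divide_distrib)
  qed
  then have l2: "((\<lambda>t. be 2 t / sinh t) \<longlongrightarrow> 0) at_top" by simp
  show "neumann (be 0) (be 1)"
  proof (rule neumannI[OF d _ l])
    show "b' t * cosh t + b' t * sinh t = be 0 t * sinh t + be 1 t * cosh t" for t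
    proof -
      have "b' t * cosh t + b' t * sinh t = - (2 / 3) * kap * (exp (- 2 * t) * (cosh t + sinh t))"
        by (simp add: b'_def algebra_simps)
      moreover have "be 0 t * sinh t + be 1 t * cosh t = kap * (sinh t - cosh t + (exp (- 2 * t) * (cosh t + sinh t)) / 3)"
        by (simp add: field_simps)
      ultimately show ?thesis unfolding ex by (simp add: field_simps)
    qed
  qed
  show "neumann (be 1) (be 2)"
  proof (rule neumannI[OF d(2) d2 _ l(2) l2])
    fix t :: real
    have e: "exp (- 2 * t) * cosh t = cosh t - sinh t - exp (- 2 * t) * sinh t"
      using ex[of t] by (simp add: algebra_simps)
    show "b' t * cosh t + (b' t + 2 * kap * (cosh t * Lam t - 1)) * sinh t = be 1 t * sinh t + be 2 t * cosh t"
    proof -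
      define E where "E = exp (- 2 * t)"
      have bs: "b' t = - (2 / 3) * kap * E" "be 1 t = kap * (- 1 + E / 3)" "be 2 t = kap * (- 1 + E / 3) + 2 * kap * sinh t * Lam t"
        by (simp_all add: b'_def E_def numeral_2_eq_2)
      have EC: "cosh t - sinh t = E * (cosh t + sinh t)" using ex by (simp add: E_def)
      have "b' t * cosh t + (b' t + 2 * kap * (cosh t * Lam t - 1)) * sinh t
          = - (2 / 3) * kap * (cosh t - sinh t) + 2 * kap * cosh t * sinh t * Lam t - 2 * kap * sinh t"
        unfolding bs EC by (simp add: algebra_simps)
      moreover have "be 1 t * sinh t + be 2 t * cosh t
          = - kap * (cosh t + sinh t) + kap * (cosh t - sinh t) / 3 + 2 * kap * cosh t * sinh t * Lam t"
        unfolding bs EC by (simp add: field_simps)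
      ultimately show ?thesis by (simp add: field_simps)
    qed
  qed
qed

lemma b0_eq: "b0 s = be 0 s"
  by (simp add: b0_def kap_def)

text \<open>\<open>b0\<close> is subtracted inside \<open>Kop\<close> but \<open>b0\<close> and
  \<open>b1\<close> are added back outside, so they do not cancel: inside they contribute the
  coefficients \<open>be\<close>, outside their interpolation is the explicit exponential term of
  \<open>VB\<close>.\<close>

lemma formula_B:
  assumes "c \<ge> 0" "e \<ge> 0" "c + e > 0" "e \<le> b"
  shows "(HBfun a (c + e) (b - e) + b0 (c + e)) * (sinh c / sinh (c + e))
      + (RBfun a (c + e) (b - e) + b1 (c + e)) * (sinh e / sinh (c + e))
    = VB (c + (b + e) / 2) a ((b + e) / 2) ((b - e) / 2)"
proof -
  define k where "k j t = 1 * kf j t a + - 1 * be j t" for j t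
  have N: "neumann (k 0) (k 1)" "neumann (k 1) (k 2)"
    unfolding k_def[abs_def] by (intro neumann_combine neumann_kf012 neumann_be)+
  define d where "d = (b - e) / 2"
  have b: "b - e = 2 * d" "(b + e) / 2 = e + d" "c + (b + e) / 2 = e + c + d" and d: "d \<ge> 0"
    using assms by (simp_all add: d_def field_simps)
  have "psi_datum a s = k 0 s" if "s > 0" for s
    using Ltilde_eq[OF that] b0_eq by (simp add: psi_datum_def k_def)
  note chamber_formula[OF N this _ d, where b = e and c = c]
  then have H: "HBfun a (c + e) (b - e) * (sinh c / sinh (c + e)) + RBfun a (c + e) (b - e) * (sinh e / sinh (c + e))
     = VV2 (k 0 (e + c + d)) (k 1 (e + c + d)) (k 2 (e + c + d)) (e + d) d"
    using assms(3) by (simp add: HBfun_def RBfun_def b add.commute[of c e])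
  have "b0 (c + e) * (sinh c / sinh (c + e)) + b1 (c + e) * (sinh e / sinh (c + e)) = kap * (exp (- e) + exp (e - 2 * (c + e)) / 3)"
  proof -
    define s where "s = sinh (c + e)"
    have s: "s \<noteq> 0" using assms by (simp add: s_def)
    define A B a' b' where "A = exp c" and "B = exp e" and "a' = exp (- c)" and "b' = exp (- e)"
    have AB: "A * a' = 1" "B * b' = 1" by (simp_all add: A_def B_def a'_def b'_def flip: exp_add)
    have 1: "b0 (c + e) = kap * (1 + (a' * b') ^ 2 / 3)" "b1 (c + e) = 4 / 3 * kap * (a' * b')"
    proof -
      have "exp (- 2 * (c + e)) = (a' * b') ^ 2" "exp (- (c + e)) = a' * b'"
        by (simp_all add: a'_def b'_def power2_eq_square flip: exp_add)
      then show "b0 (c + e) = kap * (1 + (a' * b') ^ 2 / 3)" "b1 (c + e) = 4 / 3 * kap * (a' * b')"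
        by (simp_all only: b0_def b1_def kap_def)
    qed
    have "exp (c + e) = A * B" "exp (- (c + e)) = a' * b'"
      by (simp_all add: A_def B_def a'_def b'_def flip: exp_add)
    then have 2: "sinh c = (A - a') / 2" "sinh e = (B - b') / 2" "s = (A * B - a' * b') / 2"
      by (simp_all add: sinh_def s_def A_def B_def a'_def b'_def)
    have 3: "exp (- e) = b'" "exp (e - 2 * (c + e)) = a' * a' * b'"
      by (simp_all add: a'_def b'_def flip: exp_add)
    have "3 * (b0 (c + e) * sinh c + b1 (c + e) * sinh e) = 3 * (kap * (exp (- e) + exp (e - 2 * (c + e)) / 3) * s)"
      unfolding 1 2 3 using AB by (simp add: field_simps) algebra
    then show ?thesis using s unfolding s_def[symmetric] by (simp add: divide_simps)
  qed
  moreover have "d - (e + d) = - e" "e + d + d - 2 * (e + c + d) = e - 2 * (c + e)"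
    by (simp_all add: field_simps)
  moreover have "c + (e + d) = e + c + d" by simp
  ultimately have "VB (c + (b + e) / 2) a ((b + e) / 2) ((b - e) / 2) =
     (HBfun a (c + e) (b - e) * (sinh c / sinh (c + e)) + RBfun a (c + e) (b - e) * (sinh e / sinh (c + e)))
     + (b0 (c + e) * (sinh c / sinh (c + e)) + b1 (c + e) * (sinh e / sinh (c + e)))"
    unfolding VB_def b(2) d_def[symmetric] H by (simp only: k_def) simp
  then show ?thesis
    by (simp only: distrib_right add_ac)
qed

section \<open>Second derivatives and matching across the interface\<close>

text \<open>Hyperbolic cosines and sines enter as independent arguments, so that differentiating in a
  coordinate exchanges two of them.\<close>

definition Q :: "(nat \<Rightarrow> real) \<Rightarrow> real \<Rightarrow> real \<Rightarrow> real \<Rightarrow> real \<Rightarrow> real \<Rightarrow> real \<Rightarrow> real" where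
  "Q K cx sx cy sy cz sz =
     K 0 * (cx * cy * cz) + K 1 * (sx * cy * cz + cx * sy * cz + cx * cy * sz)
     + K 2 * (sx * sy * cz + sx * cy * sz + cx * sy * sz) + K 3 * (sx * sy * sz)"

lemma Q_deriv:
  assumes "\<And>j. ((\<lambda>e. K e j) has_real_derivative K' j) (at e)"
    and "(cx has_real_derivative dx * sx e) (at e)" "(sx has_real_derivative dx * cx e) (at e)"
    and "(cy has_real_derivative dy * sy e) (at e)" "(sy has_real_derivative dy * cy e) (at e)"
    and "(cz has_real_derivative dz * sz e) (at e)" "(sz has_real_derivative dz * cz e) (at e)"
  shows "((\<lambda>e. Q (K e) (cx e) (sx e) (cy e) (sy e) (cz e) (sz e)) has_real_derivative
    Q K' (cx e) (sx e) (cy e) (sy e) (cz e) (sz e)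
    + dx * Q (K e) (sx e) (cx e) (cy e) (sy e) (cz e) (sz e)
    + dy * Q (K e) (cx e) (sx e) (sy e) (cy e) (cz e) (sz e)
    + dz * Q (K e) (cx e) (sx e) (cy e) (sy e) (sz e) (cz e)) (at e)"
  unfolding Q_def
  by (rule DERIV_cong, (rule derivative_intros assms)+) algebra

definition Q1 where
  "Q1 K K1 dx dy dz cx sx cy sy cz sz = Q K1 cx sx cy sy cz sz
    + dx * Q K sx cx cy sy cz sz + dy * Q K cx sx sy cy cz sz + dz * Q K cx sx cy sy sz cz"

text \<open>The second derivative along a line. As \<open>cosh\<close> and \<open>sinh\<close> equal
  their own second derivatives, the squares of \<open>dx\<close>, \<open>dy\<close>,
  \<open>dz\<close> multiply the form itself.\<close>

definition Q2 where
  "Q2 K K1 K2 dx dy dz cx sx cy sy cz sz = Q K2 cx sx cy sy cz sz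
    + 2 * (dx * Q K1 sx cx cy sy cz sz + dy * Q K1 cx sx sy cy cz sz + dz * Q K1 cx sx cy sy sz cz)
    + (dx ^ 2 + dy ^ 2 + dz ^ 2) * Q K cx sx cy sy cz sz
    + 2 * (dx * dy * Q K sx cx sy cy cz sz + dx * dz * Q K sx cx cy sy sz cz + dy * dz * Q K cx sx sy cy sz cz)"

lemma Q_line_deriv:
  assumes "\<And>j. ((\<lambda>e. K e j) has_real_derivative K1 e j) (at e)"
  shows "((\<lambda>e. Q (K e) (cosh (x + e * dx)) (sinh (x + e * dx)) (cosh (y + e * dy)) (sinh (y + e * dy))
      (cosh (z + e * dz)) (sinh (z + e * dz))) has_real_derivative
    Q1 (K e) (K1 e) dx dy dz (cosh (x + e * dx)) (sinh (x + e * dx)) (cosh (y + e * dy)) (sinh (y + e * dy))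
      (cosh (z + e * dz)) (sinh (z + e * dz))) (at e)"
  unfolding Q1_def
  by (rule Q_deriv assms)+ (auto intro!: derivative_eq_intros)

lemma Q1_line_deriv:
  assumes "\<And>j. ((\<lambda>e. K e j) has_real_derivative K1 e j) (at e)"
    and "\<And>j. ((\<lambda>e. K1 e j) has_real_derivative K2 j) (at e)"
  shows "((\<lambda>e. Q1 (K e) (K1 e) dx dy dz (cosh (x + e * dx)) (sinh (x + e * dx)) (cosh (y + e * dy)) (sinh (y + e * dy))
      (cosh (z + e * dz)) (sinh (z + e * dz))) has_real_derivative
    Q2 (K e) (K1 e) K2 dx dy dz (cosh (x + e * dx)) (sinh (x + e * dx)) (cosh (y + e * dy)) (sinh (y + e * dy))
      (cosh (z + e * dz)) (sinh (z + e * dz))) (at e)"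
proof -
  have c: "((\<lambda>e. cosh (x + e * dx)) has_real_derivative dx * sinh (x + e * dx)) (at e)"
    and s: "((\<lambda>e. sinh (x + e * dx)) has_real_derivative dx * cosh (x + e * dx)) (at e)" for x dx :: real
    by (auto intro!: derivative_eq_intros)
  show ?thesis
    unfolding Q1_def
    by (rule DERIV_cong, (rule derivative_intros Q_deriv assms c s)+) (simp add: Q2_def algebra_simps power2_eq_square)
qed

definition "kD1 dt dw t w j = kt j t w * dt + kw j t w * dw"

definition "kD2 dt dw t w j = ktt j t w * dt ^ 2 + 2 * ktw j t w * dt * dw + kww j t w * dw ^ 2"

text \<open>\<open>VA\<close> is the trilinear form at \<open>z = 0\<close>, so the last pair is
  \<open>(1, 0)\<close>; the coefficient 3, which multiplies \<open>sinh z\<close>, is set to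
  0.\<close>

lemma VA_eq_Q: "VA t w x y = Q ((\<lambda>j. kf j t w)(3 := 0)) (cosh x) (sinh x) (cosh y) (sinh y) 1 0"
  by (simp add: VA_def VV2_def Q_def algebra_simps)

lemma VC_eq_Q: "VC r x y z = Q (\<lambda>j. kf j r 0) (cosh x) (sinh x) (cosh y) (sinh y) (cosh z) (sinh z)"
  by (simp add: VC_def VV3_def VV2_def Q_def algebra_simps)

section \<open>Identities between the coefficient functions at \<open>w = 0\<close>\<close>

context
  fixes t C S X :: real and i j x :: real
  assumes t: "t > 0"
begin

text \<open>The reciprocals appear as separate factors \<open>1 / S\<close> and
  \<open>1 / C\<close>. Once these are abbreviated, all relations are polynomial and can serve as
  ideal generators for \<open>algebra\<close>.\<close>

lemma closed_forms:
  defines "C \<equiv> cosh t" and "S \<equiv> sinh t"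
  shows "C ^ 2 = 1 + S ^ 2" "S * (1 / S) = 1" "C * (1 / C) = 1"
    "5 * Xint 1 t = S * gam t + kap * (1 / C)"
    "6 * Xint 2 t = C * gam t + 2 * kap * theta t + Xint 0 t"
    "7 * Xint 3 t = C ^ 2 * (1 / S) * gam t + kap * Lam t + 2 * Xint 1 t"
    "8 * Xint 4 t = C ^ 3 * (1 / S) ^ 2 * gam t + kap * (1 / S) + 3 * Xint 2 t"
    "18 * Xint 5 t = 2 * C ^ 4 * (1 / S) ^ 3 * gam t + kap * (C * (1 / S) ^ 2 + Lam t) + 8 * Xint 3 t"
proof -
  have S: "S > 0" "C > 0" using t by (auto simp: S_def C_def)
  show "C ^ 2 = 1 + S ^ 2" "S * (1 / S) = 1" "C * (1 / C) = 1"
    using S by (simp_all add: C_def S_def cosh_sq)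
  show "5 * Xint 1 t = S * gam t + kap * (1 / C)" "6 * Xint 2 t = C * gam t + 2 * kap * theta t + Xint 0 t"
    using Xint_1[OF t] Xint_2[OF t] by (simp_all add: C_def S_def)
  have p: "S * cth t ^ 2 = C ^ 2 * (1 / S)" "S * cth t ^ 3 = C ^ 3 * (1 / S) ^ 2" "S * cth t ^ 4 = C ^ 4 * (1 / S) ^ 3"
    using S by (simp_all add: cth_def C_def[symmetric] S_def[symmetric] field_simps eval_nat_numeral)
  show "7 * Xint 3 t = C ^ 2 * (1 / S) * gam t + kap * Lam t + 2 * Xint 1 t"
    "8 * Xint 4 t = C ^ 3 * (1 / S) ^ 2 * gam t + kap * (1 / S) + 3 * Xint 2 t"
    using Xint_3[OF t] Xint_4[OF t] unfolding S_def[symmetric] C_def[symmetric] p by simp_all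
  show "18 * Xint 5 t = 2 * C ^ 4 * (1 / S) ^ 3 * gam t + kap * (C * (1 / S) ^ 2 + Lam t) + 8 * Xint 3 t"
    using Xint_5[OF t] S unfolding S_def[symmetric] C_def[symmetric] p by (simp add: field_simps power2_eq_square)
qed

lemma kf_w0:
  "kf 0 t 0 = 2 * kap * theta t * cosh t + cosh t * Xint 0 t - sinh t * Xint 1 t"
  "kf 1 t 0 = - kap - cosh t * Xint 1 t + sinh t * Xint 2 t"
  "kf 2 t 0 = kap * sinh t * Lam t + cosh t * Xint 2 t - sinh t * Xint 3 t"
  "kf 3 t 0 = kap * (cosh t * Lam t - 2) - cosh t * Xint 3 t + sinh t * Xint 4 t"
  "kt 0 t 0 = 2 * kap * theta t * sinh t - kap + sinh t * Xint 0 t - cosh t * Xint 1 t"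
  "kt 1 t 0 = - sinh t * Xint 1 t + cosh t * Xint 2 t"
  "kt 2 t 0 = kap * (cosh t * Lam t - 1) + sinh t * Xint 2 t - cosh t * Xint 3 t"
  "kt 3 t 0 = kap * (sinh t * Lam t - cosh t * (1 / sinh t)) - sinh t * Xint 3 t + cosh t * Xint 4 t"
  "kw 0 t 0 = 2 * (- cosh t * Xint 1 t + sinh t * Xint 2 t)"
  "kw 1 t 0 = 2 * (cosh t * Xint 2 t - sinh t * Xint 3 t)"
  "kw 2 t 0 = 2 * (- cosh t * Xint 3 t + sinh t * Xint 4 t)"
  "ktt 0 t 0 = 2 * kap * theta t * cosh t - kap * sinh t * (1 / cosh t) + cosh t * Xint 0 t - sinh t * Xint 1 t + gam t"
  "ktt 1 t 0 = - cosh t * Xint 1 t + sinh t * Xint 2 t - cosh t * (1 / sinh t) * gam t"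
  "ktt 2 t 0 = kap * (sinh t * Lam t - cosh t * (1 / sinh t)) + cosh t * Xint 2 t - sinh t * Xint 3 t + cosh t ^ 2 * (1 / sinh t) ^ 2 * gam t"
  "ktw 0 t 0 = 2 * (- sinh t * Xint 1 t + cosh t * Xint 2 t)"
  "ktw 1 t 0 = 2 * (sinh t * Xint 2 t - cosh t * Xint 3 t)"
  "ktw 2 t 0 = 2 * (- sinh t * Xint 3 t + cosh t * Xint 4 t)"
  "kww 0 t 0 = 4 * (cosh t * Xint 2 t - sinh t * Xint 3 t)"
  "kww 1 t 0 = 4 * (- cosh t * Xint 3 t + sinh t * Xint 4 t)"
  "kww 2 t 0 = 4 * (cosh t * Xint 4 t - sinh t * Xint 5 t)"
  unfolding kf_def kt_def ktt_def kw_def ktw_def kww_def Iint_def Jint_def Fk_def Xint_def cth_def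
  by (simp_all add: eval_nat_numeral algebra_simps)

text \<open>First-order matching of \<open>VA\<close> and \<open>VC\<close>: in terms of the
  arguments of \<open>VC\<close>, those of \<open>VA\<close> are \<open>t = r + z / 2\<close>,
  \<open>w = - 3 / 2 * z\<close>, \<open>x + z / 2\<close> and \<open>y + z / 2\<close>. Comparing
  coefficients in the \<open>z\<close>-derivatives at \<open>z = 0\<close> gives the first three
  equations; the others are their derivatives in \<open>t\<close>.\<close>

lemma interface_1:
  "3 * kw 0 t 0 = kt 0 t 0"
  "3 * kw 1 t 0 = kt 1 t 0 + kf 0 t 0 - kf 2 t 0"
  "3 * kw 2 t 0 = kt 2 t 0 + 2 * kf 1 t 0 - 2 * kf 3 t 0"
  "3 * ktw 0 t 0 = ktt 0 t 0"
  "3 * ktw 1 t 0 = ktt 1 t 0 + kt 0 t 0 - kt 2 t 0"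
  "3 * ktw 2 t 0 = ktt 2 t 0 + 2 * kt 1 t 0 - 2 * kt 3 t 0"
proof -
  define C S i k where "C = cosh t" and "S = sinh t" and "i = 1 / S" and "k = 1 / C"
  note cf = closed_forms[folded C_def S_def, folded i_def k_def]
  note kk = kf_w0[folded C_def S_def, folded i_def k_def]
  show "3 * kw 0 t 0 = kt 0 t 0" unfolding kk using cf(1-5) by algebra
  show "3 * kw 1 t 0 = kt 1 t 0 + kf 0 t 0 - kf 2 t 0" unfolding kk using cf(1-6) by algebra
  show "3 * kw 2 t 0 = kt 2 t 0 + 2 * kf 1 t 0 - 2 * kf 3 t 0" unfolding kk using cf(1-7) by algebra
  show "3 * ktw 0 t 0 = ktt 0 t 0" unfolding kk using cf(1-5) by algebra
  show "3 * ktw 1 t 0 = ktt 1 t 0 + kt 0 t 0 - kt 2 t 0" unfolding kk using cf(1-6) by algebra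
  show "3 * ktw 2 t 0 = ktt 2 t 0 + 2 * kt 1 t 0 - 2 * kt 3 t 0" unfolding kk using cf(1-7) by algebra
qed

text \<open>The direction \<open>(- 1 / 2, 3 / 2)\<close> is what lowering \<open>z\<close> by 1
  does to \<open>(t, w)\<close>. The equations say that under this motion \<open>VA\<close>
  reproduces itself to second order at \<open>w = 0\<close>, as \<open>VC\<close> does.\<close>

lemma interface_2:
  defines "d1 \<equiv> kD1 (- 1 / 2) (3 / 2) t 0" and "d2 \<equiv> kD2 (- 1 / 2) (3 / 2) t 0"
  shows "d2 0 = (kf 0 t 0 - kf 2 t 0) / 2 + 2 * d1 1"
    "d2 1 = d1 0 + d1 2"
    "d2 2 = (kf 2 t 0 - kf 0 t 0) / 2 + 2 * d1 1"
proof -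
  define C S i k where "C = cosh t" and "S = sinh t" and "i = 1 / S" and "k = 1 / C"
  note cf = closed_forms[folded C_def S_def, folded i_def k_def]
  note kk = kf_w0[folded C_def S_def, folded i_def k_def]
  have e: "2 * d1 j = 3 * kw j t 0 - kt j t 0" for j
    by (simp add: d1_def kD1_def algebra_simps)
  have e2: "4 * d2 j = ktt j t 0 - 6 * ktw j t 0 + 9 * kww j t 0" for j
    by (simp add: d2_def kD2_def algebra_simps power2_eq_square)
  have "ktt 0 t 0 - 6 * ktw 0 t 0 + 9 * kww 0 t 0 = 2 * (kf 0 t 0 - kf 2 t 0) + 4 * (3 * kw 1 t 0 - kt 1 t 0)"
    unfolding kk using cf(1-6) by algebra
  then show "d2 0 = (kf 0 t 0 - kf 2 t 0) / 2 + 2 * d1 1" using e[of 1] e2[of 0] by (simp add: field_simps)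
  have "ktt 1 t 0 - 6 * ktw 1 t 0 + 9 * kww 1 t 0 = 2 * (3 * kw 0 t 0 - kt 0 t 0) + 2 * (3 * kw 2 t 0 - kt 2 t 0)"
    unfolding kk using cf(1-7) by algebra
  then show "d2 1 = d1 0 + d1 2" using e[of 0] e[of 2] e2[of 1] by (simp add: field_simps)
  have "ktt 2 t 0 - 6 * ktw 2 t 0 + 9 * kww 2 t 0 = 2 * (kf 2 t 0 - kf 0 t 0) + 4 * (3 * kw 1 t 0 - kt 1 t 0)"
    unfolding kk using cf by algebra
  then show "d2 2 = (kf 2 t 0 - kf 0 t 0) / 2 + 2 * d1 1" using e[of 1] e2[of 2] by (simp add: field_simps)
qed


text \<open>The arguments on the left are the direction \<open>(dr, dx, dy, dz)\<close> rewritten in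
  the coordinates of \<open>VA\<close>. By the two preceding lemmas all \<open>w\<close>-derivatives
  are expressed through \<open>kf\<close>, \<open>kt\<close> and \<open>ktt\<close>, and the two
  Hessians become the same quadratic form.\<close>

lemma hessian_match:
  fixes dr dx dy dz :: real
  defines "KA \<equiv> (\<lambda>j. kf j t 0)(3 := 0)"
  defines "KA1 \<equiv> (kD1 (dr + dz / 2) (- 3 / 2 * dz) t 0)(3 := 0)"
  defines "KA2 \<equiv> (kD2 (dr + dz / 2) (- 3 / 2 * dz) t 0)(3 := 0)"
  shows "Q2 KA KA1 KA2 (dx + dz / 2) (dy + dz / 2) 0 cx sx cy sy 1 0
    = Q2 (\<lambda>j. kf j t 0) (kD1 dr 0 t 0) (kD2 dr 0 t 0) dx dy dz cx sx cy sy 1 0"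
proof -
  define h where "h = dz / 2"
  have dz: "dz = 2 * h" "- 3 / 2 * dz = - 3 * h" by (simp_all add: h_def)
  define a b c where "a j = kf j t 0" and "b j = kt j t 0" and "c j = ktt j t 0" for j
  have kw: "kw 0 t 0 = b 0 / 3" "kw 1 t 0 = (b 1 + a 0 - a 2) / 3" "kw 2 t 0 = (b 2 + 2 * a 1 - 2 * a 3) / 3"
    and ktw: "ktw 0 t 0 = c 0 / 3" "ktw 1 t 0 = (c 1 + b 0 - b 2) / 3" "ktw 2 t 0 = (c 2 + 2 * b 1 - 2 * b 3) / 3"
    using interface_1 by (simp_all add: a_def b_def c_def)
  have kww: "kww 0 t 0 = (6 * a 0 - 6 * a 2 + c 0) / 9"
    "kww 1 t 0 = (4 * a 1 - 4 * a 3 + c 1 + 2 * b 0 - 2 * b 2) / 9"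
    "kww 2 t 0 = (2 * a 0 - 2 * a 2 + c 2 + 4 * b 1 - 4 * b 3) / 9"
    using interface_2 kw ktw by (simp_all add: kD1_def kD2_def power2_eq_square a_def b_def c_def field_simps)
  have "Q2 KA KA1 KA2 (dx + dz / 2) (dy + dz / 2) 0 cx sx cy sy 1 0
    = Q2 (a(3 := 0)) ((\<lambda>j. b j * (dr + h) - 3 * kw j t 0 * h)(3 := 0))
      ((\<lambda>j. c j * (dr + h) ^ 2 - 6 * ktw j t 0 * (dr + h) * h + 9 * kww j t 0 * h ^ 2)(3 := 0)) (dx + h) (dy + h) 0 cx sx cy sy 1 0"
    unfolding Q2_def Q_def
    by (simp add: KA_def KA1_def KA2_def kD1_def kD2_def a_def b_def c_def dz power_mult_distrib mult_ac)
  also have "\<dots> = Q2 a (\<lambda>j. b j * dr) (\<lambda>j. c j * dr ^ 2) dx dy (2 * h) cx sx cy sy 1 0"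
  proof -
    have 3: "3 * kw 0 t 0 = b 0" "3 * kw (Suc 0) t 0 = b 1 + a 0 - a 2" "3 * kw 2 t 0 = b 2 + 2 * a 1 - 2 * a 3"
      "6 * ktw 0 t 0 = 2 * c 0" "6 * ktw (Suc 0) t 0 = 2 * (c 1 + b 0 - b 2)" "6 * ktw 2 t 0 = 2 * (c 2 + 2 * b 1 - 2 * b 3)"
      "9 * kww 0 t 0 = 6 * a 0 - 6 * a 2 + c 0"
      "9 * kww (Suc 0) t 0 = 4 * a 1 - 4 * a 3 + c 1 + 2 * b 0 - 2 * b 2"
      "9 * kww 2 t 0 = 2 * a 0 - 2 * a 2 + c 2 + 4 * b 1 - 4 * b 3"
      using kw ktw kww by simp_all
    show ?thesis
      unfolding Q2_def Q_def fun_upd_def by (simp add: 3) algebra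
  qed
  also have "\<dots> = Q2 (\<lambda>j. kf j t 0) (kD1 dr 0 t 0) (kD2 dr 0 t 0) dx dy dz cx sx cy sy 1 0"
    by (simp add: a_def[abs_def] b_def c_def kD1_def[abs_def] kD2_def[abs_def] dz)
  finally show ?thesis .
qed

text \<open>On the line where all four coordinates agree, the second derivatives have the full permutation
  symmetry, also in the variable of the coefficient functions.\<close>

lemma vertex_hessian:
  defines "C \<equiv> cosh t" and "S \<equiv> sinh t"
  defines "V \<equiv> kf 0 t 0 * C ^ 3 + 3 * kf 1 t 0 * S * C ^ 2 + 3 * kf 2 t 0 * S ^ 2 * C + kf 3 t 0 * S ^ 3"
    and "\<beta> \<equiv> kf 0 t 0 * S ^ 2 * C + kf 1 t 0 * (2 * S * C ^ 2 + S ^ 3) + kf 2 t 0 * (C ^ 3 + 2 * S ^ 2 * C) + kf 3 t 0 * C ^ 2 * S"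
  shows "ktt 0 t 0 * C ^ 3 + 3 * ktt 1 t 0 * S * C ^ 2 + 3 * ktt 2 t 0 * S ^ 2 * C + ktt 3 t 0 * S ^ 3 = V"
    and "kt 0 t 0 * S * C ^ 2 + kt 1 t 0 * (C ^ 3 + 2 * S ^ 2 * C) + kt 2 t 0 * (2 * S * C ^ 2 + S ^ 3) + kt 3 t 0 * S ^ 2 * C = \<beta>"
proof -
  define i k where "i = 1 / S" and "k = 1 / C"
  note cf = closed_forms[folded C_def S_def, folded i_def k_def]
  note kk = kf_w0[folded C_def S_def, folded i_def k_def]
  have k3: "ktt 3 t 0 = kap * (C * Lam t - 1 + i ^ 2) - C * Xint 3 t + S * Xint 4 t - C ^ 3 * i ^ 3 * gam t"
    unfolding ktt_def Iint_def Fk_def Xint_def cth_def C_def S_def i_def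
    by (simp add: eval_nat_numeral algebra_simps)
  show "ktt 0 t 0 * C ^ 3 + 3 * ktt 1 t 0 * S * C ^ 2 + 3 * ktt 2 t 0 * S ^ 2 * C + ktt 3 t 0 * S ^ 3 = V"
    unfolding V_def kk k3 using cf(1-3) by algebra
  show "kt 0 t 0 * S * C ^ 2 + kt 1 t 0 * (C ^ 3 + 2 * S ^ 2 * C) + kt 2 t 0 * (2 * S * C ^ 2 + S ^ 3) + kt 3 t 0 * S ^ 2 * C = \<beta>"
    unfolding \<beta>_def kk using cf(1-3) by algebra
qed

end

section \<open>The residual as a multilinear form\<close>

definition "uQ K K1 K2 dx dy dz cx sx cy sy cz sz = Q K cx sx cy sy cz sz - Q2 K K1 K2 dx dy dz cx sx cy sy cz sz"

definition "uC dr dx dy dz r x y z = uQ (\<lambda>j. kf j r 0) (kD1 dr 0 r 0) (kD2 dr 0 r 0) dx dy dz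
    (cosh x) (sinh x) (cosh y) (sinh y) (cosh z) (sinh z)"

lemma uQ_linear:
  "uQ K K1 K2 dx dy dz cx sx cy sy cz sz = cx * uQ K K1 K2 dx dy dz 1 0 cy sy cz sz + sx * uQ K K1 K2 dx dy dz 0 1 cy sy cz sz"
  unfolding uQ_def Q2_def Q_def by algebra

lemma uQ_swap12: "uQ K K1 K2 dx dy dz cx sx cy sy cz sz = uQ K K1 K2 dy dx dz cy sy cx sx cz sz"
  unfolding uQ_def Q2_def Q_def by algebra

lemma uQ_swap23: "uQ K K1 K2 dx dy dz cx sx cy sy cz sz = uQ K K1 K2 dx dz dy cx sx cz sz cy sy"
  unfolding uQ_def Q2_def Q_def by algebra

lemma uC_swap12: "uC dr dx dy dz r x y z = uC dr dy dx dz r y x z"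
  unfolding uC_def by (rule uQ_swap12)

lemma uC_swap23: "uC dr dx dy dz r x y z = uC dr dx dz dy r x z y"
  unfolding uC_def by (rule uQ_swap23)

lemma cosh_sinh_nonneg_between:
  fixes A B r x :: real
  assumes "A \<ge> 0" "A * cosh r + B * sinh r \<ge> 0" "0 \<le> x" "x \<le> r" "r > 0"
  shows "A * cosh x + B * sinh x \<ge> 0"
proof -
  have "sinh r * (A * cosh x + B * sinh x) = sinh (r - x) * A + sinh x * (A * cosh r + B * sinh r)"
    by (simp add: sinh_diff algebra_simps)
  also have "\<dots> \<ge> 0" using assms by simp
  finally show ?thesis using assms by (simp add: zero_le_mult_iff)
qed

lemma uC_interpolate:
  assumes "uC dr dx dy dz r 0 y z \<ge> 0" "uC dr dx dy dz r r y z \<ge> 0" "0 \<le> x" "x \<le> r" "r > 0"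
  shows "uC dr dx dy dz r x y z \<ge> 0"
proof -
  define A B where "A = uQ (\<lambda>j. kf j r 0) (kD1 dr 0 r 0) (kD2 dr 0 r 0) dx dy dz 1 0 (cosh y) (sinh y) (cosh z) (sinh z)"
    and "B = uQ (\<lambda>j. kf j r 0) (kD1 dr 0 r 0) (kD2 dr 0 r 0) dx dy dz 0 1 (cosh y) (sinh y) (cosh z) (sinh z)"
  have "uC dr dx dy dz r x' y z = A * cosh x' + B * sinh x'" for x'
    unfolding uC_def A_def B_def by (subst uQ_linear) simp
  then show ?thesis using assms cosh_sinh_nonneg_between[of A r B x] by simp
qed

text \<open>By \<open>vertex_hessian\<close>, the Hessian in \<open>(r, x, y, z)\<close> at this
  vertex has every diagonal entry \<open>V\<close> and every other entry \<open>\<beta>\<close>, so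
  only the sum of squares and the sum of pair products of the direction count.\<close>

lemma uC_vertex:
  assumes "r > 0"
  defines "V \<equiv> kf 0 r 0 * cosh r ^ 3 + 3 * kf 1 r 0 * sinh r * cosh r ^ 2 + 3 * kf 2 r 0 * sinh r ^ 2 * cosh r + kf 3 r 0 * sinh r ^ 3"
    and "\<beta> \<equiv> kf 0 r 0 * sinh r ^ 2 * cosh r + kf 1 r 0 * (2 * sinh r * cosh r ^ 2 + sinh r ^ 3)
      + kf 2 r 0 * (cosh r ^ 3 + 2 * sinh r ^ 2 * cosh r) + kf 3 r 0 * cosh r ^ 2 * sinh r"
  shows "uC dr dx dy dz r r r r = V * (1 - dr ^ 2 - dx ^ 2 - dy ^ 2 - dz ^ 2)
    - 2 * \<beta> * (dr * dx + dr * dy + dr * dz + dx * dy + dx * dz + dy * dz)"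
  unfolding uC_def uQ_def Q2_def Q_def kD1_def kD2_def V_def \<beta>_def
  using vertex_hessian[OF assms(1)] by simp algebra

section \<open>The vertex inequalities\<close>

text \<open>At the vertex \<open>Xint 0\<close> and \<open>theta\<close> occur in this combination
  only, because both \<open>kf 0 t 0\<close> and \<open>Xint 2\<close> contain them this
  way.\<close>

definition TT :: "real \<Rightarrow> real" where "TT t = Xint 0 t + 2 * kap * theta t"

lemma TT_deriv: "t > 0 \<Longrightarrow> (TT has_real_derivative - (sinh t * gam t) - kap / cosh t) (at t)"
  unfolding TT_def[abs_def]
  by (rule DERIV_cong, (rule derivative_intros Xint_deriv theta_deriv | assumption)+) simp

lemma TT_tendsto_0: "(TT \<longlongrightarrow> 0) at_top"
proof -
  have "((\<lambda>t. Xint 0 t + 2 * kap * theta t) \<longlongrightarrow> 0 + 2 * kap * 0) at_top"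
    by (intro tendsto_intros Xint_tendsto_0 theta_tendsto_0)
  then show ?thesis by (simp add: TT_def[abs_def])
qed

lemma cosh_gam_tendsto_0: "((\<lambda>t. cosh t * gam t) \<longlongrightarrow> 0) at_top"
  by (rule Lim_transform_eventually[OF gam_term_tendsto_0[of 1]])
    (use eventually_gt_at_top[of 0] in \<open>eventually_elim, simp add: cth_def\<close>)

text \<open>Combinations of \<open>TT\<close>, \<open>Lam\<close>, \<open>gam\<close> and 1 are
  closed under differentiation, and a constant coefficient of \<open>TT\<close> or
  \<open>Lam\<close> removes that function from the derivative.\<close>

lemma combination_deriv:
  assumes "t > 0" "(a has_real_derivative a') (at t)" "(b has_real_derivative b') (at t)"
    "(c has_real_derivative c') (at t)" "(d has_real_derivative d') (at t)"
  shows "((\<lambda>t. TT t * a t + kap * Lam t * b t + gam t * c t + kap * d t) has_real_derivative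
    TT t * a' + kap * Lam t * b' + gam t * (c' - 6 * (cosh t / sinh t) * c t - sinh t * a t)
    + kap * (d' - a t / cosh t - b t / sinh t + c t / cosh t ^ 2)) (at t)"
  by (rule DERIV_cong, (rule derivative_intros assms TT_deriv Lam_deriv gam_deriv)+)
    (simp add: cth_def algebra_simps diff_divide_distrib)

lemma quotient_deriv:
  assumes "(n has_real_derivative n') (at t)" "(d has_real_derivative d') (at t)" "d t \<noteq> (0::real)"
    "n' * d t - n t * d' = r"
  shows "((\<lambda>t. n t / d t) has_real_derivative r / d t ^ 2) (at t)"
  using DERIV_divide[OF assms(1-3)] by (simp add: assms(4) power2_eq_square)

definition "vertex_v t = kf 0 t 0 * cosh t ^ 3 + 3 * kf 1 t 0 * sinh t * cosh t ^ 2 + 3 * kf 2 t 0 * sinh t ^ 2 * cosh t + kf 3 t 0 * sinh t ^ 3"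

definition "vertex_b t = kf 0 t 0 * sinh t ^ 2 * cosh t + kf 1 t 0 * (2 * sinh t * cosh t ^ 2 + sinh t ^ 3)
      + kf 2 t 0 * (cosh t ^ 3 + 2 * sinh t ^ 2 * cosh t) + kf 3 t 0 * cosh t ^ 2 * sinh t"

text \<open>Two eliminations: \<open>f\<close> is the difference normalised to coefficient 1 of
  \<open>TT\<close>, so \<open>TT\<close> is absent from its derivative, which is a negative
  multiple of \<open>f2\<close>. There \<open>Lam\<close> has coefficient 1 and disappears in turn.
  In the derivative of \<open>f2\<close> the coefficients of \<open>gam\<close> and of 1 are both
  negative.\<close>

lemma vertex_lower:
  assumes "t > 0" shows "vertex_v t \<le> 6 * vertex_b t"
proof -
  \<comment> \<open>Up to powers of \<open>sinh\<close> and \<open>cosh\<close>, the coefficients of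
    \<open>TT\<close>, \<open>Lam\<close>, \<open>gam\<close> and 1 in
    \<open>112 * (6 * vertex_b s - vertex_v s)\<close> after reduction by the closed forms.\<close>
  define A B D E where "A s = 1050 + 1155 * sinh s ^ 2" and "B s = 1152 + 1920 * sinh s ^ 2"
    and "D s = 4 - 12 * sinh s ^ 2 - 231 * sinh s ^ 4" and "E s = - 2524 - 3306 * sinh s ^ 2" for s :: real
  \<comment> \<open>Polynomial factors in the derivative of \<open>f\<close>: \<open>l\<close> in
    the coefficient of \<open>Lam\<close>, \<open>n\<close> in the elementary term.\<close>
  define l n where "l s = 30 + 49 * sinh s ^ 2 + 21 * sinh s ^ 4" and "n s = 215 + 336 * sinh s ^ 2 + 126 * sinh s ^ 4" for s :: real
  define f where "f s = TT s * 1 + kap * Lam s * (cosh s * B s / (sinh s * A s)) + gam s * (cosh s * D s / (sinh s ^ 2 * A s))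
     + kap * (E s / (sinh s * A s))" for s
  define f2 where "f2 s = TT s * 0 + kap * Lam s * 1 + gam s * (5 / (6 * sinh s * l s)) + kap * (- n s / (6 * cosh s * l s))" for s
  have A: "A s > 0" and l: "l s > 0" for s by (simp_all add: A_def l_def add_pos_nonneg)
  have f2_nonneg: "f2 s \<ge> 0" if "s > 0" for s
  proof (rule nonneg_if_decreasing_to_0[OF _ _ _ that])
    fix s :: real assume s: "s > 0"
    define S C where "S = sinh s" and "C = cosh s"
    have S: "S > 0" "C > 0" and CS: "C ^ 2 = 1 + S ^ 2" using s by (auto simp: S_def C_def cosh_sq)
    define L where "L = 30 + 49 * S ^ 2 + 21 * S ^ 4"
    have L: "L > 0" "l s = L" using l[of s] by (simp_all add: L_def l_def S_def)
    have l': "(l has_real_derivative 98 * S * C + 84 * S ^ 3 * C) (at s)"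
      unfolding l_def[abs_def] S_def C_def by (auto intro!: derivative_eq_intros)
    have n': "(n has_real_derivative 672 * S * C + 504 * S ^ 3 * C) (at s)"
      unfolding n_def[abs_def] S_def C_def by (auto intro!: derivative_eq_intros)
    have c: "((\<lambda>s. 5 / (6 * sinh s * l s)) has_real_derivative
        (- 30 * (C * L + S * (98 * S * C + 84 * S ^ 3 * C))) / (6 * sinh s * l s) ^ 2) (at s)"
      using s L by (intro quotient_deriv) (auto intro!: derivative_eq_intros l' simp: S_def C_def algebra_simps)
    have d: "((\<lambda>s. - n s / (6 * cosh s * l s)) has_real_derivative
        (- (672 * S * C + 504 * S ^ 3 * C) * (6 * C * L) + n s * (6 * (S * L + C * (98 * S * C + 84 * S ^ 3 * C)))) / (6 * cosh s * l s) ^ 2) (at s)"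
      using s L by (intro quotient_deriv) (auto intro!: derivative_eq_intros l' n' simp: S_def C_def algebra_simps)
    note D = combination_deriv[OF s DERIV_const DERIV_const c d, of 0 1]
    have e1: "(- 30 * (C * L + S * (98 * S * C + 84 * S ^ 3 * C))) / (6 * S * L) ^ 2 - 6 * (C / S) * (5 / (6 * S * L))
        = - (C ^ 3 * (175 + 385 / 2 * S ^ 2)) / (S ^ 2 * L ^ 2)"
    proof -
      have "(- 30 * (C * L + S * (98 * S * C + 84 * S ^ 3 * C))) - 180 * C * L = - 36 * (C ^ 3 * (175 + 385 / 2 * S ^ 2))"
        unfolding L_def using CS by (simp add: field_simps) algebra
      moreover have "6 * (C / S) * (5 / (6 * S * L)) = 180 * C * L / (6 * S * L) ^ 2"
        using S L by (simp add: power2_eq_square)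
      ultimately have "(- 30 * (C * L + S * (98 * S * C + 84 * S ^ 3 * C))) / (6 * S * L) ^ 2 - 6 * (C / S) * (5 / (6 * S * L))
        = - 36 * (C ^ 3 * (175 + 385 / 2 * S ^ 2)) / (6 * S * L) ^ 2"
        by (simp only: diff_divide_distrib[symmetric])
      then show ?thesis by (simp add: power_mult_distrib)
    qed
    have e2: "(- (672 * S * C + 504 * S ^ 3 * C) * (6 * C * L) + n s * (6 * (S * L + C * (98 * S * C + 84 * S ^ 3 * C)))) / (6 * C * L) ^ 2
        - 1 / S + 5 / (6 * S * L) / C ^ 2 = - (875 + 3395 / 2 * S ^ 2 + 1617 / 2 * S ^ 4) / (S * L ^ 2)"
    proof -
      have n: "n s = 215 + 336 * S ^ 2 + 126 * S ^ 4" by (simp add: n_def S_def)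
      define R where "R = 875 + 3395 / 2 * S ^ 2 + 1617 / 2 * S ^ 4"
      have "(- (672 * S * C + 504 * S ^ 3 * C) * (6 * C * L) + n s * (6 * (S * L + C * (98 * S * C + 84 * S ^ 3 * C)))) * S
          - 36 * C ^ 2 * L ^ 2 + 30 * L = - 36 * C ^ 2 * R"
        unfolding n L_def R_def using CS by (simp add: field_simps) algebra
      then have "((- (672 * S * C + 504 * S ^ 3 * C) * (6 * C * L) + n s * (6 * (S * L + C * (98 * S * C + 84 * S ^ 3 * C)))) * S
          - 36 * C ^ 2 * L ^ 2 + 30 * L) / (36 * S * C ^ 2 * L ^ 2) = - R / (S * L ^ 2)"
        using S L by simp
      then show ?thesis
        unfolding R_def[symmetric] using S L by (simp add: add_divide_distrib diff_divide_distrib power2_eq_square mult_ac)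
    qed
    show "(f2 has_real_derivative gam s * (- (C ^ 3 * (175 + 385 / 2 * S ^ 2)) / (S ^ 2 * L ^ 2))
        + kap * (- (875 + 3395 / 2 * S ^ 2 + 1617 / 2 * S ^ 4) / (S * L ^ 2))) (at s)"
      unfolding f2_def[abs_def]
      by (rule DERIV_cong[OF D], simp only: S_def[symmetric] C_def[symmetric] L(2) mult_zero_right diff_zero div_0 e1 e2)
    show "gam s * (- (C ^ 3 * (175 + 385 / 2 * S ^ 2)) / (S ^ 2 * L ^ 2))
        + kap * (- (875 + 3395 / 2 * S ^ 2 + 1617 / 2 * S ^ 4) / (S * L ^ 2)) \<le> 0"
    proof -
      have "0 \<le> gam s * (C ^ 3 * (175 + 385 / 2 * S ^ 2) / (S ^ 2 * L ^ 2))"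
        using S gam_nonneg[OF s] by (intro mult_nonneg_nonneg divide_nonneg_nonneg add_nonneg_nonneg) auto
      moreover have "0 \<le> kap * ((875 + 3395 / 2 * S ^ 2 + 1617 / 2 * S ^ 4) / (S * L ^ 2))"
        using S by (intro mult_nonneg_nonneg divide_nonneg_nonneg add_nonneg_nonneg) auto
      ultimately show ?thesis
        by (simp only: minus_divide_left[symmetric] mult_minus_right)
    qed
  next
    have lims: "((\<lambda>s. 5 / (6 * sinh s * cosh s * l s)) \<longlongrightarrow> 0) at_top" "((\<lambda>s. - n s / (6 * cosh s * l s)) \<longlongrightarrow> 0) at_top"
      unfolding l_def n_def sinh_def cosh_def by (simp?, real_asymp, (simp add: power_divide; fail)?)+
    have "((\<lambda>s. kap * Lam s + cosh s * gam s * (5 / (6 * sinh s * cosh s * l s)) + kap * (- n s / (6 * cosh s * l s)))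
        \<longlongrightarrow> kap * 0 + 0 * 0 + kap * 0) at_top"
      by (intro tendsto_add tendsto_mult tendsto_const lims Lam_tendsto_0 cosh_gam_tendsto_0)
    then show "(f2 \<longlongrightarrow> 0) at_top"
      by (simp add: f2_def[abs_def] mult_ac)
  qed
  have f_nonneg: "f t \<ge> 0"
  proof (rule nonneg_if_decreasing_to_0[OF _ _ _ assms])
    fix s :: real assume s: "s > 0"
    define S C where "S = sinh s" and "C = cosh s"
    have S: "S > 0" "C > 0" and CS: "C ^ 2 = 1 + S ^ 2" using s by (auto simp: S_def C_def cosh_sq)
    define a L where "a = 1050 + 1155 * S ^ 2" and "L = 30 + 49 * S ^ 2 + 21 * S ^ 4"
    have L: "L > 0" "l s = L" "a > 0" "A s = a" using l[of s] A[of s] by (simp_all add: L_def l_def S_def a_def A_def)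
    have A': "(A has_real_derivative 2310 * S * C) (at s)" and B': "(B has_real_derivative 3840 * S * C) (at s)"
      and D': "(D has_real_derivative - 24 * S * C - 924 * S ^ 3 * C) (at s)" and E': "(E has_real_derivative - 6612 * S * C) (at s)"
      unfolding A_def[abs_def] B_def[abs_def] D_def[abs_def] E_def[abs_def] S_def C_def by (auto intro!: derivative_eq_intros)
    have bd: "B s = 1152 + 1920 * S ^ 2" "D s = 4 - 12 * S ^ 2 - 231 * S ^ 4" "E s = - 2524 - 3306 * S ^ 2"
      by (simp_all add: B_def D_def E_def S_def)
    have b: "((\<lambda>s. cosh s * B s / (sinh s * A s)) has_real_derivative (- 40320 * L) / (sinh s * A s) ^ 2) (at s)"
    proof (rule quotient_deriv)
      show "((\<lambda>s. cosh s * B s) has_real_derivative S * B s + C * (3840 * S * C)) (at s)"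
        "((\<lambda>s. sinh s * A s) has_real_derivative C * a + S * (2310 * S * C)) (at s)"
        using L by (auto intro!: derivative_eq_intros A' B' simp: S_def C_def)
      show "(S * B s + C * (3840 * S * C)) * (sinh s * A s) - cosh s * B s * (C * a + S * (2310 * S * C)) = - 40320 * L"
        unfolding bd L(4) a_def S_def[symmetric] C_def[symmetric] L_def using CS by algebra
    qed (use s L in auto)
    define dn where "dn = (S * D s + C * (- 24 * S * C - 924 * S ^ 3 * C)) * (S ^ 2 * a) - C * D s * (2 * S * C * a + S ^ 2 * (2310 * S * C))"
    have c: "((\<lambda>s. cosh s * D s / (sinh s ^ 2 * A s)) has_real_derivative dn / (sinh s ^ 2 * A s) ^ 2) (at s)"
    proof (rule quotient_deriv)
      show "((\<lambda>s. cosh s * D s) has_real_derivative S * D s + C * (- 24 * S * C - 924 * S ^ 3 * C)) (at s)"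
        by (auto intro!: derivative_eq_intros D' simp: S_def C_def)
      show "((\<lambda>s. sinh s ^ 2 * A s) has_real_derivative 2 * S * C * a + S ^ 2 * (2310 * S * C)) (at s)"
        using L by (auto intro!: derivative_eq_intros A' simp: S_def C_def)
      show "(S * D s + C * (- 24 * S * C - 924 * S ^ 3 * C)) * (sinh s ^ 2 * A s) - cosh s * D s * (2 * S * C * a + S ^ 2 * (2310 * S * C)) = dn"
        unfolding dn_def L(4) S_def C_def ..
    qed (use s L in auto)
    define en where "en = (- 6612 * S * C) * (S * a) - E s * (C * a + S * (2310 * S * C))"
    have d: "((\<lambda>s. E s / (sinh s * A s)) has_real_derivative en / (sinh s * A s) ^ 2) (at s)"
    proof (rule quotient_deriv[OF E'])
      show "((\<lambda>s. sinh s * A s) has_real_derivative C * a + S * (2310 * S * C)) (at s)"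
        using L by (auto intro!: derivative_eq_intros A' simp: S_def C_def)
      show "(- 6612 * S * C) * (sinh s * A s) - E s * (C * a + S * (2310 * S * C)) = en"
        unfolding en_def L(4) S_def C_def ..
    qed (use s L in auto)
    note Dv = combination_deriv[OF s DERIV_const b c d, of 1]
    have e1: "dn / (S ^ 2 * a) ^ 2 - 6 * (C / S) * (C * D s / (S ^ 2 * a)) - S * 1 = - 33600 / (S ^ 3 * a ^ 2)"
    proof -
      have "dn - 6 * C ^ 2 * D s * (S * a) - S ^ 5 * a ^ 2 = - 33600 * S"
        unfolding dn_def bd a_def using CS by algebra
      moreover have "- 33600 * S / (S ^ 4 * a ^ 2) = - 33600 / (S ^ 3 * a ^ 2)"
        using S L by (simp add: field_simps eval_nat_numeral)
      ultimately have "(dn - 6 * C ^ 2 * D s * (S * a) - S ^ 5 * a ^ 2) / (S ^ 4 * a ^ 2) = - 33600 / (S ^ 3 * a ^ 2)"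
        by (simp only:)
      moreover have "6 * C ^ 2 * D s * (S * a) / (S ^ 4 * a ^ 2) = 6 * (C / S) * (C * D s / (S ^ 2 * a))"
        "S ^ 5 * a ^ 2 / (S ^ 4 * a ^ 2) = S" "dn / (S ^ 4 * a ^ 2) = dn / (S ^ 2 * a) ^ 2"
        using S L by (simp_all add: field_simps eval_nat_numeral)
      ultimately show ?thesis by (simp add: diff_divide_distrib)
    qed
    have e2: "en / (S * a) ^ 2 - 1 / C - C * B s / (S * a) / S + C * D s / (S ^ 2 * a) / C ^ 2
        = 6720 * n s / (S ^ 2 * C * a ^ 2)"
    proof -
      have n: "n s = 215 + 336 * S ^ 2 + 126 * S ^ 4" by (simp add: n_def S_def)
      have "en * C - S ^ 2 * a ^ 2 - C ^ 2 * B s * a + D s * a = 6720 * n s"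
        unfolding en_def bd a_def n using CS by algebra
      moreover have "(en * C - S ^ 2 * a ^ 2 - C ^ 2 * B s * a + D s * a) / (S ^ 2 * C * a ^ 2) =
         en / (S * a) ^ 2 - 1 / C - C * B s / (S * a) / S + C * D s / (S ^ 2 * a) / C ^ 2"
        using S L by (simp add: field_simps power2_eq_square)
      ultimately show ?thesis by simp
    qed
    have "(f has_real_derivative TT s * 0 + kap * Lam s * ((- 40320 * L) / (S * a) ^ 2) + gam s * (- 33600 / (S ^ 3 * a ^ 2))
        + kap * (6720 * n s / (S ^ 2 * C * a ^ 2))) (at s)"
      unfolding f_def[abs_def]
      by (rule DERIV_cong[OF Dv], simp only: S_def[symmetric] C_def[symmetric] L(4) mult_zero_right diff_zero div_0 e1 e2)
    moreover have "TT s * 0 + kap * Lam s * ((- 40320 * L) / (S * a) ^ 2) + gam s * (- 33600 / (S ^ 3 * a ^ 2))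
        + kap * (6720 * n s / (S ^ 2 * C * a ^ 2)) = - (40320 * L / (S * a) ^ 2) * f2 s"
      unfolding f2_def S_def[symmetric] C_def[symmetric] L(2)
      using S L by (simp add: field_simps eval_nat_numeral)
    ultimately show "(f has_real_derivative - (40320 * L / (S * a) ^ 2) * f2 s) (at s)" by simp
    show "- (40320 * L / (S * a) ^ 2) * f2 s \<le> 0"
      using f2_nonneg[OF s] L by simp
  next
    have lims: "((\<lambda>s. cosh s * B s / (sinh s * A s)) \<longlongrightarrow> 128 / 77) at_top"
      "((\<lambda>s. D s / (sinh s ^ 2 * A s)) \<longlongrightarrow> - 1 / 5) at_top"
      "((\<lambda>s. E s / (sinh s * A s)) \<longlongrightarrow> 0) at_top"
      unfolding A_def B_def D_def E_def sinh_def cosh_def by (simp?, real_asymp, (simp add: power_divide; fail)?)+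
    have "((\<lambda>s. TT s + kap * Lam s * (cosh s * B s / (sinh s * A s)) + cosh s * gam s * (D s / (sinh s ^ 2 * A s)) + kap * (E s / (sinh s * A s)))
        \<longlongrightarrow> 0 + kap * 0 * (128 / 77) + 0 * (- 1 / 5) + kap * 0) at_top"
      by (intro tendsto_add tendsto_mult tendsto_const lims Lam_tendsto_0 cosh_gam_tendsto_0 TT_tendsto_0)
    then show "(f \<longlongrightarrow> 0) at_top"
      by (simp add: f_def[abs_def] mult_ac)
  qed
  define S C i k where "S = sinh t" and "C = cosh t" and "i = 1 / S" and "k = 1 / C"
  have S: "S > 0" "C > 0" using assms by (auto simp: S_def C_def)
  note cf = closed_forms[OF assms, folded C_def S_def, folded i_def k_def]
  note kk = kf_w0[OF assms, folded C_def S_def, folded i_def k_def]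
  have "112 * (6 * vertex_b t - vertex_v t) = S ^ 2 * A t * TT t + kap * Lam t * (S * C * B t) + gam t * (C * D t) + kap * (S * E t)"
    unfolding vertex_v_def vertex_b_def A_def B_def D_def E_def TT_def S_def[symmetric] C_def[symmetric] kk
    using cf(1-7) by algebra
  also have "\<dots> = S ^ 2 * A t * f t"
    unfolding f_def S_def[symmetric] C_def[symmetric] using S A[of t] by (simp add: field_simps power2_eq_square)
  also have "\<dots> \<ge> 0" using f_nonneg A[of t] by (simp add: less_imp_le)
  finally show ?thesis by simp
qed

lemma gam_le': "t > 0 \<Longrightarrow> gam t * (cosh t * (4 * sinh t ^ 2 + 5)) \<le> kap * sinh t"
proof -
  assume "t > 0"
  moreover have "cosh t * (4 * sinh t ^ 2 + 5) > 0" by (simp add: add_nonneg_pos)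
  ultimately show ?thesis using gam_le[of t] by (simp add: pos_le_divide_eq)
qed

text \<open>The eliminations in the opposite order: \<open>Lam\<close> first, normalised to
  coefficient -1, then \<open>TT\<close>. In the last derivative the coefficient of
  \<open>gam\<close> is positive, and the upper bound \<open>gam_le\<close> decides the
  sign.\<close>

lemma vertex_upper:
  assumes "t > 0" shows "12 * vertex_b t \<le> 5 * vertex_v t"
proof -
  \<comment> \<open>Here from \<open>560 * (5 * vertex_v s - 12 * vertex_b s)\<close>, with
    \<open>B\<close> taken from the negated coefficient of \<open>Lam\<close>.\<close>
  define A B D E where "A s = 1680 - 5460 * sinh s ^ 2 - 8085 * sinh s ^ 4" and "B s = 11520 + 13440 * sinh s ^ 2"
    and "D s = - 40 - 294 * sinh s ^ 2 + 1617 * sinh s ^ 4" and "E s = 18856 + 23142 * sinh s ^ 2" for s :: real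
  \<comment> \<open>Polynomial factors of \<open>TT\<close>, \<open>gam\<close> and 1 in the
    derivative of \<open>f\<close>.\<close>
  define l g w where "l s = 32 + 280 * sinh s ^ 2 + 490 * sinh s ^ 4 + 245 * sinh s ^ 6"
    and "g s = 16 + 28 * sinh s ^ 2 + 168 * sinh s ^ 4 + 147 * sinh s ^ 6" and "w s = 560 + 1428 * sinh s ^ 2 + 882 * sinh s ^ 4" for s :: real
  define f where "f s = TT s * (A s / (sinh s * cosh s * B s)) + kap * Lam s * - 1 + gam s * (D s / (sinh s * B s))
     + kap * (E s / (cosh s * B s))" for s
  define f2 where "f2 s = TT s * 1 + kap * Lam s * 0 + gam s * (- (cosh s * g s) / (3 * l s)) + kap * (- (sinh s * w s) / (3 * l s))" for s
  have B: "B s > 0" and l: "l s > 0" for s by (simp_all add: B_def l_def add_pos_nonneg)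
  have f2_nonneg: "f2 s \<ge> 0" if "s > 0" for s
  proof (rule nonneg_if_decreasing_to_0[OF _ _ _ that])
    fix s :: real assume s: "s > 0"
    define S C where "S = sinh s" and "C = cosh s"
    have S: "S > 0" "C > 0" and CS: "C ^ 2 = 1 + S ^ 2" using s by (auto simp: S_def C_def cosh_sq)
    define L where "L = 32 + 280 * S ^ 2 + 490 * S ^ 4 + 245 * S ^ 6"
    have L: "L > 0" "l s = L" using l[of s] by (simp_all add: L_def l_def S_def)
    have gw: "g s = 16 + 28 * S ^ 2 + 168 * S ^ 4 + 147 * S ^ 6" "w s = 560 + 1428 * S ^ 2 + 882 * S ^ 4"
      by (simp_all add: g_def w_def S_def)
    define l' g' w' where "l' = (560 * S + 1960 * S ^ 3 + 1470 * S ^ 5) * C" and "g' = (56 * S + 672 * S ^ 3 + 882 * S ^ 5) * C"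
      and "w' = (2856 * S + 3528 * S ^ 3) * C"
    have l': "(l has_real_derivative l') (at s)" and g': "(g has_real_derivative g') (at s)" and w': "(w has_real_derivative w') (at s)"
      unfolding l_def[abs_def] g_def[abs_def] w_def[abs_def] S_def C_def l'_def g'_def w'_def
      by (auto intro!: derivative_eq_intros simp: algebra_simps)
    define cn dn where "cn = - (S * g s + C * g') * (3 * L) + C * g s * (3 * l')"
      and "dn = - (C * w s + S * w') * (3 * L) + S * w s * (3 * l')"
    have c: "((\<lambda>s. - (cosh s * g s) / (3 * l s)) has_real_derivative cn / (3 * l s) ^ 2) (at s)"
      using s L by (intro quotient_deriv) (auto intro!: derivative_eq_intros l' g' simp: S_def C_def cn_def algebra_simps)
    have d: "((\<lambda>s. - (sinh s * w s) / (3 * l s)) has_real_derivative dn / (3 * l s) ^ 2) (at s)"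
      using s L by (intro quotient_deriv) (auto intro!: derivative_eq_intros l' w' simp: S_def C_def dn_def algebra_simps)
    note Dv = combination_deriv[OF s DERIV_const DERIV_const c d, of 1 0]
    define m n where "m = 3072 + 35840 * S ^ 2 + 80640 * S ^ 4 + 50176 * S ^ 6" and "n = 21504 + 35840 * S ^ 2 + 12544 * S ^ 4"
    have e1: "cn / (3 * L) ^ 2 - 6 * (C / S) * (- (C * g s) / (3 * L)) - S * 1 = C ^ 2 * m / (3 * S * L ^ 2)"
    proof -
      have "cn * S + 18 * C ^ 2 * g s * L - 9 * S ^ 2 * L ^ 2 = 3 * (C ^ 2 * m)"
        unfolding cn_def gw L_def m_def l'_def g'_def using CS by algebra
      then have "(cn * S + 18 * C ^ 2 * g s * L - 9 * S ^ 2 * L ^ 2) / (9 * S * L ^ 2) = C ^ 2 * m / (3 * S * L ^ 2)"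
        using S L by (simp add: mult_ac)
      then show ?thesis
        using S L by (simp add: add_divide_distrib diff_divide_distrib power2_eq_square mult_ac)
    qed
    have e2: "dn / (3 * L) ^ 2 - 1 / C + - (C * g s) / (3 * L) / C ^ 2 = - (C * n) / (3 * L ^ 2)"
    proof -
      have "dn * C - 9 * L ^ 2 - 3 * g s * L = - 3 * (C ^ 2 * n)"
        unfolding dn_def gw L_def n_def l'_def w'_def using CS by algebra
      then have "(dn * C - 9 * L ^ 2 - 3 * g s * L) / (9 * C * L ^ 2) = - (C * n) / (3 * L ^ 2)"
        using S L by (simp add: power2_eq_square)
      then show ?thesis
        using S L by (simp add: add_divide_distrib diff_divide_distrib power2_eq_square mult_ac)
    qed
    show "(f2 has_real_derivative gam s * (C ^ 2 * m / (3 * S * L ^ 2)) + kap * (- (C * n) / (3 * L ^ 2))) (at s)"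
      unfolding f2_def[abs_def]
      by (rule DERIV_cong[OF Dv], simp only: S_def[symmetric] C_def[symmetric] L(2) mult_zero_right diff_zero div_0 e1 e2)
    show "gam s * (C ^ 2 * m / (3 * S * L ^ 2)) + kap * (- (C * n) / (3 * L ^ 2)) \<le> 0"
    proof -
      define q where "q = 4 * S ^ 2 + 5"
      have q: "q > 0" by (simp add: q_def add_nonneg_pos)
      \<comment> \<open>The coefficients of \<open>S ^ 6\<close> on the two sides are equal and the
        lower ones are smaller on the left. So a bound on \<open>gam\<close> that is worse by a
        constant factor at infinity would not do here.\<close>
      have m: "m \<le> n * q"
        unfolding m_def n_def q_def by (simp add: algebra_simps power_add[symmetric] flip: power2_eq_square)
      have "gam s * (C * q) \<le> kap * S"
        using gam_le'[OF s] by (simp add: S_def C_def q_def)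
      have "gam s * (C * m) \<le> gam s * (C * (n * q))"
        using m S gam_nonneg[OF s] by (intro mult_left_mono) auto
      also have "\<dots> = n * (gam s * (C * q))" by simp
      also have "\<dots> \<le> n * (kap * S)"
        using gam_le'[OF s] by (intro mult_left_mono) (auto simp: S_def C_def q_def n_def)
      finally have "(gam s * (C * m) - n * (kap * S)) * (C / (3 * S * L ^ 2)) \<le> 0"
        using S L by (intro mult_nonpos_nonneg) auto
      moreover have "(gam s * (C * m) - n * (kap * S)) * (C / (3 * S * L ^ 2))
          = gam s * (C ^ 2 * m / (3 * S * L ^ 2)) + kap * (- (C * n) / (3 * L ^ 2))"
        using S L by (simp add: field_simps power2_eq_square)
      ultimately show ?thesis by simp
    qed
  next
    have lims: "((\<lambda>s. - g s / (3 * l s)) \<longlongrightarrow> - 1 / 5) at_top" "((\<lambda>s. - (sinh s * w s) / (3 * l s)) \<longlongrightarrow> 0) at_top"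
      unfolding l_def g_def w_def sinh_def cosh_def by (simp?, real_asymp, (simp add: power_divide; fail)?)+
    have "((\<lambda>s. TT s + cosh s * gam s * (- g s / (3 * l s)) + kap * (- (sinh s * w s) / (3 * l s)))
        \<longlongrightarrow> 0 + 0 * (- 1 / 5) + kap * 0) at_top"
      by (intro tendsto_add tendsto_mult tendsto_const lims TT_tendsto_0 cosh_gam_tendsto_0)
    then show "(f2 \<longlongrightarrow> 0) at_top"
      by (simp add: f2_def[abs_def] mult_ac)
  qed
  have f_nonneg: "f t \<ge> 0"
  proof (rule nonneg_if_decreasing_to_0[OF _ _ _ assms])
    fix s :: real assume s: "s > 0"
    define S C where "S = sinh s" and "C = cosh s"
    have S: "S > 0" "C > 0" and CS: "C ^ 2 = 1 + S ^ 2" using s by (auto simp: S_def C_def cosh_sq)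
    define b L where "b = 11520 + 13440 * S ^ 2" and "L = 32 + 280 * S ^ 2 + 490 * S ^ 4 + 245 * S ^ 6"
    have L: "L > 0" "l s = L" "b > 0" "B s = b" using l[of s] B[of s] by (simp_all add: L_def l_def S_def b_def B_def)
    have ad: "A s = 1680 - 5460 * S ^ 2 - 8085 * S ^ 4" "D s = - 40 - 294 * S ^ 2 + 1617 * S ^ 4" "E s = 18856 + 23142 * S ^ 2"
      by (simp_all add: A_def D_def E_def S_def)
    have gw: "g s = 16 + 28 * S ^ 2 + 168 * S ^ 4 + 147 * S ^ 6" "w s = 560 + 1428 * S ^ 2 + 882 * S ^ 4"
      by (simp_all add: g_def w_def S_def)
    define A' D' where "A' = - (10920 * S + 32340 * S ^ 3) * C" and "D' = (- 588 * S + 6468 * S ^ 3) * C"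
    have A': "(A has_real_derivative A') (at s)" and B': "(B has_real_derivative 26880 * S * C) (at s)"
      and D': "(D has_real_derivative D') (at s)" and E': "(E has_real_derivative 46284 * S * C) (at s)"
      unfolding A_def[abs_def] B_def[abs_def] D_def[abs_def] E_def[abs_def] S_def C_def A'_def D'_def
      by (auto intro!: derivative_eq_intros simp: algebra_simps)
    have a: "((\<lambda>s. A s / (sinh s * cosh s * B s)) has_real_derivative (- 604800 * L) / (sinh s * cosh s * B s) ^ 2) (at s)"
    proof (rule quotient_deriv[OF A'])
      show "((\<lambda>s. sinh s * cosh s * B s) has_real_derivative (C ^ 2 + S ^ 2) * b + S * C * (26880 * S * C)) (at s)"
        using L by (auto intro!: derivative_eq_intros B' simp: S_def C_def power2_eq_square)
      show "A' * (sinh s * cosh s * B s) - A s * ((C ^ 2 + S ^ 2) * b + S * C * (26880 * S * C)) = - 604800 * L"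
        unfolding ad A'_def L(4) b_def S_def[symmetric] C_def[symmetric] L_def using CS by algebra
    qed (use s L in auto)
    define cn where "cn = D' * (S * b) - D s * (C * b + S * (26880 * S * C))"
    have c: "((\<lambda>s. D s / (sinh s * B s)) has_real_derivative cn / (sinh s * B s) ^ 2) (at s)"
    proof (rule quotient_deriv[OF D'])
      show "((\<lambda>s. sinh s * B s) has_real_derivative C * b + S * (26880 * S * C)) (at s)"
        using L by (auto intro!: derivative_eq_intros B' simp: S_def C_def)
      show "D' * (sinh s * B s) - D s * (C * b + S * (26880 * S * C)) = cn"
        unfolding cn_def L(4) S_def C_def ..
    qed (use s L in auto)
    define dn where "dn = 46284 * S * C * (C * b) - E s * (S * b + C * (26880 * S * C))"
    have d: "((\<lambda>s. E s / (cosh s * B s)) has_real_derivative dn / (cosh s * B s) ^ 2) (at s)"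
    proof (rule quotient_deriv[OF E'])
      show "((\<lambda>s. cosh s * B s) has_real_derivative S * b + C * (26880 * S * C)) (at s)"
        using L by (auto intro!: derivative_eq_intros B' simp: S_def C_def)
      show "46284 * S * C * (cosh s * B s) - E s * (S * b + C * (26880 * S * C)) = dn"
        unfolding dn_def L(4) S_def C_def ..
    qed (use s L in auto)
    note Dv = combination_deriv[OF s a DERIV_const c d, of "- 1"]
    have e1: "cn / (S * b) ^ 2 - 6 * (C / S) * (D s / (S * b)) - S * (A s / (S * C * b)) = 201600 * g s / (S ^ 2 * C * b ^ 2)"
    proof -
      have "cn * C - 6 * C ^ 2 * D s * b - A s * S ^ 2 * b = 201600 * g s"
        unfolding cn_def D'_def ad b_def gw using CS by algebra
      then have "(cn * C - 6 * C ^ 2 * D s * b - A s * S ^ 2 * b) / (S ^ 2 * C * b ^ 2) = 201600 * g s / (S ^ 2 * C * b ^ 2)"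
        by simp
      then show ?thesis
        using S L by (simp add: diff_divide_distrib power2_eq_square mult_ac)
    qed
    have e2: "dn / (C * b) ^ 2 - A s / (S * C * b) / C - - 1 / S + D s / (S * b) / C ^ 2 = 201600 * w s / (S * C ^ 2 * b ^ 2)"
    proof -
      have "dn * S - A s * b + C ^ 2 * b ^ 2 + D s * b = 201600 * w s"
        unfolding dn_def ad b_def gw using CS by algebra
      then have "(dn * S - A s * b + C ^ 2 * b ^ 2 + D s * b) / (S * C ^ 2 * b ^ 2) = 201600 * w s / (S * C ^ 2 * b ^ 2)"
        by simp
      then show ?thesis
        using S L by (simp add: diff_divide_distrib add_divide_distrib power2_eq_square mult_ac)
    qed
    have "(f has_real_derivative TT s * ((- 604800 * L) / (S * C * b) ^ 2) + kap * Lam s * 0 + gam s * (201600 * g s / (S ^ 2 * C * b ^ 2))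
        + kap * (201600 * w s / (S * C ^ 2 * b ^ 2))) (at s)"
      unfolding f_def[abs_def]
      by (rule DERIV_cong[OF Dv], simp only: S_def[symmetric] C_def[symmetric] L(4) mult_zero_right diff_zero div_0 e1 e2)
    moreover have "TT s * ((- 604800 * L) / (S * C * b) ^ 2) + kap * Lam s * 0 + gam s * (201600 * g s / (S ^ 2 * C * b ^ 2))
        + kap * (201600 * w s / (S * C ^ 2 * b ^ 2)) = - (604800 * L / (S * C * b) ^ 2) * f2 s"
      unfolding f2_def S_def[symmetric] C_def[symmetric] L(2)
      using S L by (simp add: field_simps power2_eq_square)
    ultimately show "(f has_real_derivative - (604800 * L / (S * C * b) ^ 2) * f2 s) (at s)" by simp
    show "- (604800 * L / (S * C * b) ^ 2) * f2 s \<le> 0"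
      using f2_nonneg[OF s] L by simp
  next
    have lims: "((\<lambda>s. A s / (sinh s * cosh s * B s)) \<longlongrightarrow> - 77 / 128) at_top"
      "((\<lambda>s. D s / (sinh s * cosh s * B s)) \<longlongrightarrow> 77 / 640) at_top"
      "((\<lambda>s. E s / (cosh s * B s)) \<longlongrightarrow> 0) at_top"
      unfolding A_def B_def D_def E_def sinh_def cosh_def by (simp?, real_asymp, (simp add: power_divide; fail)?)+
    have "((\<lambda>s. TT s * (A s / (sinh s * cosh s * B s)) + kap * Lam s * - 1 + cosh s * gam s * (D s / (sinh s * cosh s * B s)) + kap * (E s / (cosh s * B s)))
        \<longlongrightarrow> 0 * (- 77 / 128) + kap * 0 * - 1 + 0 * (77 / 640) + kap * 0) at_top"
      by (intro tendsto_add tendsto_mult tendsto_const lims Lam_tendsto_0 cosh_gam_tendsto_0 TT_tendsto_0)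
    then show "(f \<longlongrightarrow> 0) at_top"
      by (simp add: f_def[abs_def] mult_ac)
  qed
  define S C i k where "S = sinh t" and "C = cosh t" and "i = 1 / S" and "k = 1 / C"
  have S: "S > 0" "C > 0" using assms by (auto simp: S_def C_def)
  note cf = closed_forms[OF assms, folded C_def S_def, folded i_def k_def]
  note kk = kf_w0[OF assms, folded C_def S_def, folded i_def k_def]
  have "560 * (5 * vertex_v t - 12 * vertex_b t) = A t * TT t - kap * Lam t * (S * C * B t) + gam t * (C * D t) + kap * (S * E t)"
    unfolding vertex_v_def vertex_b_def A_def B_def D_def E_def TT_def S_def[symmetric] C_def[symmetric] kk
    using cf(1-7) by algebra
  also have "\<dots> = S * C * B t * f t"
    unfolding f_def S_def[symmetric] C_def[symmetric] using S B[of t] by (simp add: field_simps power2_eq_square)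
  also have "\<dots> \<ge> 0" using f_nonneg B[of t] S by (simp add: less_imp_le)
  finally show ?thesis by simp
qed

section \<open>Coordinates on the orthant\<close>

lemma vector_4 [simp]:
  "(vector [a, b, c, d] :: real ^ 4) $ 1 = a" "(vector [a, b, c, d] :: real ^ 4) $ 2 = b"
  "(vector [a, b, c, d] :: real ^ 4) $ 3 = c" "(vector [a, b, c, d] :: real ^ 4) $ 4 = d"
  unfolding vector_def by simp_all

lemma vector_5 [simp]:
  "(vector [a, b, c, d, e] :: real ^ 5) $ 1 = a" "(vector [a, b, c, d, e] :: real ^ 5) $ 2 = b"
  "(vector [a, b, c, d, e] :: real ^ 5) $ 3 = c" "(vector [a, b, c, d, e] :: real ^ 5) $ 4 = d"
  "(vector [a, b, c, d, e] :: real ^ 5) $ 5 = e"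
  unfolding vector_def by simp_all

lemma UNIV_5: "UNIV = {1, 2, 3, 4, 5 :: 5}"
proof -
  have "card {1, 2, 3, 4, 5 :: 5} = 5" by simp
  then show ?thesis by (intro card_eq_UNIV_imp_eq_UNIV[symmetric]) simp_all
qed

lemma forall_5: "(\<forall>i::5. P i) \<longleftrightarrow> P 1 \<and> P 2 \<and> P 3 \<and> P 4 \<and> P 5"
  by (metis UNIV_5 UNIV_I insertE singletonD)

text \<open>\<open>cr\<close>, \<open>cx\<close>, \<open>cy\<close>, \<open>cz\<close> are the arguments of \<open>VC\<close>; \<open>at'\<close>, \<open>aw\<close>, \<open>ax\<close>, \<open>ay\<close> those of \<open>VA\<close>; and
  \<open>at'\<close>, \<open>bw\<close>, \<open>ax\<close>, \<open>- ay\<close> those of \<open>VB\<close>.\<close>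

definition "cz q = sqrt 2 * (q $ 4 - q $ 2 - 2 * q $ 1) / 3" for q :: "real ^ 4"
definition "cy q = sqrt 2 * q $ 1 + cz q" for q :: "real ^ 4"
definition "cx q = sqrt 2 * (q $ 1 + q $ 2) + cz q" for q :: "real ^ 4"
definition "cr q = sqrt 2 * (q $ 1 + q $ 2 + q $ 3) + cz q" for q :: "real ^ 4"
definition "at' q = sqrt 2 * (q $ 3 + (q $ 2 + q $ 4) / 2)" for q :: "real ^ 4"
definition "aw q = sqrt 2 * (q $ 1 - (q $ 4 - q $ 2) / 2)" for q :: "real ^ 4"
definition "ax q = sqrt 2 * ((q $ 4 + q $ 2) / 2)" for q :: "real ^ 4"
definition "ay q = sqrt 2 * ((q $ 4 - q $ 2) / 2)" for q :: "real ^ 4"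
definition "bw q = sqrt 2 * q $ 1" for q :: "real ^ 4"

lemmas coord_defs = cz_def cy_def cx_def cr_def at'_def aw_def ax_def ay_def bw_def

lemma coord_line:
  "cz (q + t *\<^sub>R d) = cz q + t * cz d" "cy (q + t *\<^sub>R d) = cy q + t * cy d" "cx (q + t *\<^sub>R d) = cx q + t * cx d"
  "cr (q + t *\<^sub>R d) = cr q + t * cr d" "at' (q + t *\<^sub>R d) = at' q + t * at' d" "aw (q + t *\<^sub>R d) = aw q + t * aw d"
  "ax (q + t *\<^sub>R d) = ax q + t * ax d" "ay (q + t *\<^sub>R d) = ay q + t * ay d" "bw (q + t *\<^sub>R d) = bw q + t * bw d"
  by (simp_all add: coord_defs field_simps)

lemma coord_tendsto [tendsto_intros]:
  assumes "(f \<longlongrightarrow> q) F"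
  shows "((\<lambda>x. cz (f x)) \<longlongrightarrow> cz q) F" "((\<lambda>x. cy (f x)) \<longlongrightarrow> cy q) F" "((\<lambda>x. cx (f x)) \<longlongrightarrow> cx q) F"
    "((\<lambda>x. cr (f x)) \<longlongrightarrow> cr q) F" "((\<lambda>x. at' (f x)) \<longlongrightarrow> at' q) F" "((\<lambda>x. aw (f x)) \<longlongrightarrow> aw q) F"
    "((\<lambda>x. ax (f x)) \<longlongrightarrow> ax q) F" "((\<lambda>x. ay (f x)) \<longlongrightarrow> ay q) F" "((\<lambda>x. bw (f x)) \<longlongrightarrow> bw q) F"
  unfolding coord_defs by (intro tendsto_intros assms; simp)+

text \<open>This is the substitution behind \<open>hessian_match\<close>; being linear, it serves
  for points and for directions.\<close>

lemma coord_A_C: "at' q = cr q + cz q / 2" "aw q = - 3 / 2 * cz q" "ax q = cx q + cz q / 2" "ay q = cy q + cz q / 2"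
  by (simp_all add: coord_defs field_simps)

definition "VAq q = VA (at' q) (aw q) (ax q) (ay q)"
definition "VCq q = VC (cr q) (cx q) (cy q) (cz q)"
definition "VBq q = VB (at' q) (bw q) (ax q) (- ay q)"

lemma orthant_posD:
  assumes "q \<in> orthant_pos"
  shows "q $ 1 \<ge> 0" "q $ 2 \<ge> 0" "q $ 3 \<ge> 0" "q $ 4 \<ge> 0" "q $ 3 + q $ 2 > 0" "q $ 3 + q $ 4 > 0"
  using assms by (auto simp: orthant_pos_def orthant_def)

lemma v_formula_A:
  assumes "q \<in> orthant_pos" "q $ 4 \<ge> q $ 2" "2 * q $ 1 \<ge> q $ 4 - q $ 2"
  shows "v_formula q = VAq q"
proof -
  note o = orthant_posD[OF assms(1)]
  have "v_formula q = VA (sqrt 2 * q $ 3 + (sqrt 2 * q $ 2 + sqrt 2 * q $ 4) / 2) (sqrt 2 * q $ 1 - (sqrt 2 * q $ 4 - sqrt 2 * q $ 2) / 2)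
     ((sqrt 2 * q $ 4 + sqrt 2 * q $ 2) / 2) ((sqrt 2 * q $ 4 - sqrt 2 * q $ 2) / 2)"
  proof (subst formula_A[symmetric])
    show "sqrt 2 * q $ 4 - sqrt 2 * q $ 2 \<le> 2 * (sqrt 2 * q $ 1)"
      using mult_left_mono[OF assms(3), of "sqrt 2"] by (simp add: algebra_simps)
    show "0 < sqrt 2 * q $ 2 + sqrt 2 * q $ 3"
      using mult_pos_pos[of "sqrt 2" "q $ 3 + q $ 2"] o by (simp add: algebra_simps)
  qed (use o assms in \<open>simp_all add: v_formula_def Let_def algebra_simps\<close>)
  then show ?thesis
    by (simp add: VAq_def coord_defs algebra_simps)
qed

lemma v_formula_C:
  assumes "q \<in> orthant_pos" "2 * q $ 1 < q $ 4 - q $ 2"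
  shows "v_formula q = VCq q"
proof -
  note o = orthant_posD[OF assms(1)]
  define \<alpha> where "\<alpha> = (sqrt 2 * q $ 4 - sqrt 2 * q $ 2 - 2 * (sqrt 2 * q $ 1)) / 3"
  have \<alpha>: "\<alpha> = cz q" by (simp add: \<alpha>_def cz_def algebra_simps)
  have "v_formula q = VC (sqrt 2 * q $ 1 + sqrt 2 * q $ 2 + sqrt 2 * q $ 3 + \<alpha>) (sqrt 2 * q $ 1 + sqrt 2 * q $ 2 + \<alpha>)
     (sqrt 2 * q $ 1 + \<alpha>) \<alpha>"
    unfolding \<alpha>_def
  proof (subst formula_C[symmetric])
    show "2 * (sqrt 2 * q $ 1) < sqrt 2 * q $ 4 - sqrt 2 * q $ 2"
      using mult_strict_left_mono[OF assms(2), of "sqrt 2"] by (simp add: algebra_simps)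
    show "0 < sqrt 2 * q $ 2 + sqrt 2 * q $ 3"
      using mult_pos_pos[of "sqrt 2" "q $ 3 + q $ 2"] o by (simp add: algebra_simps)
  qed (use o assms in \<open>simp_all add: v_formula_def Let_def algebra_simps\<close>)
  then show ?thesis
    by (simp add: VCq_def \<alpha> cr_def cx_def cy_def algebra_simps)
qed

lemma v_formula_B:
  assumes "q \<in> orthant_pos" "q $ 4 < q $ 2"
  shows "v_formula q = VBq q"
proof -
  note o = orthant_posD[OF assms(1)]
  have "v_formula q = VB (sqrt 2 * q $ 3 + (sqrt 2 * q $ 2 + sqrt 2 * q $ 4) / 2) (sqrt 2 * q $ 1)
     ((sqrt 2 * q $ 2 + sqrt 2 * q $ 4) / 2) ((sqrt 2 * q $ 2 - sqrt 2 * q $ 4) / 2)"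
  proof (subst formula_B[symmetric])
    show "0 < sqrt 2 * q $ 3 + sqrt 2 * q $ 4"
      using mult_pos_pos[of "sqrt 2" "q $ 3 + q $ 4"] o by (simp add: algebra_simps)
  qed (use o assms in \<open>simp_all add: v_formula_def Let_def algebra_simps add_divide_distrib\<close>)
  moreover have "(sqrt 2 * q $ 2 - sqrt 2 * q $ 4) / 2 = - ay q" by (simp add: ay_def field_simps)
  ultimately show ?thesis
    by (simp add: VBq_def coord_defs algebra_simps)
qed

section \<open>The open chambers and the classical second derivatives\<close>

definition "RA = {q :: real ^ 4. (\<forall>i. 0 < q $ i) \<and> q $ 2 < q $ 4 \<and> q $ 4 - q $ 2 < 2 * q $ 1}"
definition "RB = {q :: real ^ 4. (\<forall>i. 0 < q $ i) \<and> q $ 4 < q $ 2}"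
definition "RC = {q :: real ^ 4. (\<forall>i. 0 < q $ i) \<and> 2 * q $ 1 < q $ 4 - q $ 2}"

lemma regular_points_eq: "regular_points = RA \<union> RB \<union> RC"
  by (auto simp: regular_points_def RA_def RB_def RC_def forall_4)

lemma open_R: "open RA" "open RB" "open RC"
proof -
  have 1: "open {q :: real ^ 4. 0 < q $ i}" for i
    by (intro open_Collect_less continuous_intros)
  have eq: "RA = {q. 0 < q $ 1} \<inter> {q. 0 < q $ 2} \<inter> {q. 0 < q $ 3} \<inter> {q. 0 < q $ 4} \<inter> {q. q $ 2 < q $ 4} \<inter> {q. q $ 4 - q $ 2 < 2 * q $ 1}"
    "RB = {q. 0 < q $ 1} \<inter> {q. 0 < q $ 2} \<inter> {q. 0 < q $ 3} \<inter> {q. 0 < q $ 4} \<inter> {q. q $ 4 < q $ 2}"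
    "RC = {q. 0 < q $ 1} \<inter> {q. 0 < q $ 2} \<inter> {q. 0 < q $ 3} \<inter> {q. 0 < q $ 4} \<inter> {q. 2 * q $ 1 < q $ 4 - q $ 2}"
    by (auto simp: RA_def RB_def RC_def forall_4)
  have 2: "open {q :: real ^ 4. q $ 2 < q $ 4}" "open {q :: real ^ 4. q $ 4 < q $ 2}"
    "open {q :: real ^ 4. q $ 4 - q $ 2 < 2 * q $ 1}" "open {q :: real ^ 4. 2 * q $ 1 < q $ 4 - q $ 2}"
    by (intro open_Collect_less continuous_intros)+
  show "open RA" "open RB" "open RC" unfolding eq by (intro open_Int 1 2)+
qed

lemma R_subset_orthant_pos: "RA \<subseteq> orthant_pos" "RB \<subseteq> orthant_pos" "RC \<subseteq> orthant_pos"
  by (auto simp: RA_def RB_def RC_def orthant_pos_def orthant_def forall_4)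

lemma v_on_R:
  "q \<in> RA \<Longrightarrow> v q = VAq q" "q \<in> RB \<Longrightarrow> v q = VBq q" "q \<in> RC \<Longrightarrow> v q = VCq q"
  using R_subset_orthant_pos v_formula_A[of q] v_formula_B[of q] v_formula_C[of q]
  by (auto simp: v_def RA_def RB_def RC_def subset_iff)

lemma coords_pos:
  "q \<in> RA \<Longrightarrow> at' q > 0" "q \<in> RB \<Longrightarrow> at' q > 0" "q \<in> RC \<Longrightarrow> cr q > 0"
  by (auto simp: RA_def RB_def RC_def forall_4 at'_def cr_def cz_def intro!: mult_pos_pos add_pos_pos)

text \<open>The outer \<open>deriv\<close> evaluates the inner one at nearby points of the line.
  Hence the first derivative is asked for wherever the line stays in \<open>R\<close>, the second
  only at \<open>q\<close>.\<close>

lemma second_dir_deriv_on_open: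
  fixes d :: "real ^ 4"
  assumes "open R" "q \<in> R" and eq: "\<And>p. p \<in> R \<Longrightarrow> f p = h p"
    and 1: "\<And>e. q + e *\<^sub>R d \<in> R \<Longrightarrow> ((\<lambda>e. h (q + e *\<^sub>R d)) has_real_derivative h1 e) (at e)"
    and 2: "(h1 has_real_derivative h2) (at 0)"
  shows "dir_deriv d (dir_deriv d f) q = h2"
proof -
  have "open ((\<lambda>e. q + e *\<^sub>R d) -` R)"
    by (intro open_vimage \<open>open R\<close> continuous_intros)
  then have ev: "\<forall>\<^sub>F e' in nhds e. q + e' *\<^sub>R d \<in> R" if "q + e *\<^sub>R d \<in> R" for e
    using that eventually_nhds_in_open[of "(\<lambda>e. q + e *\<^sub>R d) -` R" e] by simp
  have h1: "dir_deriv d f (q + e *\<^sub>R d) = h1 e" if "q + e *\<^sub>R d \<in> R" for e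
  proof -
    have "((\<lambda>e. f (q + e *\<^sub>R d)) has_real_derivative h1 e) (at e)"
      by (rule DERIV_cong_ev[THEN iffD2, OF refl _ refl 1[OF that]])
        (use ev[OF that] in \<open>auto elim!: eventually_mono simp: eq\<close>)
    then have "((\<lambda>t. f (q + (t + e) *\<^sub>R d)) has_real_derivative h1 e) (at 0)"
      using DERIV_shift[of "\<lambda>e. f (q + e *\<^sub>R d)" "h1 e" 0 e] by simp
    then have "((\<lambda>t. f (q + e *\<^sub>R d + t *\<^sub>R d)) has_real_derivative h1 e) (at 0)"
      by (simp add: algebra_simps)
    then show ?thesis unfolding dir_deriv_def by (rule DERIV_imp_deriv)
  qed
  have "((\<lambda>e. dir_deriv d f (q + e *\<^sub>R d)) has_real_derivative h2) (at 0)"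
    by (rule DERIV_cong_ev[THEN iffD2, OF refl _ refl 2])
      (use ev[of 0] \<open>q \<in> R\<close> h1 in \<open>auto elim!: eventually_mono\<close>)
  then show ?thesis
    unfolding dir_deriv_def[of d "dir_deriv d f"] by (rule DERIV_imp_deriv)
qed

fun be1 :: "nat \<Rightarrow> real \<Rightarrow> real" where
  "be1 (Suc (Suc 0)) t = - (2 / 3) * kap * exp (- 2 * t) + 2 * kap * (cosh t * Lam t - 1)"
| "be1 _ t = - (2 / 3) * kap * exp (- 2 * t)"

fun be2 :: "nat \<Rightarrow> real \<Rightarrow> real" where
  "be2 (Suc (Suc 0)) t = 4 / 3 * kap * exp (- 2 * t) + 2 * kap * (sinh t * Lam t - cosh t / sinh t)"
| "be2 _ t = 4 / 3 * kap * exp (- 2 * t)"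

lemma be_deriv: "t > 0 \<Longrightarrow> j \<le> 2 \<Longrightarrow> (be j has_real_derivative be1 j t) (at t)"
  "t > 0 \<Longrightarrow> j \<le> 2 \<Longrightarrow> (be1 j has_real_derivative be2 j t) (at t)"
proof -
  assume t: "t > 0" "j \<le> 2"
  then have c: "j = 0 \<or> j = Suc 0 \<or> j = Suc (Suc 0)" by auto
  show "(be j has_real_derivative be1 j t) (at t)"
    using t c by (auto simp: be.simps[abs_def] field_simps intro!: derivative_eq_intros Lam_deriv)
  show "(be1 j has_real_derivative be2 j t) (at t)"
    using t c by (auto simp: be1.simps[abs_def] field_simps intro!: derivative_eq_intros Lam_deriv)
qed

definition "KA t w = (\<lambda>j. kf j t w)(3 := 0)"
definition "KA1 dt dw t w = (kD1 dt dw t w)(3 := 0)"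
definition "KA2 dt dw t w = (kD2 dt dw t w)(3 := 0)"
text \<open>The guard is there because beyond index 2 the default clauses of \<open>be\<close>,
  \<open>be1\<close> and \<open>be2\<close> are not derivatives of each other.\<close>

definition "KB t w j = (if j \<le> 2 then kf j t w - be j t else 0)"
definition "KB1 dt dw t w j = (if j \<le> 2 then kD1 dt dw t w j - be1 j t * dt else 0)"
definition "KB2 dt dw t w j = (if j \<le> 2 then kD2 dt dw t w j - be2 j t * dt ^ 2 else 0)"

text \<open>Second derivatives of the three chamber formulas. They stay continuous on the boundary
  of a chamber as long as \<open>at'\<close> or \<open>cr\<close> is positive, and so furnish the
  extensions from \<open>regular_points\<close>.\<close>

definition "HA d q = Q2 (KA (at' q) (aw q)) (KA1 (at' d) (aw d) (at' q) (aw q)) (KA2 (at' d) (aw d) (at' q) (aw q))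
   (ax d) (ay d) 0 (cosh (ax q)) (sinh (ax q)) (cosh (ay q)) (sinh (ay q)) 1 0"
definition "HB d q = Q2 (KB (at' q) (bw q)) (KB1 (at' d) (bw d) (at' q) (bw q)) (KB2 (at' d) (bw d) (at' q) (bw q))
   (ax d) (- ay d) 0 (cosh (ax q)) (sinh (ax q)) (cosh (- ay q)) (sinh (- ay q)) 1 0
   + kap * ((ay d + ax d) ^ 2 * exp (- ay q - ax q) + (ax d - ay d - 2 * at' d) ^ 2 * exp (ax q - ay q - 2 * at' q) / 3)"
definition "HC d q = Q2 (\<lambda>j. kf j (cr q) 0) (kD1 (cr d) 0 (cr q) 0) (kD2 (cr d) 0 (cr q) 0)
   (cx d) (cy d) (cz d) (cosh (cx q)) (sinh (cx q)) (cosh (cy q)) (sinh (cy q)) (cosh (cz q)) (sinh (cz q))"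

lemma kD_curve:
  assumes "t + e * dt > 0"
  shows "((\<lambda>e. kf j (t + e * dt) (w + e * dw)) has_real_derivative kD1 dt dw (t + e * dt) (w + e * dw) j) (at e)"
    "((\<lambda>e. kD1 dt dw (t + e * dt) (w + e * dw) j) has_real_derivative kD2 dt dw (t + e * dt) (w + e * dw) j) (at e)"
proof -
  have l: "((\<lambda>e. t + e * dt) has_real_derivative dt) (at e)" "((\<lambda>e. w + e * dw) has_real_derivative dw) (at e)"
    by (auto intro!: derivative_eq_intros)
  note k = kf_deriv_curve[of "\<lambda>e. t + e * dt" e, OF assms l]
  show "((\<lambda>e. kf j (t + e * dt) (w + e * dw)) has_real_derivative kD1 dt dw (t + e * dt) (w + e * dw) j) (at e)"
    unfolding kD1_def by (rule k)
  show "((\<lambda>e. kD1 dt dw (t + e * dt) (w + e * dw) j) has_real_derivative kD2 dt dw (t + e * dt) (w + e * dw) j) (at e)"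
    unfolding kD1_def kD2_def
    by (rule DERIV_cong[OF DERIV_add[OF DERIV_cmult_right[OF k(2)] DERIV_cmult_right[OF k(3)]]])
      (simp add: algebra_simps power2_eq_square)
qed

lemma second_deriv_A:
  assumes "q \<in> RA" shows "dir_deriv d (dir_deriv d v) q = HA d q"
proof (rule second_dir_deriv_on_open[OF open_R(1) assms v_on_R(1)])
  define K where "K e = KA (at' q + e * at' d) (aw q + e * aw d)" for e
  define K1 where "K1 e = KA1 (at' d) (aw d) (at' q + e * at' d) (aw q + e * aw d)" for e
  define h1 where "h1 e = Q1 (K e) (K1 e) (ax d) (ay d) 0 (cosh (ax q + e * ax d)) (sinh (ax q + e * ax d))
    (cosh (ay q + e * ay d)) (sinh (ay q + e * ay d)) (cosh (0 + e * 0)) (sinh (0 + e * 0))" for e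
  have K: "((\<lambda>e. K e j) has_real_derivative K1 e j) (at e)"
    "((\<lambda>e. K1 e j) has_real_derivative KA2 (at' d) (aw d) (at' q + e * at' d) (aw q + e * aw d) j) (at e)"
    if "at' q + e * at' d > 0" for e j
    using kD_curve[OF that] by (simp_all add: K_def K1_def KA_def KA1_def KA2_def)
  show "((\<lambda>e. VAq (q + e *\<^sub>R d)) has_real_derivative h1 e) (at e)" if "q + e *\<^sub>R d \<in> RA" for e
  proof -
    have "at' q + e * at' d > 0" using coords_pos(1)[OF that] by (simp add: coord_line)
    from Q_line_deriv[of K K1 e "ax q" "ax d" "ay q" "ay d" 0 0, OF K(1)[OF this]]
    show ?thesis by (simp add: VAq_def VA_eq_Q coord_line h1_def K_def KA_def)
  qed
  have "at' q + 0 * at' d > 0" using coords_pos(1)[OF assms] by simp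
  from Q1_line_deriv[of K K1 0 _ "ax d" "ay d" 0 "ax q" "ay q" 0, OF K[OF this]]
  show "(h1 has_real_derivative HA d q) (at 0)"
    by (simp add: h1_def[abs_def] HA_def K_def K1_def)
qed

lemma second_deriv_C:
  assumes "q \<in> RC" shows "dir_deriv d (dir_deriv d v) q = HC d q"
proof (rule second_dir_deriv_on_open[OF open_R(3) assms v_on_R(3)])
  define K where "K e = (\<lambda>j. kf j (cr q + e * cr d) (0 + e * 0))" for e
  define K1 where "K1 e = kD1 (cr d) 0 (cr q + e * cr d) (0 + e * 0)" for e
  define h1 where "h1 e = Q1 (K e) (K1 e) (cx d) (cy d) (cz d) (cosh (cx q + e * cx d)) (sinh (cx q + e * cx d))
    (cosh (cy q + e * cy d)) (sinh (cy q + e * cy d)) (cosh (cz q + e * cz d)) (sinh (cz q + e * cz d))" for e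
  have K: "((\<lambda>e. K e j) has_real_derivative K1 e j) (at e)"
    "((\<lambda>e. K1 e j) has_real_derivative kD2 (cr d) 0 (cr q + e * cr d) (0 + e * 0) j) (at e)"
    if "cr q + e * cr d > 0" for e j
    unfolding K_def K1_def by (rule kD_curve[OF that])+
  show "((\<lambda>e. VCq (q + e *\<^sub>R d)) has_real_derivative h1 e) (at e)" if "q + e *\<^sub>R d \<in> RC" for e
  proof -
    have "cr q + e * cr d > 0" using coords_pos(3)[OF that] by (simp add: coord_line)
    from Q_line_deriv[of K K1 e "cx q" "cx d" "cy q" "cy d" "cz q" "cz d", OF K(1)[OF this]]
    show ?thesis by (simp add: VCq_def VC_eq_Q coord_line h1_def K_def)
  qed
  have "cr q + 0 * cr d > 0" using coords_pos(3)[OF assms] by simp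
  from Q1_line_deriv[of K K1 0 _ "cx d" "cy d" "cz d" "cx q" "cy q" "cz q", OF K[OF this]]
  show "(h1 has_real_derivative HC d q) (at 0)"
    by (simp add: h1_def[abs_def] HC_def K_def K1_def)
qed

lemma second_deriv_B:
  assumes "q \<in> RB" shows "dir_deriv d (dir_deriv d v) q = HB d q"
proof (rule second_dir_deriv_on_open[OF open_R(2) assms v_on_R(2)])
  define K where "K e = KB (at' q + e * at' d) (bw q + e * bw d)" for e
  define K1 where "K1 e = KB1 (at' d) (bw d) (at' q + e * at' d) (bw q + e * bw d)" for e
  define E where "E e = kap * (exp (- ay q - ax q + e * (- ay d - ax d)) + exp (ax q - ay q - 2 * at' q + e * (ax d - ay d - 2 * at' d)) / 3)" for e
  define E1 where "E1 e = kap * ((- ay d - ax d) * exp (- ay q - ax q + e * (- ay d - ax d))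
    + (ax d - ay d - 2 * at' d) * exp (ax q - ay q - 2 * at' q + e * (ax d - ay d - 2 * at' d)) / 3)" for e
  define h1 where "h1 e = Q1 (K e) (K1 e) (ax d) (- ay d) 0 (cosh (ax q + e * ax d)) (sinh (ax q + e * ax d))
    (cosh (- ay q + e * - ay d)) (sinh (- ay q + e * - ay d)) (cosh (0 + e * 0)) (sinh (0 + e * 0)) + E1 e" for e
  have be: "((\<lambda>e. be j (at' q + e * at' d)) has_real_derivative be1 j (at' q + e * at' d) * at' d) (at e)"
    "((\<lambda>e. be1 j (at' q + e * at' d) * at' d) has_real_derivative be2 j (at' q + e * at' d) * at' d ^ 2) (at e)"
    if "at' q + e * at' d > 0" "j \<le> 2" for e j
  proof -
    have l: "((\<lambda>e. at' q + e * at' d) has_real_derivative at' d) (at e)"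
      by (auto intro!: derivative_eq_intros)
    show "((\<lambda>e. be j (at' q + e * at' d)) has_real_derivative be1 j (at' q + e * at' d) * at' d) (at e)"
      by (rule DERIV_chain2[OF be_deriv(1)[OF that] l])
    show "((\<lambda>e. be1 j (at' q + e * at' d) * at' d) has_real_derivative be2 j (at' q + e * at' d) * at' d ^ 2) (at e)"
      by (rule DERIV_cong[OF DERIV_cmult_right[OF DERIV_chain2[OF be_deriv(2)[OF that] l]]]) (simp add: power2_eq_square)
  qed
  have K: "((\<lambda>e. K e j) has_real_derivative K1 e j) (at e)"
    "((\<lambda>e. K1 e j) has_real_derivative KB2 (at' d) (bw d) (at' q + e * at' d) (bw q + e * bw d) j) (at e)"
    if "at' q + e * at' d > 0" for e j
    using kD_curve[OF that] be[OF that]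
    by (auto simp: K_def K1_def KB_def[abs_def] KB1_def[abs_def] KB2_def intro!: DERIV_diff)
  have E: "(E has_real_derivative E1 e) (at e)" for e
    unfolding E_def[abs_def] E1_def by (auto intro!: derivative_eq_intros)
  have E1: "(E1 has_real_derivative kap * ((ay d + ax d) ^ 2 * exp (- ay q - ax q)
      + (ax d - ay d - 2 * at' d) ^ 2 * exp (ax q - ay q - 2 * at' q) / 3)) (at 0)"
    unfolding E1_def[abs_def] by (auto intro!: derivative_eq_intros simp: power2_eq_square field_simps)
  show "((\<lambda>e. VBq (q + e *\<^sub>R d)) has_real_derivative h1 e) (at e)" if "q + e *\<^sub>R d \<in> RB" for e
  proof -
    have "at' q + e * at' d > 0" using coords_pos(2)[OF that] by (simp add: coord_line)
    from DERIV_add[OF Q_line_deriv[of K K1 e "ax q" "ax d" "- ay q" "- ay d" 0 0, OF K(1)[OF this]] E]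
    have "((\<lambda>e. Q (K e) (cosh (ax q + e * ax d)) (sinh (ax q + e * ax d)) (cosh (- ay q + e * - ay d)) (sinh (- ay q + e * - ay d))
        (cosh (0 + e * 0)) (sinh (0 + e * 0)) + E e) has_real_derivative h1 e) (at e)"
      unfolding h1_def .
    moreover have "VBq (q + e *\<^sub>R d) = Q (K e) (cosh (ax q + e * ax d)) (sinh (ax q + e * ax d)) (cosh (- ay q + e * - ay d)) (sinh (- ay q + e * - ay d))
        (cosh (0 + e * 0)) (sinh (0 + e * 0)) + E e" for e
    proof -
      have "- (ay q + e * ay d) = - ay q + e * - ay d" by simp
      then show ?thesis
        unfolding VBq_def VB_def VV2_def coord_line Q_def K_def KB_def E_def
        by (simp add: algebra_simps)
    qed
    ultimately show ?thesis by simp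
  qed
  have "at' q + 0 * at' d > 0" using coords_pos(2)[OF assms] by simp
  from DERIV_add[OF Q1_line_deriv[of K K1 0 _ "ax d" "- ay d" 0 "ax q" "- ay q" 0, OF K[OF this]] E1]
  show "(h1 has_real_derivative HB d q) (at 0)"
    by (simp add: h1_def[abs_def] HB_def K_def K1_def)
qed

section \<open>Interpolation from the vertices\<close>

lemma tendsto_k:
  assumes "(t \<longlongrightarrow> t0) F" "(w \<longlongrightarrow> w0) F" "t0 > 0"
  shows "((\<lambda>x. kf j (t x) (w x)) \<longlongrightarrow> kf j t0 w0) F"
    "((\<lambda>x. kD1 dt dw (t x) (w x) j) \<longlongrightarrow> kD1 dt dw t0 w0 j) F"
    "((\<lambda>x. kD2 dt dw (t x) (w x) j) \<longlongrightarrow> kD2 dt dw t0 w0 j) F"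
proof -
  note l = assms(1,2)
  have I: "((\<lambda>x. Iint j (t x) (w x)) \<longlongrightarrow> Iint j t0 w0) F" "((\<lambda>x. Jint j (t x) (w x)) \<longlongrightarrow> Jint j t0 w0) F" for j
    unfolding Iint_def Jint_def by (intro tendsto_intros l assms(3))+
  have "((\<lambda>x. cth (t x)) \<longlongrightarrow> cth t0) F" "((\<lambda>x. gam (t x)) \<longlongrightarrow> gam t0) F"
    using isCont_tendsto_compose[OF DERIV_isCont[OF cth_deriv[OF assms(3)]] l(1)]
      isCont_tendsto_compose[OF DERIV_isCont[OF gam_deriv[OF assms(3)]] l(1)] by simp_all
  then have F: "((\<lambda>x. Fk j (t x) (w x)) \<longlongrightarrow> Fk j t0 w0) F"
    unfolding Fk_def by (intro tendsto_intros l)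
  have a: "((\<lambda>x. aco j (t x)) \<longlongrightarrow> aco j t0) F" "((\<lambda>x. aco' j (t x)) \<longlongrightarrow> aco' j t0) F"
    using isCont_tendsto_compose[OF DERIV_isCont[OF aco_deriv[OF assms(3)]] l(1)]
      isCont_tendsto_compose[OF DERIV_isCont[OF aco'_deriv[OF assms(3)]] l(1)] by simp_all
  have "((\<lambda>x. theta (t x)) \<longlongrightarrow> theta t0) F" "((\<lambda>x. Lam (t x)) \<longlongrightarrow> Lam t0) F"
    using isCont_tendsto_compose[OF DERIV_isCont[OF theta_deriv] l(1)]
      isCont_tendsto_compose[OF DERIV_isCont[OF Lam_deriv[OF assms(3)]] l(1)] by simp_all
  then have a2: "((\<lambda>x. aco'' j (t x)) \<longlongrightarrow> aco'' j t0) F"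
    using assms(3) by (cases "(j, t0)" rule: aco.cases) (auto intro!: tendsto_intros l)
  show "((\<lambda>x. kf j (t x) (w x)) \<longlongrightarrow> kf j t0 w0) F"
    "((\<lambda>x. kD1 dt dw (t x) (w x) j) \<longlongrightarrow> kD1 dt dw t0 w0 j) F"
    "((\<lambda>x. kD2 dt dw (t x) (w x) j) \<longlongrightarrow> kD2 dt dw t0 w0 j) F"
    unfolding kf_def kD1_def kD2_def kt_def ktt_def kw_def ktw_def kww_def
    by (intro tendsto_intros I F a a2)+
qed

lemma tendsto_be:
  assumes "(t \<longlongrightarrow> t0) F" "t0 > 0" "j \<le> 2"
  shows "((\<lambda>x. be j (t x)) \<longlongrightarrow> be j t0) F" "((\<lambda>x. be1 j (t x)) \<longlongrightarrow> be1 j t0) F" "((\<lambda>x. be2 j (t x)) \<longlongrightarrow> be2 j t0) F"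
proof -
  show "((\<lambda>x. be j (t x)) \<longlongrightarrow> be j t0) F" "((\<lambda>x. be1 j (t x)) \<longlongrightarrow> be1 j t0) F"
    using isCont_tendsto_compose[OF DERIV_isCont[OF be_deriv(1)[OF assms(2,3)]] assms(1)]
      isCont_tendsto_compose[OF DERIV_isCont[OF be_deriv(2)[OF assms(2,3)]] assms(1)] by simp_all
  have "j = 0 \<or> j = Suc 0 \<or> j = Suc (Suc 0)" using assms(3) by auto
  moreover have "((\<lambda>x. Lam (t x)) \<longlongrightarrow> Lam t0) F"
    using isCont_tendsto_compose[OF DERIV_isCont[OF Lam_deriv[OF assms(2)]] assms(1)] by simp
  ultimately show "((\<lambda>x. be2 j (t x)) \<longlongrightarrow> be2 j t0) F"
    using assms(2) by (auto intro!: tendsto_intros assms(1))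
qed

lemma tendsto_Q:
  assumes "\<And>j. ((\<lambda>x. K x j) \<longlongrightarrow> K0 j) F"
    and "(a \<longlongrightarrow> aL) F" "(b \<longlongrightarrow> bL) F" "(c \<longlongrightarrow> cL) F" "(d \<longlongrightarrow> dL) F" "(e \<longlongrightarrow> eL) F" "(f \<longlongrightarrow> fL) F"
  shows "((\<lambda>x. Q (K x) (a x) (b x) (c x) (d x) (e x) (f x)) \<longlongrightarrow> Q K0 aL bL cL dL eL fL) F"
  unfolding Q_def by (intro tendsto_intros assms)

lemma tendsto_Q2:
  assumes "\<And>j. ((\<lambda>x. K x j) \<longlongrightarrow> K0 j) F" "\<And>j. ((\<lambda>x. K1 x j) \<longlongrightarrow> K10 j) F" "\<And>j. ((\<lambda>x. K2 x j) \<longlongrightarrow> K20 j) F"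
    and "(a \<longlongrightarrow> aL) F" "(b \<longlongrightarrow> bL) F" "(c \<longlongrightarrow> cL) F" "(d \<longlongrightarrow> dL) F" "(e \<longlongrightarrow> eL) F" "(f \<longlongrightarrow> fL) F"
  shows "((\<lambda>x. Q2 (K x) (K1 x) (K2 x) dx dy dz (a x) (b x) (c x) (d x) (e x) (f x))
    \<longlongrightarrow> Q2 K0 K10 K20 dx dy dz aL bL cL dL eL fL) F"
  unfolding Q2_def by (intro tendsto_intros tendsto_Q assms)

lemma VAq_eq_Q: "VAq q = Q (KA (at' q) (aw q)) (cosh (ax q)) (sinh (ax q)) (cosh (ay q)) (sinh (ay q)) 1 0"
  unfolding VAq_def VA_eq_Q KA_def ..

lemma VCq_eq_Q: "VCq q = Q (\<lambda>j. kf j (cr q) 0) (cosh (cx q)) (sinh (cx q)) (cosh (cy q)) (sinh (cy q)) (cosh (cz q)) (sinh (cz q))"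
  unfolding VCq_def VC_eq_Q ..

lemma VBq_eq_Q: "VBq q = Q (KB (at' q) (bw q)) (cosh (ax q)) (sinh (ax q)) (cosh (- ay q)) (sinh (- ay q)) 1 0
   + kap * (exp (- ay q - ax q) + exp (ax q - ay q - 2 * at' q) / 3)"
  unfolding VBq_def VB_def VV2_def Q_def KB_def by (simp add: algebra_simps)

lemma tendsto_KA:
  assumes "(t \<longlongrightarrow> t0) F" "(w \<longlongrightarrow> w0) F" "t0 > 0"
  shows "((\<lambda>x. KA (t x) (w x) j) \<longlongrightarrow> KA t0 w0 j) F" "((\<lambda>x. KA1 dt dw (t x) (w x) j) \<longlongrightarrow> KA1 dt dw t0 w0 j) F"
    "((\<lambda>x. KA2 dt dw (t x) (w x) j) \<longlongrightarrow> KA2 dt dw t0 w0 j) F"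
  using tendsto_k[OF assms] by (simp_all add: KA_def KA1_def KA2_def)

lemma tendsto_KB:
  assumes "(t \<longlongrightarrow> t0) F" "(w \<longlongrightarrow> w0) F" "t0 > 0"
  shows "((\<lambda>x. KB (t x) (w x) j) \<longlongrightarrow> KB t0 w0 j) F" "((\<lambda>x. KB1 dt dw (t x) (w x) j) \<longlongrightarrow> KB1 dt dw t0 w0 j) F"
    "((\<lambda>x. KB2 dt dw (t x) (w x) j) \<longlongrightarrow> KB2 dt dw t0 w0 j) F"
  using tendsto_k[OF assms] tendsto_be[OF assms(1,3)]
  by (auto simp: KB_def KB1_def KB2_def intro!: tendsto_intros)

lemma tendsto_chambers:
  assumes f: "(f \<longlongrightarrow> q) F"
  shows "at' q > 0 \<Longrightarrow> ((\<lambda>x. VAq (f x)) \<longlongrightarrow> VAq q) F" "at' q > 0 \<Longrightarrow> ((\<lambda>x. HA d (f x)) \<longlongrightarrow> HA d q) F"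
    "at' q > 0 \<Longrightarrow> ((\<lambda>x. VBq (f x)) \<longlongrightarrow> VBq q) F" "at' q > 0 \<Longrightarrow> ((\<lambda>x. HB d (f x)) \<longlongrightarrow> HB d q) F"
    "cr q > 0 \<Longrightarrow> ((\<lambda>x. VCq (f x)) \<longlongrightarrow> VCq q) F" "cr q > 0 \<Longrightarrow> ((\<lambda>x. HC d (f x)) \<longlongrightarrow> HC d q) F"
  unfolding VAq_eq_Q VBq_eq_Q VCq_eq_Q HA_def HB_def HC_def
  by (intro tendsto_Q tendsto_Q2 tendsto_KA tendsto_KB tendsto_k tendsto_intros f; simp)+

section \<open>Evaluating \<open>v\<close> and its second derivatives on the closed region\<close>

lemma region_C_D:
  assumes "q \<in> region_C"
  shows "q $ 1 \<ge> 0" "q $ 2 \<ge> 0" "q $ 3 \<ge> 0" "q $ 4 \<ge> 0" "q $ 2 \<le> q $ 4" "2 * q $ 1 \<le> q $ 4 - q $ 2"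
  using assms by (auto simp: region_C_def orthant_def)

text \<open>\<open>Lim\<close> determines a value only along a nontrivial filter. Adding
  \<open>e\<close> times \<open>(1, 1, 1, 5)\<close> makes all coordinates positive and raises
  \<open>q $ 4 - q $ 2 - 2 * q $ 1\<close> by \<open>2 * e\<close>, so the open chamber is reached
  from every point of the region.\<close>

lemma islimpt_RC:
  assumes "q \<in> region_C" shows "q islimpt RC"
  unfolding islimpt_sequential
proof (intro exI[of _ "\<lambda>n. q + (1 / Suc n) *\<^sub>R vector [1, 1, 1, 5]"] conjI allI)
  fix n
  define e where "e = 1 / real (Suc n)"
  have e: "e > 0" by (simp add: e_def)
  have c: "(q + e *\<^sub>R vector [1, 1, 1, 5]) $ 1 = q $ 1 + e" "(q + e *\<^sub>R vector [1, 1, 1, 5]) $ 2 = q $ 2 + e"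
    "(q + e *\<^sub>R vector [1, 1, 1, 5]) $ 3 = q $ 3 + e" "(q + e *\<^sub>R vector [1, 1, 1, 5]) $ 4 = q $ 4 + e * 5"
    by simp_all
  have "q + e *\<^sub>R vector [1, 1, 1, 5] \<in> RC"
    unfolding RC_def mem_Collect_eq forall_4 c using region_C_D[OF assms] e by auto
  moreover have "q + e *\<^sub>R vector [1, 1, 1, 5] \<noteq> q"
  proof
    assume "q + e *\<^sub>R vector [1, 1, 1, 5] = q"
    then have "(q + e *\<^sub>R vector [1, 1, 1, 5]) $ 1 = q $ 1" by (rule arg_cong)
    then show False using c(1) e by linarith
  qed
  ultimately show "q + (1 / Suc n) *\<^sub>R vector [1, 1, 1, 5] \<in> RC - {q}"
    by (simp add: e_def)
next
  have "(\<lambda>n. q + (1 / Suc n) *\<^sub>R vector [1, 1, 1, 5]) \<longlonglongrightarrow> q + 0 *\<^sub>R vector [1, 1, 1, 5]"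
    by (intro tendsto_intros LIMSEQ_inverse_real_of_nat[unfolded inverse_eq_divide])
  then show "(\<lambda>n. q + (1 / Suc n) *\<^sub>R vector [1, 1, 1, 5]) \<longlonglongrightarrow> q" by simp
qed

lemma nontrivial_limits:
  assumes "q \<in> region_C"
  shows "at q within regular_points \<noteq> bot" "at q within orthant_pos \<noteq> bot"
  using islimpt_subset[OF islimpt_RC[OF assms]] R_subset_orthant_pos(3)
  by (auto simp: trivial_limit_within regular_points_eq)

lemma v_eqI:
  assumes "q \<in> region_C" "(v_formula \<longlongrightarrow> L) (at q within orthant_pos)"
    and "q \<in> orthant_pos \<Longrightarrow> v_formula q = L"
  shows "v q = L"
  using assms(3) tendsto_Lim[OF nontrivial_limits(2)[OF assms(1)] assms(2)] by (simp add: v_def)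

lemma second_dir_deriv_eqI:
  assumes "q \<in> region_C" "(dir_deriv d (dir_deriv d v) \<longlongrightarrow> L) (at q within regular_points)"
    and "q \<in> regular_points \<Longrightarrow> dir_deriv d (dir_deriv d v) q = L"
  shows "second_dir_deriv d v q = L"
  using assms(3) tendsto_Lim[OF nontrivial_limits(1)[OF assms(1)] assms(2)] by (simp add: second_dir_deriv_def)

lemma eventually_at_within_open_cond:
  assumes "open T" "q \<in> T" shows "\<forall>\<^sub>F p in at q within S. p \<in> S \<and> p \<in> T"
  using eventually_nhds_in_open[OF assms] by (auto simp: eventually_at_filter elim: eventually_mono)

text \<open>Off the interface \<open>cz q > 0\<close>, and therefore \<open>cr q > 0\<close> even
  where \<open>q $ 2 = q $ 3 = 0\<close> and \<open>v_formula\<close> divides by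
  \<open>sinh 0\<close>. There \<open>VCq\<close> and \<open>HC\<close> provide the continuous
  extensions.\<close>

lemma off_interface:
  assumes q: "q \<in> region_C" and less: "2 * q $ 1 < q $ 4 - q $ 2"
  shows "v q = VCq q" "second_dir_deriv d v q = HC d q" "cr q > 0"
proof -
  note o = region_C_D[OF q]
  have "cz q > 0" using less by (simp add: cz_def)
  moreover have "sqrt 2 * (q $ 1 + q $ 2 + q $ 3) \<ge> 0" using o by simp
  ultimately show r: "cr q > 0" by (simp add: cr_def)
  define T where "T = {q :: real ^ 4. 2 * q $ 1 < q $ 4 - q $ 2}"
  have T: "open T" "q \<in> T" unfolding T_def using less by (auto intro!: open_Collect_less continuous_intros)
  show "v q = VCq q"
  proof (rule v_eqI[OF q])
    show "(v_formula \<longlongrightarrow> VCq q) (at q within orthant_pos)"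
      by (rule Lim_transform_eventually[OF tendsto_chambers(5)[OF tendsto_ident_at r]])
        (rule eventually_mono[OF eventually_at_within_open_cond[OF T]], auto simp: T_def v_formula_C)
  qed (rule v_formula_C[OF _ less])
  have RC: "p \<in> RC" if "p \<in> regular_points" "p \<in> T" for p
    using that by (auto simp: regular_points_def T_def RC_def)
  show "second_dir_deriv d v q = HC d q"
  proof (rule second_dir_deriv_eqI[OF q])
    show "(dir_deriv d (dir_deriv d v) \<longlongrightarrow> HC d q) (at q within regular_points)"
      by (rule Lim_transform_eventually[OF tendsto_chambers(6)[OF tendsto_ident_at r]])
        (rule eventually_mono[OF eventually_at_within_open_cond[OF T]], auto simp: second_deriv_C dest: RC)
  qed (use T RC in \<open>auto simp: second_deriv_C\<close>)
qed

lemma Q2_scale: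
  assumes "\<And>j. K1' j = s * K1 j" "\<And>j. K2' j = s ^ 2 * K2 j"
  shows "Q2 K K1' K2' (s * dx) (s * dy) (s * dz) a b c d e f = s ^ 2 * Q2 K K1 K2 dx dy dz a b c d e f"
  unfolding Q2_def Q_def assms by algebra

text \<open>The residual for the control \<open>(a, b, c, d, f)\<close>, see \<open>residual_eq_U\<close>.\<close>

definition "U a b c d f r x y z = uC (d + (f - d - c - b - a) / 3) (c + (f - d - c - b - a) / 3)
   (b + (f - d - c - b - a) / 3) (a + (f - d - c - b - a) / 3) r x y z"

text \<open>In the coordinates of \<open>VC\<close> a control direction consists of the first four
  control entries in reverse order plus a common shift \<open>k\<close>, which is symmetric in them.
  Hence permuting \<open>x\<close>, \<open>y\<close>, \<open>z\<close> only permutes the first three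
  entries.\<close>

lemma coord_dvec:
  fixes w :: "real ^ 5"
  defines "k \<equiv> (w $ 5 - w $ 4 - w $ 3 - w $ 2 - w $ 1) / 3"
  shows "cr (dvec w) = sqrt 2 * (w $ 4 + k)" "cx (dvec w) = sqrt 2 * (w $ 3 + k)"
    "cy (dvec w) = sqrt 2 * (w $ 2 + k)" "cz (dvec w) = sqrt 2 * (w $ 1 + k)"
  by (simp_all add: k_def dvec_def coord_defs field_simps)

lemma residual_eq_U: "VCq q - 1 / 2 * HC (dvec w) q = U (w $ 1) (w $ 2) (w $ 3) (w $ 4) (w $ 5) (cr q) (cx q) (cy q) (cz q)"
proof -
  define k where "k = (w $ 5 - w $ 4 - w $ 3 - w $ 2 - w $ 1) / 3"
  have "HC (dvec w) q = (sqrt 2) ^ 2 * Q2 (\<lambda>j. kf j (cr q) 0) (kD1 (w $ 4 + k) 0 (cr q) 0) (kD2 (w $ 4 + k) 0 (cr q) 0)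
     (w $ 3 + k) (w $ 2 + k) (w $ 1 + k) (cosh (cx q)) (sinh (cx q)) (cosh (cy q)) (sinh (cy q)) (cosh (cz q)) (sinh (cz q))"
    unfolding HC_def coord_dvec k_def[symmetric]
    by (rule Q2_scale) (simp_all add: kD1_def kD2_def power_mult_distrib)
  then show ?thesis
    by (simp add: U_def uC_def uQ_def VCq_eq_Q k_def)
qed

lemma U_swap12: "U a b c d f r x y z = U a c b d f r y x z"
proof -
  have "f - d - c - b - a = f - d - b - c - a" by simp
  then show ?thesis unfolding U_def by (simp only: uC_swap12[of _ "c + _"])
qed

lemma U_swap23: "U a b c d f r x y z = U b a c d f r x z y"
proof -
  have "f - d - c - b - a = f - d - c - a - b" by simp
  then show ?thesis unfolding U_def by (simp only: uC_swap23[of _ _ "b + _"])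
qed

text \<open>With \<open>V\<close> and \<open>\<beta>\<close> the values of \<open>vertex_v\<close>
  and \<open>vertex_b\<close>, the 32 controls produce only five numbers: \<open>V\<close>,
  \<open>2 / 9 * V + 2 / 3 * \<beta>\<close>, \<open>2 / 3 * \<beta> - V / 9\<close>,
  \<open>0\<close> and \<open>5 / 9 * V - 4 / 3 * \<beta>\<close>. The third and the fifth are the
  two vertex inequalities, and together these force \<open>V\<close> and \<open>\<beta>\<close> to
  be nonnegative.\<close>

lemma U_vertex:
  assumes "r > 0" and "a \<in> {0, 1}" "b \<in> {0, 1}" "c \<in> {0, 1}" "d \<in> {0, 1}" "f \<in> {0, 1}"
  shows "U a b c d f r r r r \<ge> 0"
proof -
  have u: "U a b c d f r r r r = vertex_v r * (1 - (d + (f - d - c - b - a) / 3) ^ 2 - (c + (f - d - c - b - a) / 3) ^ 2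
     - (b + (f - d - c - b - a) / 3) ^ 2 - (a + (f - d - c - b - a) / 3) ^ 2)
    - 2 * vertex_b r * ((d + (f - d - c - b - a) / 3) * (c + (f - d - c - b - a) / 3)
       + (d + (f - d - c - b - a) / 3) * (b + (f - d - c - b - a) / 3) + (d + (f - d - c - b - a) / 3) * (a + (f - d - c - b - a) / 3)
       + (c + (f - d - c - b - a) / 3) * (b + (f - d - c - b - a) / 3) + (c + (f - d - c - b - a) / 3) * (a + (f - d - c - b - a) / 3)
       + (b + (f - d - c - b - a) / 3) * (a + (f - d - c - b - a) / 3))"
    unfolding U_def uC_vertex[OF assms(1)] vertex_v_def vertex_b_def ..
  have bounds: "vertex_v r \<le> 6 * vertex_b r" "12 * vertex_b r \<le> 5 * vertex_v r"
    using vertex_lower vertex_upper assms(1) by auto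
  show ?thesis
    unfolding u using assms(2-) bounds
    by (elim insertE emptyE) (simp_all add: power2_eq_square field_simps)
qed

lemma U_interpolate:
  assumes "r > 0" "0 \<le> x" "x \<le> r" "U a b c d f r 0 y z \<ge> 0" "U a b c d f r r y z \<ge> 0"
  shows "U a b c d f r x y z \<ge> 0"
  using uC_interpolate assms unfolding U_def by blast

text \<open>The cube is filled one coordinate at a time, starting at the vertex
  \<open>(r, r, r)\<close>. Since bringing a face into the form \<open>z = 0\<close>,
  \<open>y \<le> x\<close> permutes the control too, \<open>face\<close> has to hold for all
  controls at once.\<close>

lemma U_nonneg:
  assumes "r > 0" and xyz: "0 \<le> x" "x \<le> r" "0 \<le> y" "y \<le> r" "0 \<le> z" "z \<le> r"
    and face: "\<And>a b c d f x y. a \<in> {0, 1} \<Longrightarrow> b \<in> {0, 1} \<Longrightarrow> c \<in> {0, 1} \<Longrightarrow> d \<in> {0, 1} \<Longrightarrow> f \<in> {0, 1} \<Longrightarrow>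
       0 \<le> y \<Longrightarrow> y \<le> x \<Longrightarrow> x \<le> r \<Longrightarrow> U a b c d f r x y 0 \<ge> 0"
    and abc: "a \<in> {0, 1}" "b \<in> {0, 1}" "c \<in> {0, 1}" "d \<in> {0, 1}" "f \<in> {0, 1}"
  shows "U a b c d f r x y z \<ge> 0"
proof -
  have 1: "U a b c d f r x y 0 \<ge> 0"
    if "0 \<le> x" "x \<le> r" "0 \<le> y" "y \<le> r" "a \<in> {0, 1}" "b \<in> {0, 1}" "c \<in> {0, 1}" "d \<in> {0, 1}" "f \<in> {0, 1}" for a b c d f x y
    using face[of a b c d f y x] face[of a c b d f x y] U_swap12[of a b c d f r x y 0] that by (cases "y \<le> x") auto
  have 2: "U a b c d f r x 0 z \<ge> 0"
    if "0 \<le> x" "x \<le> r" "0 \<le> z" "z \<le> r" "a \<in> {0, 1}" "b \<in> {0, 1}" "c \<in> {0, 1}" "d \<in> {0, 1}" "f \<in> {0, 1}" for a b c d f x z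
    using 1[of x z b a c d f] U_swap23[of a b c d f r x 0 z] that by auto
  have 3: "U a b c d f r 0 y z \<ge> 0"
    if "0 \<le> y" "y \<le> r" "0 \<le> z" "z \<le> r" "a \<in> {0, 1}" "b \<in> {0, 1}" "c \<in> {0, 1}" "d \<in> {0, 1}" "f \<in> {0, 1}" for a b c d f y z
    using 2[of y z a c b d f] U_swap12[of a b c d f r 0 y z] that by auto
  have rrz: "U a b c d f r r r z \<ge> 0"
  proof -
    have "U b c a d f r z r r \<ge> 0"
      using U_interpolate[OF assms(1) xyz(5,6)] 3[of r r b c a d f] U_vertex[OF assms(1), of b c a d f] assms(1) abc by auto
    then show ?thesis
      using U_swap23[of a b c d f r r r z] U_swap12[of b a c d f r r z r] U_swap23[of b c a d f r z r r] by simp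
  qed
  have ryz: "U a b c d f r r y z \<ge> 0"
  proof -
    have "U a c b d f r y r z \<ge> 0"
      using U_interpolate[OF assms(1) xyz(3,4)] 3[of r z a c b d f] rrz U_swap12[of a b c d f r r r z] xyz assms(1) abc by auto
    then show ?thesis using U_swap12[of a b c d f r r y z] by simp
  qed
  show ?thesis
    using U_interpolate[OF assms(1) xyz(1,2)] 3 ryz xyz abc by auto
qed

section \<open>Transfer of the hypothesis to the face \<open>z = 0\<close>\<close>

text \<open>Inverse of the coordinate map \<open>(cr, cx, cy, cz)\<close>: the interpolation needs
  interface points with prescribed coordinates, and not only those below the given
  \<open>q\<close>.\<close>

definition cpoint :: "real \<Rightarrow> real \<Rightarrow> real \<Rightarrow> real \<Rightarrow> real ^ 4" where
  "cpoint r x y z = (1 / sqrt 2) *\<^sub>R vector [y - z, x - y, r - x, x + y + z]"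

lemma coord_cpoint: "cr (cpoint r x y z) = r" "cx (cpoint r x y z) = x" "cy (cpoint r x y z) = y" "cz (cpoint r x y z) = z"
  by (simp_all add: cpoint_def coord_defs field_simps)

lemma HA_eq_HC:
  assumes "cz q = 0" "cr q > 0" shows "HA d q = HC d q" "VAq q = VCq q"
proof -
  have c: "at' q = cr q" "aw q = 0" "ax q = cx q" "ay q = cy q" using assms by (simp_all add: coord_A_C)
  have d: "at' d = cr d + cz d / 2" "aw d = - 3 / 2 * cz d" "ax d = cx d + cz d / 2" "ay d = cy d + cz d / 2"
    by (rule coord_A_C)+
  show "HA d q = HC d q"
    unfolding HA_def HC_def c d KA_def KA1_def KA2_def assms(1)
    using hessian_match[OF assms(2), of "cr d" "cz d" "cx d" "cy d" "cosh (cx q)" "sinh (cx q)" "cosh (cy q)" "sinh (cy q)"] by simp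
  show "VAq q = VCq q"
    unfolding VAq_eq_Q VCq_eq_Q c assms(1) KA_def Q_def by simp
qed

text \<open>At an interface point the residual is a \<open>Lim\<close> over all adjacent chambers,
  and for a general control this limit is not computed here. The hypothesis is therefore applied at
  regular points of \<open>RA\<close>, and the inequality passes to the limit of the formula for
  \<open>VA\<close>, which \<open>HA_eq_HC\<close> identifies with that for
  \<open>VC\<close>.\<close>

lemma interface_nonneg:
  assumes hyp: "\<forall>\<omega>\<in>controls. \<forall>q\<in>region_A. residual \<omega> v q \<ge> 0"
    and w: "w \<in> controls" and r: "r > 0" and xy: "0 \<le> y" "y \<le> x" "x \<le> r"
  shows "U (w $ 1) (w $ 2) (w $ 3) (w $ 4) (w $ 5) r x y 0 \<ge> 0"
proof -
  \<comment> \<open>The last coordinate \<open>- e\<close> lies on the side of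
    \<open>region_A\<close>; the decreasing offsets open the gaps between \<open>r\<close>,
    \<open>x\<close> and \<open>y\<close>, so that all inequalities defining \<open>RA\<close>
    become strict.\<close>
  define p where "p e = cpoint (r + 3 * e) (x + 2 * e) (y + e) (- e)" for e
  have RA: "p e \<in> RA" if "e > 0" for e
    using that xy by (auto simp: RA_def p_def cpoint_def forall_4 divide_simps)
  have nn: "VAq (p e) - 1 / 2 * HA (dvec w) (p e) \<ge> 0" if "e > 0" for e
  proof -
    have "p e \<in> region_A" using RA[OF that] by (auto simp: RA_def region_A_def orthant_def less_imp_le)
    then have "residual w v (p e) \<ge> 0" using hyp w by blast
    moreover have "p e \<in> regular_points" using RA[OF that] by (simp add: regular_points_eq)
    ultimately show ?thesis
      using RA[OF that] by (simp add: residual_def second_dir_deriv_def second_deriv_A v_on_R)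
  qed
  have "p = (\<lambda>e. cpoint r x y 0 + e *\<^sub>R cpoint 3 2 1 (- 1))"
    by (simp add: p_def cpoint_def fun_eq_iff vec_eq_iff forall_4 field_simps)
  then have "isCont p 0"
    by (simp add: continuous_intros)
  then have lim: "(p \<longlongrightarrow> p 0) (at_right 0)"
    by (auto simp: isCont_def intro: filterlim_at_split[THEN iffD1, THEN conjunct2])
  have c: "cr (p 0) = r" "cx (p 0) = x" "cy (p 0) = y" "cz (p 0) = 0" by (simp_all add: p_def coord_cpoint)
  then have a: "at' (p 0) > 0" using r by (simp add: coord_A_C)
  have "((\<lambda>e. VAq (p e) - 1 / 2 * HA (dvec w) (p e)) \<longlongrightarrow> VAq (p 0) - 1 / 2 * HA (dvec w) (p 0)) (at_right 0)"
    by (intro tendsto_intros tendsto_chambers lim a)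
  then have "VAq (p 0) - 1 / 2 * HA (dvec w) (p 0) \<ge> 0"
    by (rule tendsto_lowerbound) (use nn in \<open>auto simp: eventually_at_filter\<close>)
  then show ?thesis
    using HA_eq_HC[of "p 0"] c r residual_eq_U[of "p 0" w] by simp
qed

lemma residual_nonneg_off_interface:
  assumes hyp: "\<forall>\<omega>\<in>controls. \<forall>q\<in>region_A. residual \<omega> v q \<ge> 0"
    and w: "w \<in> controls" and q: "q \<in> region_C" "2 * q $ 1 < q $ 4 - q $ 2"
  shows "residual w v q \<ge> 0"
proof -
  have "residual w v q = U (w $ 1) (w $ 2) (w $ 3) (w $ 4) (w $ 5) (cr q) (cx q) (cy q) (cz q)"
    unfolding residual_def off_interface[OF q] by (rule residual_eq_U)
  also have "\<dots> \<ge> 0"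
  proof (rule U_nonneg)
    note o = region_C_D[OF q(1)]
    have "sqrt 2 * q $ 1 \<ge> 0" "sqrt 2 * q $ 2 \<ge> 0" "sqrt 2 * q $ 3 \<ge> 0" "cz q \<ge> 0" using o q(2) by (simp_all add: cz_def)
    then show "0 \<le> cx q" "cx q \<le> cr q" "0 \<le> cy q" "cy q \<le> cr q" "0 \<le> cz q" "cz q \<le> cr q"
      by (simp_all add: cx_def cy_def cr_def algebra_simps)
    show "0 < cr q" by (rule off_interface[OF q])
    show "U a b c d f (cr q) x y 0 \<ge> 0"
      if "a \<in> {0, 1}" "b \<in> {0, 1}" "c \<in> {0, 1}" "d \<in> {0, 1}" "f \<in> {0, 1}" "0 \<le> y" "y \<le> x" "x \<le> cr q" for a b c d f x y
      using interface_nonneg[OF hyp, of "vector [a, b, c, d, f]" "cr q" y x] that off_interface(3)[OF q]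
      by (simp add: controls_def forall_5)
  qed (use w in \<open>auto simp: controls_def\<close>)
  finally show ?thesis .
qed

section \<open>Asymptotics at the origin\<close>

lemma Aint_Lipschitz:
  assumes "j \<le> 2" "w \<ge> 0" "s > 0" "s' > 0"
  shows "\<bar>Aint j s w - Aint j s' w\<bar> \<le> kap * \<bar>s - s'\<bar>"
proof -
  have "norm (Aint j s w - Aint j s' w) \<le> kap * norm (s - s')"
  proof (rule field_differentiable_bound[of "{0<..}"])
    fix x :: real assume x: "x \<in> {0<..}"
    then show "((\<lambda>s. Aint j s w) has_real_derivative - Akern j w x) (at x within {0<..})"
      using Aint_deriv_s[of x j w] by (auto intro: has_field_derivative_at_within)
    have "\<bar>Akern j w x\<bar> \<le> kap * exp (- x)" using Akern_bound_2[of x w j] assms x by simp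
    also have "\<dots> \<le> kap * 1" using x by (intro mult_left_mono) auto
    finally show "norm (- Akern j w x) \<le> kap" by simp
  qed (use assms in auto)
  then show ?thesis by simp
qed

text \<open>The limit exists for \<open>j \<le> 2\<close>, as a Lipschitz function extends to the
  closure of its domain.\<close>

definition alp :: "nat \<Rightarrow> real" where "alp j = Lim (at_right 0) (\<lambda>s. Aint j s 0)"

lemma alp_tendsto:
  assumes "j \<le> 2" shows "((\<lambda>s. Aint j s 0) \<longlongrightarrow> alp j) (at_right 0)"
proof -
  have "uniformly_continuous_on {0<..} (\<lambda>s. Aint j s 0)"
    unfolding uniformly_continuous_on_def
  proof (intro allI impI)
    fix e :: real assume "e > 0"
    then show "\<exists>d>0. \<forall>x\<in>{0<..}. \<forall>x'\<in>{0<..}. dist x' x < d \<longrightarrow> dist (Aint j x' 0) (Aint j x 0) < e"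
      using Aint_Lipschitz[OF assms, of 0]
      by (intro exI[of _ "e / kap"]) (auto simp: dist_real_def field_simps intro: le_less_trans)
  qed
  then obtain l where "((\<lambda>s. Aint j s 0) \<longlongrightarrow> l) (at 0 within {0<..})"
    using uniformly_continuous_on_extension_at_closure[of "{0<..}" "\<lambda>s. Aint j s 0" 0] by auto
  then show ?thesis
    unfolding alp_def using tendsto_Lim[of "at_right (0::real)"] by (metis trivial_limit_at_right_real)
qed

lemma alp_dist:
  assumes "j \<le> 2" "s > 0" shows "\<bar>Aint j s 0 - alp j\<bar> \<le> kap * s"
proof -
  have "((\<lambda>s'. \<bar>Aint j s 0 - Aint j s' 0\<bar>) \<longlongrightarrow> \<bar>Aint j s 0 - alp j\<bar>) (at_right 0)"
    by (intro tendsto_intros alp_tendsto assms)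
  then show ?thesis
  proof (rule tendsto_upperbound)
    show "\<forall>\<^sub>F s' in at_right 0. \<bar>Aint j s 0 - Aint j s' 0\<bar> \<le> kap * s"
      using eventually_at_right_real[OF assms(2)]
    proof eventually_elim
      case (elim s')
      then have "\<bar>Aint j s 0 - Aint j s' 0\<bar> \<le> kap * \<bar>s - s'\<bar>"
        using assms by (intro Aint_Lipschitz) auto
      also have "\<dots> \<le> kap * s" using elim by (intro mult_left_mono) auto
      finally show ?case .
    qed
  qed simp
qed

text \<open>The powers of \<open>coth\<close> beyond the third are largest at the lower limit of
  integration and can be pulled out there.\<close>

lemma Aint_high_bound:
  assumes "s > 0" "w \<ge> 0" "j \<ge> 3"
  shows "\<bar>Aint j s w\<bar> \<le> cth s ^ (j - 3) * Xint 3 s"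
proof -
  have int: "Akern i u integrable_on {s..}" for i u
    using decaying_integrable[OF Akern_decaying assms(1)] by (simp add: absolutely_integrable_on_def)
  have "norm (integral {s..} (Akern j w)) \<le> integral {s..} (\<lambda>m. cth s ^ (j - 3) * - Akern 3 0 m)"
  proof (rule integral_norm_bound_integral[OF int])
    show "(\<lambda>m. cth s ^ (j - 3) * - Akern 3 0 m) integrable_on {s..}"
      using int by (intro integrable_on_mult_right integrable_neg)
    fix m assume m: "m \<in> {s..}"
    then have m0: "m > 0" using assms by simp
    have e: "exp (- 2 * w * cth m) \<le> 1" using assms m0 by simp
    have c: "cth m ^ (j - 3) \<le> cth s ^ (j - 3)"
      using cth_antimono[OF assms(1), of m] m m0 by (intro power_mono) auto
    have "norm (Akern j w m) = sinh m * cth m ^ j * gam m * exp (- 2 * w * cth m)"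
      using m0 gam_nonneg[OF m0] abs_of_pos[OF cth_pos[OF m0]] by (simp add: Akern_def abs_mult power_abs)
    also have "\<dots> \<le> sinh m * cth m ^ j * gam m * 1"
      using e m0 gam_nonneg[OF m0] by (intro mult_left_mono) auto
    also have "\<dots> = cth m ^ (j - 3) * (sinh m * cth m ^ 3 * gam m)"
      using assms(3) by (simp flip: power_add)
    also have "\<dots> \<le> cth s ^ (j - 3) * (sinh m * cth m ^ 3 * gam m)"
      using c m0 gam_nonneg[OF m0] by (intro mult_right_mono) auto
    also have "\<dots> = cth s ^ (j - 3) * - Akern 3 0 m"
      by (simp add: Akern_def)
    finally show "norm (Akern j w m) \<le> cth s ^ (j - 3) * - Akern 3 0 m" .
  qed
  then show ?thesis
    by (simp add: Aint_def Xint_def)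
qed

lemma at_right_0_limits:
  "(sinh \<longlongrightarrow> 0) (at_right (0::real))" "(cosh \<longlongrightarrow> 1) (at_right (0::real))" "(theta \<longlongrightarrow> pi / 4) (at_right 0)"
  "((\<lambda>t. sinh t * Lam t) \<longlongrightarrow> 0) (at_right 0)"
proof -
  have "((\<lambda>t::real. sinh t) \<longlongrightarrow> sinh 0) (at_right 0)" "((\<lambda>t::real. cosh t) \<longlongrightarrow> cosh 0) (at_right 0)"
    "((\<lambda>t. arctan (exp (- t))) \<longlongrightarrow> arctan (exp (- 0))) (at_right 0)"
    by (intro tendsto_intros)+
  then show "(sinh \<longlongrightarrow> 0) (at_right (0::real))" "(cosh \<longlongrightarrow> 1) (at_right (0::real))" "(theta \<longlongrightarrow> pi / 4) (at_right 0)"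
    by (simp_all add: theta_def[abs_def] arctan_one)
  show "((\<lambda>t. sinh t * Lam t) \<longlongrightarrow> 0) (at_right 0)"
    unfolding Lam_def sinh_def by (simp, real_asymp)
qed

text \<open>By its closed form \<open>Xint 3\<close> grows only like \<open>Lam\<close> at 0, that
  is, logarithmically.\<close>

lemma sinh_Xint_3_tendsto_0: "((\<lambda>t. sinh t * Xint 3 t) \<longlongrightarrow> 0) (at_right 0)"
proof -
  note l = at_right_0_limits gam_tendsto_0_at_0
  have "((\<lambda>t. (cosh t ^ 2 * gam t + kap * (sinh t * Lam t) + 2 / 5 * (sinh t * (sinh t * gam t + kap * (1 / cosh t)))) / 7)
     \<longlongrightarrow> (1 ^ 2 * 0 + kap * 0 + 2 / 5 * (0 * (0 * 0 + kap * (1 / 1)))) / 7) (at_right 0)"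
    by (intro tendsto_intros l) auto
  then have "((\<lambda>t. (cosh t ^ 2 * gam t + kap * (sinh t * Lam t) + 2 / 5 * (sinh t * (sinh t * gam t + kap * (1 / cosh t)))) / 7)
     \<longlongrightarrow> 0) (at_right 0)" by simp
  then show ?thesis
  proof (rule Lim_transform_eventually)
    show "\<forall>\<^sub>F t in at_right 0. (cosh t ^ 2 * gam t + kap * (sinh t * Lam t)
        + 2 / 5 * (sinh t * (sinh t * gam t + kap * (1 / cosh t)))) / 7 = sinh t * Xint 3 t"
    proof (rule eventually_at_rightI[of 0 1])
      fix t :: real assume "t \<in> {0<..<1}"
      then have t: "t > 0" by simp
      define S C k where "S = sinh t" and "C = cosh t" and "k = 1 / C"
      note cf = closed_forms[OF t, folded C_def S_def, folded k_def]
      have "7 * (S * Xint 3 t) = C ^ 2 * gam t + kap * (S * Lam t) + 2 * (S * Xint 1 t)"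
        using cf(2,6) by algebra
      then show "(cosh t ^ 2 * gam t + kap * (sinh t * Lam t) + 2 / 5 * (sinh t * (sinh t * gam t + kap * (1 / cosh t)))) / 7 = sinh t * Xint 3 t"
        unfolding S_def[symmetric] C_def[symmetric] k_def[symmetric] cf(4)[symmetric] by simp
    qed simp
  qed
qed

text \<open>The closed form of \<open>Xint 2\<close> in the limit at 0. This relation is what makes
  the constant terms of \<open>Th 0\<close> and \<open>Xi 0\<close> cancel at the origin.\<close>

lemma alp_2: "6 * alp 2 = kap * pi / 2 + alp 0"
proof -
  have "((\<lambda>t. cosh t * gam t + 2 * kap * theta t + Aint 0 t 0) \<longlongrightarrow> 1 * 0 + 2 * kap * (pi / 4) + alp 0) (at_right 0)"
    by (intro tendsto_intros at_right_0_limits gam_tendsto_0_at_0 alp_tendsto) auto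
  moreover have "\<forall>\<^sub>F t in at_right 0. cosh t * gam t + 2 * kap * theta t + Aint 0 t 0 = 6 * Aint 2 t 0"
    by (rule eventually_at_rightI[of 0 1]) (use Xint_2 in \<open>auto simp: Xint_def\<close>)
  ultimately have 1: "((\<lambda>t. 6 * Aint 2 t 0) \<longlongrightarrow> 1 * 0 + 2 * kap * (pi / 4) + alp 0) (at_right 0)"
    by (rule Lim_transform_eventually)
  have 2: "((\<lambda>t. 6 * Aint 2 t 0) \<longlongrightarrow> 6 * alp 2) (at_right 0)"
    by (intro tendsto_intros alp_tendsto) auto
  show ?thesis
    using tendsto_unique[OF trivial_limit_at_right_real 1 2] by simp
qed

section \<open>Limits as \<open>t\<close> tends to 0 from the right and \<open>w\<close> tends to 0
  through nonnegative values\<close>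

context
  fixes F :: "'a filter" and t w :: "'a \<Rightarrow> real"
  assumes t: "filterlim t (at_right 0) F" and w: "(w \<longlongrightarrow> 0) F" and wn: "\<forall>\<^sub>F x in F. w x \<ge> 0"
begin

lemma tpos: "\<forall>\<^sub>F x in F. t x > 0"
  using t by (auto simp: filterlim_at elim: eventually_mono)

lemma origin_S: "((\<lambda>x. sinh (t x)) \<longlongrightarrow> 0) F"
  and origin_C: "((\<lambda>x. cosh (t x)) \<longlongrightarrow> 1) F"
  and origin_theta: "((\<lambda>x. theta (t x)) \<longlongrightarrow> pi / 4) F"
  and origin_Lam: "((\<lambda>x. sinh (t x) * Lam (t x)) \<longlongrightarrow> 0) F"
  and origin_gam: "((\<lambda>x. gam (t x)) \<longlongrightarrow> 0) F"
  using filterlim_compose[OF at_right_0_limits(1) t] filterlim_compose[OF at_right_0_limits(2) t]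
    filterlim_compose[OF at_right_0_limits(3) t] filterlim_compose[OF at_right_0_limits(4) t]
    filterlim_compose[OF gam_tendsto_0_at_0 t] by simp_all

lemma origin_exp: "((\<lambda>x. exp (- 2 * t x)) \<longlongrightarrow> 1) F"
proof -
  have "(t \<longlongrightarrow> 0) F" using t by (auto simp: filterlim_at)
  then have "((\<lambda>x. exp (- 2 * t x)) \<longlongrightarrow> exp (- 2 * 0)) F" by (intro tendsto_intros)
  then show ?thesis by simp
qed

lemma origin_A:
  assumes "j \<le> 2" shows "((\<lambda>x. Aint j (t x) (w x)) \<longlongrightarrow> alp j) F"
proof (rule tendstoI)
  fix e :: real assume e: "e > 0"
  \<comment> \<open>Three errors of at most \<open>e / 4\<close> each: from \<open>t x\<close> to
    \<open>\<delta>\<close>, from \<open>w x\<close> to 0 at fixed \<open>\<delta>\<close>, and from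
    \<open>\<delta>\<close> to 0.\<close>
  define \<delta> where "\<delta> = e / (4 * kap)"
  have \<delta>: "\<delta> > 0" "kap * \<delta> = e / 4" using e less_imp_neq[OF kap_pos] by (simp_all add: \<delta>_def)
  have "((\<lambda>x. Aint j \<delta> (w x)) \<longlongrightarrow> Aint j \<delta> 0) F"
    by (intro tendsto_intros w \<delta>(1))
  then have "\<forall>\<^sub>F x in F. dist (Aint j \<delta> (w x)) (Aint j \<delta> 0) < e / 4"
    using e by (intro tendstoD) auto
  moreover have "\<forall>\<^sub>F x in F. t x < \<delta>"
    using t \<delta>(1) by (auto simp: filterlim_at order_tendsto_iff)
  ultimately show "\<forall>\<^sub>F x in F. dist (Aint j (t x) (w x)) (alp j) < e"
    using tpos wn
  proof eventually_elim
    case (elim x)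
    have "\<bar>Aint j (t x) (w x) - Aint j \<delta> (w x)\<bar> \<le> kap * \<bar>t x - \<delta>\<bar>"
      using elim \<delta> assms by (intro Aint_Lipschitz) auto
    also have "\<dots> \<le> kap * \<delta>" using elim by (intro mult_left_mono) auto
    finally show ?case
      using elim alp_dist[OF assms \<delta>(1)] \<delta>(2) e unfolding dist_real_def by linarith
  qed
qed

text \<open>Of the factors \<open>sinh\<close>, \<open>j - 3\<close> compensate the powers of
  \<open>coth\<close>, and the last one the logarithm in \<open>Xint 3\<close>.\<close>

lemma origin_A_high:
  assumes "j \<ge> 3" shows "((\<lambda>x. sinh (t x) ^ (j - 2) * Aint j (t x) (w x)) \<longlongrightarrow> 0) F"
proof (rule Lim_null_comparison)
  have "((\<lambda>x. cosh (t x) ^ (j - 3) * (sinh (t x) * Xint 3 (t x))) \<longlongrightarrow> 1 ^ (j - 3) * 0) F"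
    by (intro tendsto_intros origin_C filterlim_compose[OF sinh_Xint_3_tendsto_0 t])
  then show "((\<lambda>x. cosh (t x) ^ (j - 3) * (sinh (t x) * Xint 3 (t x))) \<longlongrightarrow> 0) F" by simp
  show "\<forall>\<^sub>F x in F. norm (sinh (t x) ^ (j - 2) * Aint j (t x) (w x)) \<le> cosh (t x) ^ (j - 3) * (sinh (t x) * Xint 3 (t x))"
    using tpos wn
  proof eventually_elim
    case (elim x)
    have "norm (sinh (t x) ^ (j - 2) * Aint j (t x) (w x)) = sinh (t x) ^ (j - 2) * \<bar>Aint j (t x) (w x)\<bar>"
      using elim by (simp add: abs_mult)
    also have "\<dots> \<le> sinh (t x) ^ (j - 2) * (cth (t x) ^ (j - 3) * Xint 3 (t x))"
      using elim assms by (intro mult_left_mono Aint_high_bound) auto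
    also have "\<dots> = cosh (t x) ^ (j - 3) * (sinh (t x) * Xint 3 (t x))"
    proof -
      have "sinh (t x) ^ (j - 2) = sinh (t x) * sinh (t x) ^ (j - 3)"
      proof -
        have "j - 2 = Suc (j - 3)" using assms by simp
        then show ?thesis by simp
      qed
      then show ?thesis
        using elim by (simp add: cth_def power_divide)
    qed
    finally show ?case .
  qed
qed

lemma origin_A345:
  "((\<lambda>x. sinh (t x) * Aint 3 (t x) (w x)) \<longlongrightarrow> 0) F" "((\<lambda>x. sinh (t x) ^ 2 * Aint 4 (t x) (w x)) \<longlongrightarrow> 0) F"
  "((\<lambda>x. sinh (t x) ^ 3 * Aint 5 (t x) (w x)) \<longlongrightarrow> 0) F"
  using origin_A_high[of 3] origin_A_high[of 4] origin_A_high[of 5] by simp_all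

lemma origin_A012:
  "((\<lambda>x. Aint 0 (t x) (w x)) \<longlongrightarrow> alp 0) F" "((\<lambda>x. Aint 1 (t x) (w x)) \<longlongrightarrow> alp 1) F" "((\<lambda>x. Aint 2 (t x) (w x)) \<longlongrightarrow> alp 2) F"
  using origin_A[of 0] origin_A[of 1] origin_A[of 2] by simp_all

lemma origin_I:
  "((\<lambda>x. Iint 0 (t x) (w x)) \<longlongrightarrow> alp 0) F" "((\<lambda>x. Iint 1 (t x) (w x)) \<longlongrightarrow> alp 1) F" "((\<lambda>x. Iint 2 (t x) (w x)) \<longlongrightarrow> alp 2) F"
  "((\<lambda>x. sinh (t x) * Iint 3 (t x) (w x)) \<longlongrightarrow> 0) F" "((\<lambda>x. sinh (t x) ^ 2 * Iint 4 (t x) (w x)) \<longlongrightarrow> 0) F"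
proof -
  let ?S = "\<lambda>x. sinh (t x)" and ?C = "\<lambda>x. cosh (t x)" and ?A = "\<lambda>j x. Aint j (t x) (w x)"
  note l = origin_S origin_C origin_A012 origin_A345
  have "((\<lambda>x. ?C x * ?A 0 x + ?S x * ?A 1 x) \<longlongrightarrow> 1 * alp 0 + 0 * alp 1) F"
    "((\<lambda>x. ?C x * ?A 1 x + ?S x * ?A 2 x) \<longlongrightarrow> 1 * alp 1 + 0 * alp 2) F"
    "((\<lambda>x. ?C x * ?A 2 x + (?S x * ?A 3 x)) \<longlongrightarrow> 1 * alp 2 + 0) F"
    "((\<lambda>x. ?C x * (?S x * ?A 3 x) + (?S x ^ 2 * ?A 4 x)) \<longlongrightarrow> 1 * 0 + 0) F"
    "((\<lambda>x. ?C x * (?S x ^ 2 * ?A 4 x) + (?S x ^ 3 * ?A 5 x)) \<longlongrightarrow> 1 * 0 + 0) F"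
    by (intro tendsto_add tendsto_mult l)+
  then show "((\<lambda>x. Iint 0 (t x) (w x)) \<longlongrightarrow> alp 0) F" "((\<lambda>x. Iint 1 (t x) (w x)) \<longlongrightarrow> alp 1) F" "((\<lambda>x. Iint 2 (t x) (w x)) \<longlongrightarrow> alp 2) F"
    "((\<lambda>x. sinh (t x) * Iint 3 (t x) (w x)) \<longlongrightarrow> 0) F" "((\<lambda>x. sinh (t x) ^ 2 * Iint 4 (t x) (w x)) \<longlongrightarrow> 0) F"
    by (simp_all add: Iint_def eval_nat_numeral algebra_simps)
qed

lemma origin_J:
  "((\<lambda>x. Jint 0 (t x) (w x)) \<longlongrightarrow> alp 1) F" "((\<lambda>x. Jint 1 (t x) (w x)) \<longlongrightarrow> alp 2) F"
  "((\<lambda>x. sinh (t x) * Jint 2 (t x) (w x)) \<longlongrightarrow> 0) F" "((\<lambda>x. sinh (t x) ^ 2 * Jint 3 (t x) (w x)) \<longlongrightarrow> 0) F"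
proof -
  let ?S = "\<lambda>x. sinh (t x)" and ?C = "\<lambda>x. cosh (t x)" and ?A = "\<lambda>j x. Aint j (t x) (w x)"
  note l = origin_S origin_C origin_A012 origin_A345
  have "((\<lambda>x. ?S x * ?A 0 x + ?C x * ?A 1 x) \<longlongrightarrow> 0 * alp 0 + 1 * alp 1) F"
    "((\<lambda>x. ?S x * ?A 1 x + ?C x * ?A 2 x) \<longlongrightarrow> 0 * alp 1 + 1 * alp 2) F"
    "((\<lambda>x. ?S x * (?S x * ?A 2 x) + ?C x * (?S x * ?A 3 x)) \<longlongrightarrow> 0 * (0 * alp 2) + 1 * 0) F"
    "((\<lambda>x. ?S x * (?S x * (?S x * ?A 3 x)) + ?C x * (?S x ^ 2 * ?A 4 x)) \<longlongrightarrow> 0 * (0 * 0) + 1 * 0) F"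
    by (intro tendsto_add tendsto_mult l)+
  then show "((\<lambda>x. Jint 0 (t x) (w x)) \<longlongrightarrow> alp 1) F" "((\<lambda>x. Jint 1 (t x) (w x)) \<longlongrightarrow> alp 2) F"
    "((\<lambda>x. sinh (t x) * Jint 2 (t x) (w x)) \<longlongrightarrow> 0) F" "((\<lambda>x. sinh (t x) ^ 2 * Jint 3 (t x) (w x)) \<longlongrightarrow> 0) F"
    by (simp_all add: Jint_def eval_nat_numeral algebra_simps)
qed

lemma origin_Fk: "((\<lambda>x. sinh (t x) ^ j * Fk j (t x) (w x)) \<longlongrightarrow> 0) F"
proof (rule Lim_null_comparison)
  have "((\<lambda>x. cosh (t x) ^ j * gam (t x)) \<longlongrightarrow> 1 ^ j * 0) F"
    by (intro tendsto_intros origin_C origin_gam)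
  then show "((\<lambda>x. cosh (t x) ^ j * gam (t x)) \<longlongrightarrow> 0) F" by simp
  show "\<forall>\<^sub>F x in F. norm (sinh (t x) ^ j * Fk j (t x) (w x)) \<le> cosh (t x) ^ j * gam (t x)"
    using tpos wn
  proof eventually_elim
    case (elim x)
    have "norm (sinh (t x) ^ j * Fk j (t x) (w x)) = cosh (t x) ^ j * gam (t x) * exp (- 2 * w x * cth (t x))"
      using elim gam_nonneg[OF elim(1)] by (simp add: Fk_def abs_mult power_abs cth_def power_divide)
    also have "\<dots> \<le> cosh (t x) ^ j * gam (t x) * 1"
      using elim gam_nonneg[OF elim(1)] by (intro mult_left_mono) auto
    finally show ?case by simp
  qed
qed

lemma origin_kf:
  "((\<lambda>x. kf 0 (t x) (w x)) \<longlongrightarrow> kap * pi / 2 + alp 0) F" "((\<lambda>x. kf 1 (t x) (w x)) \<longlongrightarrow> alp 1 - kap) F"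
  "((\<lambda>x. kf 2 (t x) (w x)) \<longlongrightarrow> alp 2) F"
  "((\<lambda>x. sinh (t x) ^ 2 * kf 3 (t x) (w x)) \<longlongrightarrow> 0) F"
proof -
  let ?S = "\<lambda>x. sinh (t x)" and ?C = "\<lambda>x. cosh (t x)"
  note l = origin_S origin_C origin_theta origin_Lam origin_I
  have "((\<lambda>x. 2 * kap * theta (t x) * ?C x + Iint 0 (t x) (w x)) \<longlongrightarrow> 2 * kap * (pi / 4) * 1 + alp 0) F"
    "((\<lambda>x. - kap + Iint 1 (t x) (w x)) \<longlongrightarrow> - kap + alp 1) F"
    "((\<lambda>x. kap * (?S x * Lam (t x)) + Iint 2 (t x) (w x)) \<longlongrightarrow> kap * 0 + alp 2) F"
    "((\<lambda>x. kap * (?C x * (?S x * (?S x * Lam (t x))) - 2 * (?S x * ?S x)) + ?S x * (?S x * Iint 3 (t x) (w x)))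
      \<longlongrightarrow> kap * (1 * (0 * 0) - 2 * (0 * 0)) + 0 * 0) F"
    by (intro tendsto_add tendsto_diff tendsto_mult tendsto_const l)+
  then show "((\<lambda>x. kf 0 (t x) (w x)) \<longlongrightarrow> kap * pi / 2 + alp 0) F" "((\<lambda>x. kf 1 (t x) (w x)) \<longlongrightarrow> alp 1 - kap) F"
    "((\<lambda>x. kf 2 (t x) (w x)) \<longlongrightarrow> alp 2) F" "((\<lambda>x. sinh (t x) ^ 2 * kf 3 (t x) (w x)) \<longlongrightarrow> 0) F"
    by (simp_all add: kf_def eval_nat_numeral algebra_simps)
qed

lemma origin_kt:
  "((\<lambda>x. kt 0 (t x) (w x)) \<longlongrightarrow> alp 1 - kap) F" "((\<lambda>x. kt 1 (t x) (w x)) \<longlongrightarrow> alp 2) F"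
  "((\<lambda>x. sinh (t x) * kt 2 (t x) (w x)) \<longlongrightarrow> 0) F"
proof -
  let ?S = "\<lambda>x. sinh (t x)" and ?C = "\<lambda>x. cosh (t x)"
  note l = origin_S origin_C origin_theta origin_Lam origin_J
  have "((\<lambda>x. 2 * kap * theta (t x) * ?S x - kap + Jint 0 (t x) (w x)) \<longlongrightarrow> 2 * kap * (pi / 4) * 0 - kap + alp 1) F"
    "((\<lambda>x. Jint 1 (t x) (w x)) \<longlongrightarrow> alp 2) F"
    "((\<lambda>x. kap * (?C x * (?S x * Lam (t x)) - ?S x) + ?S x * Jint 2 (t x) (w x)) \<longlongrightarrow> kap * (1 * 0 - 0) + 0) F"
    by (intro tendsto_add tendsto_diff tendsto_mult tendsto_const l)+
  then show "((\<lambda>x. kt 0 (t x) (w x)) \<longlongrightarrow> alp 1 - kap) F" "((\<lambda>x. kt 1 (t x) (w x)) \<longlongrightarrow> alp 2) F"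
    "((\<lambda>x. sinh (t x) * kt 2 (t x) (w x)) \<longlongrightarrow> 0) F"
    by (simp_all add: kt_def eval_nat_numeral algebra_simps)
qed

lemma origin_ktt:
  "((\<lambda>x. ktt 0 (t x) (w x)) \<longlongrightarrow> kap * pi / 2 + alp 0) F" "((\<lambda>x. sinh (t x) * ktt 1 (t x) (w x)) \<longlongrightarrow> 0) F"
  "((\<lambda>x. sinh (t x) ^ 2 * ktt 2 (t x) (w x)) \<longlongrightarrow> 0) F"
proof -
  let ?S = "\<lambda>x. sinh (t x)" and ?C = "\<lambda>x. cosh (t x)"
  have f: "((\<lambda>x. Fk 0 (t x) (w x)) \<longlongrightarrow> 0) F" "((\<lambda>x. ?S x * Fk 1 (t x) (w x)) \<longlongrightarrow> 0) F"
    "((\<lambda>x. ?S x ^ 2 * Fk 2 (t x) (w x)) \<longlongrightarrow> 0) F"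
    using origin_Fk[of 0] origin_Fk[of 1] origin_Fk[of 2] by simp_all
  have ic: "((\<lambda>x. 1 / ?C x) \<longlongrightarrow> 1 / 1) F" by (intro tendsto_intros origin_C) simp
  note l = origin_S origin_C origin_theta origin_Lam origin_I f ic
  have "((\<lambda>x. 2 * kap * theta (t x) * ?C x - kap * (?S x * (1 / ?C x)) + Iint 0 (t x) (w x) + Fk 0 (t x) (w x))
      \<longlongrightarrow> 2 * kap * (pi / 4) * 1 - kap * (0 * (1 / 1)) + alp 0 + 0) F"
    "((\<lambda>x. ?S x * Iint 1 (t x) (w x) + ?S x * Fk 1 (t x) (w x)) \<longlongrightarrow> 0 * alp 1 + 0) F"
    by (intro tendsto_add tendsto_diff tendsto_mult tendsto_const l)+
  then show "((\<lambda>x. ktt 0 (t x) (w x)) \<longlongrightarrow> kap * pi / 2 + alp 0) F" "((\<lambda>x. sinh (t x) * ktt 1 (t x) (w x)) \<longlongrightarrow> 0) F"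
    by (simp_all add: ktt_def eval_nat_numeral algebra_simps)
  have "((\<lambda>x. kap * (?S x * ?S x * (?S x * Lam (t x)) - ?S x * ?C x) + ?S x * (?S x * Iint 2 (t x) (w x)) + ?S x ^ 2 * Fk 2 (t x) (w x))
      \<longlongrightarrow> kap * (0 * 0 * 0 - 0 * 1) + 0 * (0 * alp 2) + 0) F"
    by (intro tendsto_add tendsto_diff tendsto_mult tendsto_const l)
  then have "((\<lambda>x. kap * (?S x * ?S x * (?S x * Lam (t x)) - ?S x * ?C x) + ?S x * (?S x * Iint 2 (t x) (w x)) + ?S x ^ 2 * Fk 2 (t x) (w x))
      \<longlongrightarrow> 0) F" by simp
  then show "((\<lambda>x. sinh (t x) ^ 2 * ktt 2 (t x) (w x)) \<longlongrightarrow> 0) F"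
    by (rule Lim_transform_eventually)
      (use tpos in \<open>eventually_elim, simp add: ktt_def eval_nat_numeral field_simps\<close>)
qed

lemma origin_kw:
  "((\<lambda>x. kw 0 (t x) (w x)) \<longlongrightarrow> 2 * alp 1) F" "((\<lambda>x. kw 1 (t x) (w x)) \<longlongrightarrow> 2 * alp 2) F"
  "((\<lambda>x. sinh (t x) * kw 2 (t x) (w x)) \<longlongrightarrow> 0) F"
  "((\<lambda>x. ktw 0 (t x) (w x)) \<longlongrightarrow> 2 * alp 2) F" "((\<lambda>x. sinh (t x) * ktw 1 (t x) (w x)) \<longlongrightarrow> 0) F"
  "((\<lambda>x. sinh (t x) ^ 2 * ktw 2 (t x) (w x)) \<longlongrightarrow> 0) F"
  "((\<lambda>x. kww 0 (t x) (w x)) \<longlongrightarrow> 4 * alp 2) F" "((\<lambda>x. sinh (t x) * kww 1 (t x) (w x)) \<longlongrightarrow> 0) F"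
  "((\<lambda>x. sinh (t x) ^ 2 * kww 2 (t x) (w x)) \<longlongrightarrow> 0) F"
  using origin_I(2-)[THEN tendsto_mult_left, of 2] origin_I(2-)[THEN tendsto_mult_left, of 4] origin_J(2-)[THEN tendsto_mult_left, of 2]
  by (simp_all add: kw_def ktw_def kww_def eval_nat_numeral mult_ac)

lemma origin_be:
  "((\<lambda>x. be 0 (t x)) \<longlongrightarrow> 4 / 3 * kap) F" "((\<lambda>x. be 1 (t x)) \<longlongrightarrow> - 2 / 3 * kap) F" "((\<lambda>x. be 2 (t x)) \<longlongrightarrow> - 2 / 3 * kap) F"
  "((\<lambda>x. be1 0 (t x)) \<longlongrightarrow> - 2 / 3 * kap) F" "((\<lambda>x. be1 1 (t x)) \<longlongrightarrow> - 2 / 3 * kap) F" "((\<lambda>x. sinh (t x) * be1 2 (t x)) \<longlongrightarrow> 0) F"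
  "((\<lambda>x. be2 0 (t x)) \<longlongrightarrow> 4 / 3 * kap) F" "((\<lambda>x. be2 1 (t x)) \<longlongrightarrow> 4 / 3 * kap) F" "((\<lambda>x. sinh (t x) ^ 2 * be2 2 (t x)) \<longlongrightarrow> 0) F"
proof -
  let ?S = "\<lambda>x. sinh (t x)" and ?C = "\<lambda>x. cosh (t x)" and ?E = "\<lambda>x. exp (- 2 * t x)"
  note l = origin_S origin_C origin_Lam origin_exp
  have "((\<lambda>x. kap * (1 + ?E x / 3)) \<longlongrightarrow> kap * (1 + 1 / 3)) F" "((\<lambda>x. kap * (- 1 + ?E x / 3)) \<longlongrightarrow> kap * (- 1 + 1 / 3)) F"
    "((\<lambda>x. kap * (- 1 + ?E x / 3) + 2 * kap * (?S x * Lam (t x))) \<longlongrightarrow> kap * (- 1 + 1 / 3) + 2 * kap * 0) F"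
    "((\<lambda>x. - (2 / 3) * kap * ?E x) \<longlongrightarrow> - (2 / 3) * kap * 1) F"
    "((\<lambda>x. - (2 / 3) * kap * (?S x * ?E x) + 2 * kap * (?C x * (?S x * Lam (t x)) - ?S x)) \<longlongrightarrow> - (2 / 3) * kap * (0 * 1) + 2 * kap * (1 * 0 - 0)) F"
    "((\<lambda>x. 4 / 3 * kap * ?E x) \<longlongrightarrow> 4 / 3 * kap * 1) F"
    by (intro tendsto_add tendsto_diff tendsto_mult tendsto_divide tendsto_const l; simp)+
  then show "((\<lambda>x. be 0 (t x)) \<longlongrightarrow> 4 / 3 * kap) F" "((\<lambda>x. be 1 (t x)) \<longlongrightarrow> - 2 / 3 * kap) F" "((\<lambda>x. be 2 (t x)) \<longlongrightarrow> - 2 / 3 * kap) F"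
    "((\<lambda>x. be1 0 (t x)) \<longlongrightarrow> - 2 / 3 * kap) F" "((\<lambda>x. be1 1 (t x)) \<longlongrightarrow> - 2 / 3 * kap) F" "((\<lambda>x. sinh (t x) * be1 2 (t x)) \<longlongrightarrow> 0) F"
    "((\<lambda>x. be2 0 (t x)) \<longlongrightarrow> 4 / 3 * kap) F" "((\<lambda>x. be2 1 (t x)) \<longlongrightarrow> 4 / 3 * kap) F"
    by (simp_all add: eval_nat_numeral algebra_simps)
  have "((\<lambda>x. 4 / 3 * kap * (?S x * (?S x * ?E x)) + 2 * kap * (?S x * ?S x * (?S x * Lam (t x)) - ?S x * ?C x))
     \<longlongrightarrow> 4 / 3 * kap * (0 * (0 * 1)) + 2 * kap * (0 * 0 * 0 - 0 * 1)) F"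
    by (intro tendsto_add tendsto_diff tendsto_mult tendsto_const l)
  then have "((\<lambda>x. 4 / 3 * kap * (?S x * (?S x * ?E x)) + 2 * kap * (?S x * ?S x * (?S x * Lam (t x)) - ?S x * ?C x)) \<longlongrightarrow> 0) F"
    by simp
  then show "((\<lambda>x. sinh (t x) ^ 2 * be2 2 (t x)) \<longlongrightarrow> 0) F"
    by (rule Lim_transform_eventually)
      (use tpos in \<open>eventually_elim, simp add: eval_nat_numeral field_simps\<close>)
qed

end

section \<open>The three residuals near the interface\<close>

definition "D1 = dvec (vector [0, 0, 1, 0, 1])"
definition "D2 = dvec (vector [0, 1, 0, 0, 1])"
definition "D3 = dvec (vector [0, 1, 1, 1, 0])"

text \<open>In the coordinates of \<open>VC\<close> each direction moves a single argument.
  \<open>VA\<close> sees \<open>D1\<close> and \<open>D2\<close> in the same way, but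
  \<open>D3\<close> moves all its arguments; in \<open>VB\<close> both \<open>D2\<close> and
  \<open>D3\<close> also move \<open>bw\<close>. These are the cases that leave a defect to be
  estimated.\<close>

lemma coord_D:
  "at' D1 = sqrt 2 * 0" "aw D1 = sqrt 2 * 0" "bw D1 = sqrt 2 * 0" "ax D1 = sqrt 2 * 1" "ay D1 = sqrt 2 * 0"
  "at' D2 = sqrt 2 * 0" "aw D2 = sqrt 2 * 0" "bw D2 = sqrt 2 * 1" "ax D2 = sqrt 2 * 0" "ay D2 = sqrt 2 * 1"
  "at' D3 = sqrt 2 * (- 1 / 2)" "aw D3 = sqrt 2 * (3 / 2)" "bw D3 = sqrt 2 * 1" "ax D3 = sqrt 2 * (- 1 / 2)" "ay D3 = sqrt 2 * (- 1 / 2)"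
  "cr D1 = sqrt 2 * 0" "cx D1 = sqrt 2 * 1" "cy D1 = sqrt 2 * 0" "cz D1 = sqrt 2 * 0"
  "cr D2 = sqrt 2 * 0" "cx D2 = sqrt 2 * 0" "cy D2 = sqrt 2 * 1" "cz D2 = sqrt 2 * 0"
  "cr D3 = sqrt 2 * 0" "cx D3 = sqrt 2 * 0" "cy D3 = sqrt 2 * 0" "cz D3 = sqrt 2 * - 1"
  by (simp_all add: D1_def D2_def D3_def dvec_def coord_defs)

lemma HC_D: "HC D1 q = 2 * VCq q" "HC D2 q = 2 * VCq q" "HC D3 q = 2 * VCq q"
  by (simp_all add: HC_def VCq_eq_Q coord_D kD1_def kD2_def Q2_def Q_def)

lemma HA_scaled:
  assumes "at' d = sqrt 2 * a" "aw d = sqrt 2 * b" "ax d = sqrt 2 * x" "ay d = sqrt 2 * y"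
  shows "HA d q = 2 * Q2 (KA (at' q) (aw q)) (KA1 a b (at' q) (aw q)) (KA2 a b (at' q) (aw q)) x y 0
    (cosh (ax q)) (sinh (ax q)) (cosh (ay q)) (sinh (ay q)) 1 0"
proof -
  have "KA1 (sqrt 2 * a) (sqrt 2 * b) t w j = sqrt 2 * KA1 a b t w j"
    "KA2 (sqrt 2 * a) (sqrt 2 * b) t w j = (sqrt 2) ^ 2 * KA2 a b t w j" for t w j
    by (simp_all add: KA1_def KA2_def kD1_def kD2_def power_mult_distrib algebra_simps)
  note Q2_scale[of "KA1 (sqrt 2 * a) (sqrt 2 * b) (at' q) (aw q)" "sqrt 2" _ "KA2 (sqrt 2 * a) (sqrt 2 * b) (at' q) (aw q)", OF this, of _ x y 0]
  then show ?thesis by (simp add: HA_def assms)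
qed

lemma HB_scaled:
  assumes "at' d = sqrt 2 * a" "bw d = sqrt 2 * b" "ax d = sqrt 2 * x" "ay d = sqrt 2 * y"
  shows "HB d q = 2 * Q2 (KB (at' q) (bw q)) (KB1 a b (at' q) (bw q)) (KB2 a b (at' q) (bw q)) x (- y) 0
    (cosh (ax q)) (sinh (ax q)) (cosh (- ay q)) (sinh (- ay q)) 1 0
    + 2 * kap * ((y + x) ^ 2 * exp (- ay q - ax q) + (x - y - 2 * a) ^ 2 * exp (ax q - ay q - 2 * at' q) / 3)"
proof -
  have "KB1 (sqrt 2 * a) (sqrt 2 * b) t w j = sqrt 2 * KB1 a b t w j"
    "KB2 (sqrt 2 * a) (sqrt 2 * b) t w j = (sqrt 2) ^ 2 * KB2 a b t w j" for t w j
    by (simp_all add: KB1_def KB2_def kD1_def kD2_def power_mult_distrib algebra_simps)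
  note Q2_scale[of "KB1 (sqrt 2 * a) (sqrt 2 * b) (at' q) (bw q)" "sqrt 2" _ "KB2 (sqrt 2 * a) (sqrt 2 * b) (at' q) (bw q)", OF this, of _ x "- y" 0]
  moreover have "(sqrt 2 * y + sqrt 2 * x) ^ 2 = 2 * (y + x) ^ 2" "(sqrt 2 * x - sqrt 2 * y - 2 * (sqrt 2 * a)) ^ 2 = 2 * (x - y - 2 * a) ^ 2"
    by (simp_all add: power_mult_distrib flip: distrib_left right_diff_distrib)
      (simp add: power2_eq_square algebra_simps)
  ultimately show ?thesis
    unfolding HB_def assms by (simp add: algebra_simps)
qed

text \<open>\<open>Th\<close> and \<open>Xi\<close> collect the coefficients of the \<open>D3\<close>-residual of \<open>VA\<close> and \<open>VB\<close>. They vanish at \<open>w = 0\<close>,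
  except for the \<open>Xi j\<close> with \<open>j \<ge> 2\<close>, which are multiplied by a factor that tends to \<open>0\<close>.\<close>

fun Th :: "nat \<Rightarrow> real \<Rightarrow> real \<Rightarrow> real" where
  "Th 0 t w = (kf 0 t w - kf 2 t w) / 2 - kD2 (- 1 / 2) (3 / 2) t w 0 + 2 * kD1 (- 1 / 2) (3 / 2) t w 1"
| "Th (Suc 0) t w = kD1 (- 1 / 2) (3 / 2) t w 0 + kD1 (- 1 / 2) (3 / 2) t w 2 - kD2 (- 1 / 2) (3 / 2) t w 1"
| "Th _ t w = (kf 2 t w - kf 0 t w) / 2 - kD2 (- 1 / 2) (3 / 2) t w 2 + 2 * kD1 (- 1 / 2) (3 / 2) t w 1"

fun Xi :: "nat \<Rightarrow> real \<Rightarrow> real \<Rightarrow> real" where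
  "Xi 0 t w = (KB t w 0 + KB t w 2) / 2 - KB2 (- 1 / 2) 1 t w 0"
| "Xi (Suc 0) t w = KB t w 1 - KB2 (- 1 / 2) 1 t w 1 + (KB1 (- 1 / 2) 1 t w 0 - KB1 (- 1 / 2) 1 t w 2)"
| "Xi (Suc (Suc 0)) t w = KB t w 1 - KB2 (- 1 / 2) 1 t w 1 - (KB1 (- 1 / 2) 1 t w 0 - KB1 (- 1 / 2) 1 t w 2)"
| "Xi _ t w = (KB t w 0 + KB t w 2) / 2 - KB2 (- 1 / 2) 1 t w 2"

lemma HA_D: "HA D1 q = 2 * VAq q" "HA D2 q = 2 * VAq q"
  "HA D3 q = 2 * (VAq q - VV2 (Th 0 (at' q) (aw q)) (Th 1 (at' q) (aw q)) (Th 2 (at' q) (aw q)) (ax q) (ay q))"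
proof -
  show "HA D1 q = 2 * VAq q"
    by (subst HA_scaled[OF coord_D(1,2,4,5)]) (simp add: VAq_eq_Q KA1_def KA2_def kD1_def kD2_def Q2_def Q_def)
  show "HA D2 q = 2 * VAq q"
    by (subst HA_scaled[OF coord_D(6,7,9,10)]) (simp add: VAq_eq_Q KA1_def KA2_def kD1_def kD2_def Q2_def Q_def)
  show "HA D3 q = 2 * (VAq q - VV2 (Th 0 (at' q) (aw q)) (Th 1 (at' q) (aw q)) (Th 2 (at' q) (aw q)) (ax q) (ay q))"
    by (subst HA_scaled[OF coord_D(11,12,14,15)])
      (simp add: VAq_eq_Q KA_def KA1_def KA2_def Q2_def Q_def VV2_def numeral_2_eq_2 power2_eq_square field_simps)
qed

text \<open>The defect for \<open>D2\<close> carries the factor \<open>sinh (- ay q)\<close>, and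
  \<open>ay\<close> vanishes wherever this chamber meets the interface.\<close>

lemma HB_D: "HB D1 q = 2 * VBq q"
  "HB D2 q = 2 * (VBq q - 4 * sinh (- ay q) * ((Iint 1 (at' q) (bw q) - Iint 3 (at' q) (bw q)) * cosh (ax q)
     + (Iint 2 (at' q) (bw q) - Iint 4 (at' q) (bw q)) * sinh (ax q)))"
  "HB D3 q = 2 * (VBq q - (Xi 0 (at' q) (bw q) * (cosh (ax q) * cosh (- ay q)) + Xi 1 (at' q) (bw q) * (sinh (ax q) * cosh (- ay q))
     + Xi 2 (at' q) (bw q) * (cosh (ax q) * sinh (- ay q)) + Xi 3 (at' q) (bw q) * (sinh (ax q) * sinh (- ay q))))"
proof -
  show "HB D1 q = 2 * VBq q"
    by (subst HB_scaled[OF coord_D(1,3,4,5)]) (simp add: VBq_eq_Q KB1_def KB2_def kD1_def kD2_def Q2_def Q_def)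
  show "HB D2 q = 2 * (VBq q - 4 * sinh (- ay q) * ((Iint 1 (at' q) (bw q) - Iint 3 (at' q) (bw q)) * cosh (ax q)
     + (Iint 2 (at' q) (bw q) - Iint 4 (at' q) (bw q)) * sinh (ax q)))"
    by (subst HB_scaled[OF coord_D(6,8,9,10)])
      (simp add: VBq_eq_Q KB1_def KB2_def kD1_def kD2_def Q2_def Q_def kw_def kww_def eval_nat_numeral algebra_simps)
  show "HB D3 q = 2 * (VBq q - (Xi 0 (at' q) (bw q) * (cosh (ax q) * cosh (- ay q)) + Xi 1 (at' q) (bw q) * (sinh (ax q) * cosh (- ay q))
     + Xi 2 (at' q) (bw q) * (cosh (ax q) * sinh (- ay q)) + Xi 3 (at' q) (bw q) * (sinh (ax q) * sinh (- ay q))))"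
  proof -
    have z: "KB (at' q) (bw q) 3 = 0" "KB1 a b (at' q) (bw q) 3 = 0" "KB2 a b (at' q) (bw q) 3 = 0" for a b
      by (simp_all add: KB_def KB1_def KB2_def)
    show ?thesis
      by (subst HB_scaled[OF coord_D(11,13,14,15)])
        (simp add: VBq_eq_Q Q2_def Q_def z numeral_2_eq_2 numeral_3_eq_3 power2_eq_square field_simps)
  qed
qed

lemma Th_w0: "t > 0 \<Longrightarrow> j \<le> 2 \<Longrightarrow> Th j t 0 = 0"
  using interface_2[of t] by (cases "(j, t, 0::real)" rule: Th.cases) (auto simp: numeral_2_eq_2)

text \<open>The exponential brought in by \<open>be\<close> is treated as an unknown
  \<open>E\<close> with \<open>E * (C + S) = C - S\<close>, which leaves polynomial
  identities.\<close>

lemma Xi_w0: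
  assumes t: "t > 0" shows "Xi 0 t 0 = 0" "Xi 1 t 0 = 0"
proof -
  define C S i k where "C = cosh t" and "S = sinh t" and "i = 1 / S" and "k = 1 / C"
  note cf = closed_forms[OF t, folded C_def S_def, folded i_def k_def]
  note kk = kf_w0[OF t, folded C_def S_def, folded i_def k_def]
  define E where "E = exp (- 2 * t)"
  have E: "E * (C + S) = C - S"
    unfolding E_def C_def S_def cosh_plus_sinh cosh_minus_sinh by (simp flip: exp_add)
  have b: "3 * be 0 t = kap * (3 + E)" "3 * be 1 t = kap * (- 3 + E)" "3 * be 2 t = kap * (- 3 + E) + 6 * kap * S * Lam t"
    "3 * be1 0 t = - 2 * kap * E" "3 * be1 1 t = - 2 * kap * E" "3 * be1 2 t = - 2 * kap * E + 6 * kap * (C * Lam t - 1)"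
    "3 * be2 0 t = 4 * kap * E" "3 * be2 1 t = 4 * kap * E"
    by (simp_all add: E_def S_def C_def numeral_2_eq_2 field_simps)
  have "12 * Xi 0 t 0 = 6 * (kf 0 t 0 - be 0 t + kf 2 t 0 - be 2 t) - (3 * ktt 0 t 0 - 12 * ktw 0 t 0 + 12 * kww 0 t 0 - 3 * be2 0 t)"
    by (simp add: KB_def KB2_def kD2_def field_simps power2_eq_square)
  also have "\<dots> = 0" using b cf(1-6) E unfolding kk by algebra
  finally show "Xi 0 t 0 = 0" by simp
  have "12 * Xi 1 t 0 = 12 * (kf 1 t 0 - be 1 t) - (3 * ktt 1 t 0 - 12 * ktw 1 t 0 + 12 * kww 1 t 0 - 3 * be2 1 t)
     + (- 6 * kt 0 t 0 + 12 * kw 0 t 0 + 6 * be1 0 t) - (- 6 * kt 2 t 0 + 12 * kw 2 t 0 + 6 * be1 2 t)"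
    by (simp add: KB_def KB1_def KB2_def kD1_def kD2_def field_simps power2_eq_square)
  also have "\<dots> = 0" using b cf(1-7) E unfolding kk by algebra
  finally show "Xi 1 t 0 = 0" by simp
qed

text \<open>For \<open>t0 > 0\<close> this is continuity together with \<open>Th_w0\<close>. At
  \<open>t0 = 0\<close> the limits available for the derivatives of higher index carry factors
  \<open>sinh t\<close>, which explains the weights; the constant term of \<open>Th 0\<close>
  cancels by \<open>alp_2\<close>.\<close>

lemma Th_tendsto:
  assumes t: "(t \<longlongrightarrow> t0) F" and tp: "\<forall>\<^sub>F x in F. t x > 0" and t0: "t0 \<ge> 0"
    and w: "(w \<longlongrightarrow> 0) F" and wn: "\<forall>\<^sub>F x in F. w x \<ge> 0"
  shows "((\<lambda>x. Th 0 (t x) (w x)) \<longlongrightarrow> 0) F" "((\<lambda>x. sinh (t x) * Th 1 (t x) (w x)) \<longlongrightarrow> 0) F"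
    "((\<lambda>x. sinh (t x) ^ 2 * Th 2 (t x) (w x)) \<longlongrightarrow> 0) F"
proof -
  have "((\<lambda>x. Th 0 (t x) (w x)) \<longlongrightarrow> 0) F \<and> ((\<lambda>x. sinh (t x) * Th 1 (t x) (w x)) \<longlongrightarrow> 0) F \<and>
    ((\<lambda>x. sinh (t x) ^ 2 * Th 2 (t x) (w x)) \<longlongrightarrow> 0) F"
  proof (cases "t0 > 0")
    case True
    note k = tendsto_k[OF t w True]
    have T: "((\<lambda>x. Th j (t x) (w x)) \<longlongrightarrow> Th j t0 0) F" for j
      by (cases "(j, t0, 0::real)" rule: Th.cases) (auto intro!: tendsto_intros k)
    have s: "((\<lambda>x. sinh (t x)) \<longlongrightarrow> sinh t0) F" by (intro tendsto_intros t)
    show ?thesis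
      using T[of 0] tendsto_mult[OF s T[of 1]] tendsto_mult[OF tendsto_power[OF s, of 2] T[of 2]]
        Th_w0[OF True, of 0] Th_w0[OF True, of 1] Th_w0[OF True, of 2] by simp
  next
    case False
    with t0 t tp have o: "filterlim t (at_right 0) F"
      by (auto simp: filterlim_at elim: eventually_mono)
    note L = origin_S[OF o w wn] origin_kf[OF o w wn] origin_kt[OF o w wn] origin_ktt[OF o w wn] origin_kw[OF o w wn]
    let ?S = "\<lambda>x. sinh (t x)"
    have e0: "Th 0 t w = (kf 0 t w - kf 2 t w) / 2
         - (1 / 4 * ktt 0 t w - 3 / 2 * ktw 0 t w + 9 / 4 * kww 0 t w) + (3 * kw 1 t w - kt 1 t w)" for t w
      by (simp add: kD1_def kD2_def power2_eq_square field_simps)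
    have e1: "sinh t * Th 1 t w = (sinh t * (3 / 2 * kw 0 t w - 1 / 2 * kt 0 t w))
         + (3 / 2 * (sinh t * kw 2 t w) - 1 / 2 * (sinh t * kt 2 t w))
         - (1 / 4 * (sinh t * ktt 1 t w) - 3 / 2 * (sinh t * ktw 1 t w) + 9 / 4 * (sinh t * kww 1 t w))" for t w
      by (simp add: kD1_def kD2_def power2_eq_square field_simps)
    have e2: "sinh t ^ 2 * Th 2 t w = sinh t * (sinh t * ((kf 2 t w - kf 0 t w) / 2))
         - (1 / 4 * (sinh t ^ 2 * ktt 2 t w) - 3 / 2 * (sinh t ^ 2 * ktw 2 t w) + 9 / 4 * (sinh t ^ 2 * kww 2 t w))
         + sinh t * (sinh t * (3 * kw 1 t w - kt 1 t w))" for t w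
      by (simp add: kD1_def kD2_def numeral_2_eq_2 field_simps)
    have "((\<lambda>x. (kf 0 (t x) (w x) - kf 2 (t x) (w x)) / 2
         - (1 / 4 * ktt 0 (t x) (w x) - 3 / 2 * ktw 0 (t x) (w x) + 9 / 4 * kww 0 (t x) (w x))
         + (3 * kw 1 (t x) (w x) - kt 1 (t x) (w x)))
       \<longlongrightarrow> (kap * pi / 2 + alp 0 - alp 2) / 2 - (1 / 4 * (kap * pi / 2 + alp 0) - 3 / 2 * (2 * alp 2) + 9 / 4 * (4 * alp 2))
         + (3 * (2 * alp 2) - alp 2)) F"
      by (intro tendsto_add tendsto_diff tendsto_mult tendsto_divide tendsto_const L) auto
    moreover have "(kap * pi / 2 + alp 0 - alp 2) / 2 - (1 / 4 * (kap * pi / 2 + alp 0) - 3 / 2 * (2 * alp 2) + 9 / 4 * (4 * alp 2))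
         + (3 * (2 * alp 2) - alp 2) = 0"
      using alp_2 by (simp add: field_simps)
    ultimately have 0: "((\<lambda>x. Th 0 (t x) (w x)) \<longlongrightarrow> 0) F"
      unfolding e0 by simp
    have "((\<lambda>x. (?S x * (3 / 2 * kw 0 (t x) (w x) - 1 / 2 * kt 0 (t x) (w x)))
         + (3 / 2 * (?S x * kw 2 (t x) (w x)) - 1 / 2 * (?S x * kt 2 (t x) (w x)))
         - (1 / 4 * (?S x * ktt 1 (t x) (w x)) - 3 / 2 * (?S x * ktw 1 (t x) (w x)) + 9 / 4 * (?S x * kww 1 (t x) (w x))))
       \<longlongrightarrow> (0 * (3 / 2 * (2 * alp 1) - 1 / 2 * (alp 1 - kap))) + (3 / 2 * 0 - 1 / 2 * 0) - (1 / 4 * 0 - 3 / 2 * 0 + 9 / 4 * 0)) F"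
      by (intro tendsto_add tendsto_diff tendsto_mult tendsto_const L)
    then have 1: "((\<lambda>x. sinh (t x) * Th 1 (t x) (w x)) \<longlongrightarrow> 0) F"
      unfolding e1 by simp
    have "((\<lambda>x. ?S x * (?S x * ((kf 2 (t x) (w x) - kf 0 (t x) (w x)) / 2))
         - (1 / 4 * (?S x ^ 2 * ktt 2 (t x) (w x)) - 3 / 2 * (?S x ^ 2 * ktw 2 (t x) (w x)) + 9 / 4 * (?S x ^ 2 * kww 2 (t x) (w x)))
         + ?S x * (?S x * (3 * kw 1 (t x) (w x) - kt 1 (t x) (w x))))
       \<longlongrightarrow> 0 * (0 * ((alp 2 - (kap * pi / 2 + alp 0)) / 2)) - (1 / 4 * 0 - 3 / 2 * 0 + 9 / 4 * 0) + 0 * (0 * (3 * (2 * alp 2) - alp 2))) F"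
      by (intro tendsto_add tendsto_diff tendsto_mult tendsto_divide tendsto_const L) auto
    then have 2: "((\<lambda>x. sinh (t x) ^ 2 * Th 2 (t x) (w x)) \<longlongrightarrow> 0) F"
      unfolding e2 by simp
    from 0 1 2 show ?thesis by simp
  qed
  then show "((\<lambda>x. Th 0 (t x) (w x)) \<longlongrightarrow> 0) F" "((\<lambda>x. sinh (t x) * Th 1 (t x) (w x)) \<longlongrightarrow> 0) F"
    "((\<lambda>x. sinh (t x) ^ 2 * Th 2 (t x) (w x)) \<longlongrightarrow> 0) F" by auto
qed

text \<open>The defects contain \<open>sinh x\<close> and \<open>sinh y\<close> with
  \<open>y \<le> x \<le> t\<close>, whereas the limits are known with weights in
  \<open>sinh t\<close>.\<close>

lemma dominated_null:
  fixes f g h :: "'a \<Rightarrow> real"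
  assumes "((\<lambda>x. g x * h x) \<longlongrightarrow> 0) F" "\<forall>\<^sub>F x in F. 0 \<le> f x \<and> f x \<le> g x"
  shows "((\<lambda>x. f x * h x) \<longlongrightarrow> 0) F"
proof (rule Lim_null_comparison)
  show "((\<lambda>x. \<bar>g x * h x\<bar>) \<longlongrightarrow> 0) F" using assms(1) by (rule tendsto_rabs_zero)
  show "\<forall>\<^sub>F x in F. norm (f x * h x) \<le> \<bar>g x * h x\<bar>"
    using assms(2) by eventually_elim (auto simp: abs_mult intro!: mult_right_mono)
qed

lemma dominated_sinh:
  fixes x y t :: "'a \<Rightarrow> real"
  assumes "\<forall>\<^sub>F p in F. 0 \<le> y p \<and> y p \<le> x p \<and> x p \<le> t p"
  shows "\<forall>\<^sub>F p in F. 0 \<le> sinh (x p) \<and> sinh (x p) \<le> sinh (t p)" "\<forall>\<^sub>F p in F. 0 \<le> sinh (y p) \<and> sinh (y p) \<le> sinh (t p)"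
    "\<forall>\<^sub>F p in F. 0 \<le> sinh (x p) * sinh (y p) \<and> sinh (x p) * sinh (y p) \<le> sinh (t p) ^ 2"
proof -
  show "\<forall>\<^sub>F p in F. 0 \<le> sinh (x p) \<and> sinh (x p) \<le> sinh (t p)" "\<forall>\<^sub>F p in F. 0 \<le> sinh (y p) \<and> sinh (y p) \<le> sinh (t p)"
    using assms by (auto elim!: eventually_mono)
  then show "\<forall>\<^sub>F p in F. 0 \<le> sinh (x p) * sinh (y p) \<and> sinh (x p) * sinh (y p) \<le> sinh (t p) ^ 2"
    by eventually_elim (auto simp: power2_eq_square intro!: mult_mono)
qed

context
  fixes t w x y :: "'a \<Rightarrow> real" and F :: "'a filter" and t0 x0 :: real
  assumes t: "(t \<longlongrightarrow> t0) F" and tp: "\<forall>\<^sub>F p in F. t p > 0" and t0: "t0 \<ge> 0"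
    and w: "(w \<longlongrightarrow> 0) F" and wn: "\<forall>\<^sub>F p in F. w p \<ge> 0"
    and x: "(x \<longlongrightarrow> x0) F" and dom: "\<forall>\<^sub>F p in F. 0 \<le> y p \<and> y p \<le> x p \<and> x p \<le> t p"
begin

lemma VV2_Th_tendsto:
  assumes y: "(y \<longlongrightarrow> y0) F"
  shows "((\<lambda>p. VV2 (Th 0 (t p) (w p)) (Th 1 (t p) (w p)) (Th 2 (t p) (w p)) (x p) (y p)) \<longlongrightarrow> 0) F"
proof -
  note T = Th_tendsto[OF t tp t0 w wn]
  note D = dominated_null[OF T(2) dominated_sinh(1)[OF dom]] dominated_null[OF T(2) dominated_sinh(2)[OF dom]]
    dominated_null[OF T(3) dominated_sinh(3)[OF dom]]
  have "((\<lambda>p. Th 0 (t p) (w p) * (cosh (x p) * cosh (y p)) + (sinh (x p) * Th 1 (t p) (w p) * cosh (y p)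
      + sinh (y p) * Th 1 (t p) (w p) * cosh (x p)) + sinh (x p) * sinh (y p) * Th 2 (t p) (w p))
    \<longlongrightarrow> 0 * (cosh x0 * cosh y0) + (0 * cosh y0 + 0 * cosh x0) + 0) F"
    by (intro tendsto_add tendsto_mult tendsto_cosh T D x y)
  then show ?thesis by (simp add: VV2_def algebra_simps)
qed

lemma
  assumes y: "(y \<longlongrightarrow> 0) F"
  shows residual_D2_tendsto: "((\<lambda>p. 4 * sinh (y p) * ((Iint 1 (t p) (w p) - Iint 3 (t p) (w p)) * cosh (x p)
     + (Iint 2 (t p) (w p) - Iint 4 (t p) (w p)) * sinh (x p))) \<longlongrightarrow> 0) F"
    and residual_D3_tendsto: "((\<lambda>p. Xi 0 (t p) (w p) * (cosh (x p) * cosh (y p)) + Xi 1 (t p) (w p) * (sinh (x p) * cosh (y p))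
     + Xi 2 (t p) (w p) * (cosh (x p) * sinh (y p)) + Xi 3 (t p) (w p) * (sinh (x p) * sinh (y p))) \<longlongrightarrow> 0) F"
proof -
  have sy: "((\<lambda>p. sinh (y p)) \<longlongrightarrow> 0) F" using tendsto_sinh[OF y] by simp
  note dom' = dominated_sinh[OF dom]
  have "(((\<lambda>p. Xi 0 (t p) (w p)) \<longlongrightarrow> 0) F \<and> ((\<lambda>p. sinh (x p) * Xi 1 (t p) (w p)) \<longlongrightarrow> 0) F \<and>
    ((\<lambda>p. sinh (y p) * Xi 2 (t p) (w p)) \<longlongrightarrow> 0) F \<and> ((\<lambda>p. sinh (x p) * sinh (y p) * Xi 3 (t p) (w p)) \<longlongrightarrow> 0) F) \<and>
    ((\<lambda>p. sinh (y p) * Iint 1 (t p) (w p)) \<longlongrightarrow> 0) F \<and> ((\<lambda>p. sinh (y p) * Iint 3 (t p) (w p)) \<longlongrightarrow> 0) F \<and>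
    ((\<lambda>p. sinh (x p) * sinh (y p) * Iint 2 (t p) (w p)) \<longlongrightarrow> 0) F \<and> ((\<lambda>p. sinh (x p) * sinh (y p) * Iint 4 (t p) (w p)) \<longlongrightarrow> 0) F"
  proof (cases "t0 > 0")
    case True
    note k = tendsto_KB[OF t w True] tendsto_k[OF t w True]
    have X: "((\<lambda>p. Xi j (t p) (w p)) \<longlongrightarrow> Xi j t0 0) F" for j
      by (cases "(j, t0, 0::real)" rule: Xi.cases) (auto intro!: tendsto_intros k)
    \<comment> \<open>In the direction \<open>(0, 1)\<close> these are \<open>kw / 2\<close> and
      \<open>kww / 4\<close>, that is, \<open>Iint\<close> with index raised by 1 and by 2.\<close>
    have D: "((\<lambda>p. kD1 0 1 (t p) (w p) j / 2) \<longlongrightarrow> kD1 0 1 t0 0 j / 2) F"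
      "((\<lambda>p. kD2 0 1 (t p) (w p) j / 4) \<longlongrightarrow> kD2 0 1 t0 0 j / 4) F" for j
      by (intro tendsto_intros k; simp)+
    have I: "((\<lambda>p. Iint 1 (t p) (w p)) \<longlongrightarrow> Iint 1 t0 0) F" "((\<lambda>p. Iint 2 (t p) (w p)) \<longlongrightarrow> Iint 2 t0 0) F"
      "((\<lambda>p. Iint 3 (t p) (w p)) \<longlongrightarrow> Iint 3 t0 0) F" "((\<lambda>p. Iint 4 (t p) (w p)) \<longlongrightarrow> Iint 4 t0 0) F"
      using D(1)[of 0] D(1)[of 1] D(2)[of 1] D(2)[of 2]
      by (simp_all add: kD1_def kD2_def kw_def kww_def eval_nat_numeral)
    show ?thesis
      using X[of 0] tendsto_mult[OF tendsto_sinh[OF x] X[of 1]] tendsto_mult[OF sy X[of 2]]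
        tendsto_mult[OF tendsto_mult[OF tendsto_sinh[OF x] sy] X[of 3]] Xi_w0[OF True]
        tendsto_mult[OF sy I(1)] tendsto_mult[OF sy I(3)] tendsto_mult[OF tendsto_mult[OF tendsto_sinh[OF x] sy] I(2)]
        tendsto_mult[OF tendsto_mult[OF tendsto_sinh[OF x] sy] I(4)] by simp
  next
    case False
    with t0 t tp have o: "filterlim t (at_right 0) F"
      by (auto simp: filterlim_at elim: eventually_mono)
    let ?S = "\<lambda>x. sinh (t x)"
    note L = origin_S[OF o w wn] origin_kf[OF o w wn] origin_kt[OF o w wn] origin_ktt[OF o w wn] origin_kw[OF o w wn] origin_be[OF o w wn]
      origin_I[OF o w wn]
    have e0: "Xi 0 t w = (kf 0 t w - be 0 t + kf 2 t w - be 2 t) / 2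
         - (1 / 4 * (ktt 0 t w - be2 0 t) - ktw 0 t w + kww 0 t w)" for t w
      by (simp add: KB_def KB2_def kD2_def power2_eq_square field_simps)
    have e1: "sinh t * Xi 1 t w = sinh t * (kf 1 t w - be 1 t) - (1 / 4 * (sinh t * ktt 1 t w - sinh t * be2 1 t) - sinh t * ktw 1 t w + sinh t * kww 1 t w)
       + (sinh t * (kw 0 t w - 1 / 2 * (kt 0 t w - be1 0 t)) - (sinh t * kw 2 t w - 1 / 2 * (sinh t * kt 2 t w - sinh t * be1 2 t)))" for t w
      by (simp add: KB_def KB1_def KB2_def kD1_def kD2_def power2_eq_square field_simps)
    have e2: "sinh t * Xi 2 t w = sinh t * (kf 1 t w - be 1 t) - (1 / 4 * (sinh t * ktt 1 t w - sinh t * be2 1 t) - sinh t * ktw 1 t w + sinh t * kww 1 t w)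
       - (sinh t * (kw 0 t w - 1 / 2 * (kt 0 t w - be1 0 t)) - (sinh t * kw 2 t w - 1 / 2 * (sinh t * kt 2 t w - sinh t * be1 2 t)))" for t w
      by (simp add: numeral_2_eq_2 KB_def KB1_def KB2_def kD1_def kD2_def power2_eq_square field_simps)
    have e3: "sinh t ^ 2 * Xi 3 t w = sinh t * (sinh t * ((kf 0 t w - be 0 t + kf 2 t w - be 2 t) / 2))
         - (1 / 4 * (sinh t ^ 2 * ktt 2 t w - sinh t ^ 2 * be2 2 t) - sinh t ^ 2 * ktw 2 t w + sinh t ^ 2 * kww 2 t w)" for t w
      by (simp add: numeral_3_eq_3 KB_def KB2_def kD2_def power2_eq_square field_simps)
    have X0: "((\<lambda>p. Xi 0 (t p) (w p)) \<longlongrightarrow> (kap * pi / 2 + alp 0 - 4 / 3 * kap + alp 2 - (- 2 / 3 * kap)) / 2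
         - (1 / 4 * (kap * pi / 2 + alp 0 - 4 / 3 * kap) - 2 * alp 2 + 4 * alp 2)) F"
      unfolding e0 by (intro tendsto_add tendsto_diff tendsto_mult tendsto_divide tendsto_const L) auto
    moreover have "(kap * pi / 2 + alp 0 - 4 / 3 * kap + alp 2 - (- 2 / 3 * kap)) / 2
         - (1 / 4 * (kap * pi / 2 + alp 0 - 4 / 3 * kap) - 2 * alp 2 + 4 * alp 2) = 0"
      using alp_2 by (simp add: field_simps)
    ultimately have 0: "((\<lambda>p. Xi 0 (t p) (w p)) \<longlongrightarrow> 0) F" by (simp only:)
    have "((\<lambda>p. sinh (t p) * Xi 1 (t p) (w p)) \<longlongrightarrow> 0 * (alp 1 - kap - (- 2 / 3 * kap)) - (1 / 4 * (0 - 0 * (4 / 3 * kap)) - 0 + 0)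
       + (0 * (2 * alp 1 - 1 / 2 * (alp 1 - kap - (- 2 / 3 * kap))) - (0 - 1 / 2 * (0 - 0)))) F"
      unfolding e1 by (intro tendsto_add tendsto_diff tendsto_mult tendsto_const L)
    then have 1: "((\<lambda>p. sinh (t p) * Xi 1 (t p) (w p)) \<longlongrightarrow> 0) F" by simp
    have "((\<lambda>p. sinh (t p) * Xi 2 (t p) (w p)) \<longlongrightarrow> 0 * (alp 1 - kap - (- 2 / 3 * kap)) - (1 / 4 * (0 - 0 * (4 / 3 * kap)) - 0 + 0)
       - (0 * (2 * alp 1 - 1 / 2 * (alp 1 - kap - (- 2 / 3 * kap))) - (0 - 1 / 2 * (0 - 0)))) F"
      unfolding e2 by (intro tendsto_add tendsto_diff tendsto_mult tendsto_const L)
    then have 2: "((\<lambda>p. sinh (t p) * Xi 2 (t p) (w p)) \<longlongrightarrow> 0) F" by simp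
    have "((\<lambda>p. sinh (t p) ^ 2 * Xi 3 (t p) (w p)) \<longlongrightarrow> 0 * (0 * ((kap * pi / 2 + alp 0 - 4 / 3 * kap + alp 2 - (- 2 / 3 * kap)) / 2))
         - (1 / 4 * (0 - 0) - 0 + 0)) F"
      unfolding e3 by (intro tendsto_add tendsto_diff tendsto_mult tendsto_divide tendsto_const L) auto
    then have 3: "((\<lambda>p. sinh (t p) ^ 2 * Xi 3 (t p) (w p)) \<longlongrightarrow> 0) F" by simp
    have I: "((\<lambda>p. sinh (t p) * Iint 1 (t p) (w p)) \<longlongrightarrow> 0) F" "((\<lambda>p. sinh (t p) ^ 2 * Iint 2 (t p) (w p)) \<longlongrightarrow> 0) F"
      using tendsto_mult[OF L(1) origin_I(2)[OF o w wn]] tendsto_mult[OF tendsto_power[OF L(1), of 2] origin_I(3)[OF o w wn]] by simp_all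
    show ?thesis
      by (intro conjI 0 dominated_null[OF 1 dom'(1)] dominated_null[OF 2 dom'(2)] dominated_null[OF 3 dom'(3)]
        dominated_null[OF I(1) dom'(2)] dominated_null[OF I(2) dom'(3)] dominated_null[OF origin_I(4)[OF o w wn] dom'(2)]
        dominated_null[OF origin_I(5)[OF o w wn] dom'(3)])
  qed
  then have T: "((\<lambda>p. Xi 0 (t p) (w p)) \<longlongrightarrow> 0) F" "((\<lambda>p. sinh (x p) * Xi 1 (t p) (w p)) \<longlongrightarrow> 0) F"
    "((\<lambda>p. sinh (y p) * Xi 2 (t p) (w p)) \<longlongrightarrow> 0) F" "((\<lambda>p. sinh (x p) * sinh (y p) * Xi 3 (t p) (w p)) \<longlongrightarrow> 0) F"
    "((\<lambda>p. sinh (y p) * Iint 1 (t p) (w p)) \<longlongrightarrow> 0) F" "((\<lambda>p. sinh (y p) * Iint 3 (t p) (w p)) \<longlongrightarrow> 0) F"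
    "((\<lambda>p. sinh (x p) * sinh (y p) * Iint 2 (t p) (w p)) \<longlongrightarrow> 0) F" "((\<lambda>p. sinh (x p) * sinh (y p) * Iint 4 (t p) (w p)) \<longlongrightarrow> 0) F"
    by auto
  have "((\<lambda>p. 4 * ((sinh (y p) * Iint 1 (t p) (w p) - sinh (y p) * Iint 3 (t p) (w p)) * cosh (x p)
     + (sinh (x p) * sinh (y p) * Iint 2 (t p) (w p) - sinh (x p) * sinh (y p) * Iint 4 (t p) (w p)))) \<longlongrightarrow> 4 * ((0 - 0) * cosh x0 + (0 - 0))) F"
    by (intro tendsto_add tendsto_diff tendsto_mult tendsto_const tendsto_cosh T x)
  then show "((\<lambda>p. 4 * sinh (y p) * ((Iint 1 (t p) (w p) - Iint 3 (t p) (w p)) * cosh (x p)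
     + (Iint 2 (t p) (w p) - Iint 4 (t p) (w p)) * sinh (x p))) \<longlongrightarrow> 0) F"
    by (simp add: algebra_simps)
  have "((\<lambda>p. Xi 0 (t p) (w p) * (cosh (x p) * cosh (y p)) + sinh (x p) * Xi 1 (t p) (w p) * cosh (y p)
     + sinh (y p) * Xi 2 (t p) (w p) * cosh (x p) + sinh (x p) * sinh (y p) * Xi 3 (t p) (w p))
     \<longlongrightarrow> 0 * (cosh x0 * cosh 0) + 0 * cosh 0 + 0 * cosh x0 + 0) F"
    by (intro tendsto_add tendsto_diff tendsto_mult tendsto_const tendsto_cosh T x y)
  then show "((\<lambda>p. Xi 0 (t p) (w p) * (cosh (x p) * cosh (y p)) + Xi 1 (t p) (w p) * (sinh (x p) * cosh (y p))
     + Xi 2 (t p) (w p) * (cosh (x p) * sinh (y p)) + Xi 3 (t p) (w p) * (sinh (x p) * sinh (y p))) \<longlongrightarrow> 0) F"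
    by (simp add: mult_ac)
qed

end

section \<open>Limits at the interface\<close>

text \<open>The three pieces cover \<open>orthant_pos\<close>, so a limit within it splits into
  three. Each piece contains the matching open chamber, so the same limits also serve the second
  derivatives.\<close>

definition "PA = {q \<in> orthant_pos. q $ 2 \<le> q $ 4 \<and> q $ 4 - q $ 2 \<le> 2 * q $ 1}"
definition "PB = {q \<in> orthant_pos. q $ 4 < q $ 2}"
definition "PC = {q \<in> orthant_pos. 2 * q $ 1 < q $ 4 - q $ 2}"

lemma orthant_pos_eq: "orthant_pos = PA \<union> PB \<union> PC"
proof -
  have "q $ 1 \<ge> 0" if "q \<in> orthant_pos" for q using orthant_posD(1)[OF that] .
  then show ?thesis by (force simp: PA_def PB_def PC_def)
qed

lemma R_subset_P: "RA \<subseteq> PA" "RB \<subseteq> PB" "RC \<subseteq> PC"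
  using R_subset_orthant_pos by (auto simp: RA_def RB_def RC_def PA_def PB_def PC_def)

lemma coord_bounds:
  "q \<in> PA \<Longrightarrow> at' q > 0 \<and> aw q \<ge> 0 \<and> 0 \<le> ay q \<and> ay q \<le> ax q \<and> ax q \<le> at' q"
  "q \<in> PB \<Longrightarrow> at' q > 0 \<and> bw q \<ge> 0 \<and> 0 \<le> - ay q \<and> - ay q \<le> ax q \<and> ax q \<le> at' q"
  "q \<in> PC \<Longrightarrow> cr q > 0 \<and> 0 \<le> cz q \<and> cz q \<le> cy q \<and> cy q \<le> cx q \<and> cx q \<le> cr q"
proof -
  have diffs: "at' q = sqrt 2 / 2 * (q $ 3 + q $ 2 + (q $ 3 + q $ 4))" "ax q - ay q = sqrt 2 * q $ 2" "ax q + ay q = sqrt 2 * q $ 4"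
    "at' q - ax q = sqrt 2 * q $ 3" "aw q = sqrt 2 * ((2 * q $ 1 - (q $ 4 - q $ 2)) / 2)"
    by (simp_all add: coord_defs field_simps)
  show "at' q > 0 \<and> aw q \<ge> 0 \<and> 0 \<le> ay q \<and> ay q \<le> ax q \<and> ax q \<le> at' q" if "q \<in> PA"
  proof -
    have "q \<in> orthant_pos" "q $ 2 \<le> q $ 4" "q $ 4 - q $ 2 \<le> 2 * q $ 1" using that by (auto simp: PA_def)
    note o = this orthant_posD[OF this(1)]
    have "at' q > 0" unfolding diffs(1) using add_pos_pos[OF o(8,9)] by simp
    moreover have "aw q \<ge> 0" unfolding diffs(5) using o by (intro mult_nonneg_nonneg) auto
    moreover have "ay q \<ge> 0" unfolding ay_def using o by (intro mult_nonneg_nonneg) auto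
    moreover have "ax q - ay q \<ge> 0" "at' q - ax q \<ge> 0" unfolding diffs(2,4) using o by auto
    ultimately show ?thesis by linarith
  qed
  show "at' q > 0 \<and> bw q \<ge> 0 \<and> 0 \<le> - ay q \<and> - ay q \<le> ax q \<and> ax q \<le> at' q" if "q \<in> PB"
  proof -
    have "q \<in> orthant_pos" "q $ 4 < q $ 2" using that by (auto simp: PB_def)
    note o = this orthant_posD[OF this(1)]
    have "at' q > 0" unfolding diffs(1) using add_pos_pos[OF o(7,8)] by simp
    moreover have "bw q \<ge> 0" unfolding bw_def using o by auto
    moreover have "ay q \<le> 0" unfolding ay_def using o by (intro mult_nonneg_nonpos) auto
    moreover have "ax q + ay q \<ge> 0" "at' q - ax q \<ge> 0" unfolding diffs(3,4) using o by auto
    ultimately show ?thesis by linarith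
  qed
  show "cr q > 0 \<and> 0 \<le> cz q \<and> cz q \<le> cy q \<and> cy q \<le> cx q \<and> cx q \<le> cr q" if "q \<in> PC"
  proof -
    have "q \<in> orthant_pos" "2 * q $ 1 < q $ 4 - q $ 2" using that by (auto simp: PC_def)
    note o = this orthant_posD[OF this(1)]
    have "cr q - cx q = sqrt 2 * q $ 3" "cx q - cy q = sqrt 2 * q $ 2" "cy q - cz q = sqrt 2 * q $ 1"
      by (simp_all add: cr_def cx_def cy_def algebra_simps)
    then have "cr q - cx q \<ge> 0" "cx q - cy q \<ge> 0" "cy q - cz q \<ge> 0" using o by auto
    moreover have "cz q > 0" using o by (simp add: cz_def)
    ultimately show ?thesis by linarith
  qed
qed

lemma eventually_coord_bounds:
  "\<forall>\<^sub>F p in at q within PA. at' p > 0" "\<forall>\<^sub>F p in at q within PA. aw p \<ge> 0"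
  "\<forall>\<^sub>F p in at q within PA. 0 \<le> ay p \<and> ay p \<le> ax p \<and> ax p \<le> at' p"
  "\<forall>\<^sub>F p in at q within PB. at' p > 0" "\<forall>\<^sub>F p in at q within PB. bw p \<ge> 0"
  "\<forall>\<^sub>F p in at q within PB. 0 \<le> - ay p \<and> - ay p \<le> ax p \<and> ax p \<le> at' p"
  "\<forall>\<^sub>F p in at q within PC. cr p > 0" "\<forall>\<^sub>F p in at q within PC. 0 \<le> cz p \<and> cz p \<le> cy p \<and> cy p \<le> cx p \<and> cx p \<le> cr p"
  unfolding eventually_at_filter using coord_bounds by (auto intro!: always_eventually)

text \<open>On the interface within \<open>region_C\<close>, \<open>cr q = 0\<close> happens only at
  the origin. There all hyperbolic sines vanish and only the limit of \<open>kf 0\<close>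
  survives.\<close>

definition "interface_value q = (if cr q > 0 then VCq q else kap * pi / 2 + alp 0)"

context
  fixes q :: "real ^ 4"
  assumes q: "q \<in> region_C" and on: "2 * q $ 1 = q $ 4 - q $ 2"
begin

lemma interface_coords: "cz q = 0" "at' q = cr q" "aw q = 0" "ax q = cx q" "ay q = cy q"
  "0 \<le> cy q" "cy q \<le> cx q" "cx q \<le> cr q" "q $ 2 = q $ 4 \<Longrightarrow> bw q = 0 \<and> cy q = 0"
  using region_C_D[OF q] on by (simp_all add: coord_defs)

lemma origin_case:
  assumes "\<not> cr q > 0" shows "cr q = 0" "cx q = 0" "cy q = 0"
  using assms interface_coords by auto

text \<open>The chamber \<open>q $ 4 < q $ 2\<close> reaches the interface only where
  \<open>q $ 2 = q $ 4\<close>. Elsewhere the filter is trivial and every limit in that chamber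
  holds vacuously.\<close>

lemma at_q_within_PB: assumes "q $ 2 \<noteq> q $ 4" shows "at q within PB = bot"
proof -
  have "q $ 2 < q $ 4" using assms region_C_D(5)[OF q] by simp
  have "open {p :: real ^ 4. p $ 2 < p $ 4}" by (intro open_Collect_less continuous_intros)
  then have "\<forall>\<^sub>F p in at q within PB. p \<in> PB \<and> p \<in> {p. p $ 2 < p $ 4}"
    by (rule eventually_at_within_open_cond) (use \<open>q $ 2 < q $ 4\<close> in simp)
  then have "\<forall>\<^sub>F p in at q within PB. False" by eventually_elim (auto simp: PB_def)
  then show ?thesis by (simp add: trivial_limit_def)
qed

lemma VAq_tendsto: "(VAq \<longlongrightarrow> interface_value q) (at q within PA)"
proof (cases "cr q > 0")
  case True
  then show ?thesis
    using tendsto_chambers(1)[OF tendsto_ident_at, of q PA] HA_eq_HC(2)[OF interface_coords(1) True] interface_coords(2)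
    by (simp add: interface_value_def)
next
  case False
  note z = origin_case[OF False] interface_coords
  note ct = coord_tendsto[OF tendsto_ident_at, of q PA]
  have o: "filterlim at' (at_right 0) (at q within PA)"
    using ct(5) eventually_coord_bounds(1)[of q] z by (auto simp: filterlim_at elim: eventually_mono)
  have w: "(aw \<longlongrightarrow> 0) (at q within PA)" using ct(6) z by simp
  have "(VAq \<longlongrightarrow> (kap * pi / 2 + alp 0) * (cosh (ax q) * cosh (ay q))
     + (alp 1 - kap) * (sinh (ax q) * cosh (ay q) + cosh (ax q) * sinh (ay q)) + alp 2 * (sinh (ax q) * sinh (ay q))) (at q within PA)"
    unfolding VAq_def VA_def VV2_def
    by (intro tendsto_add tendsto_mult tendsto_cosh tendsto_sinh ct origin_kf[OF o w eventually_coord_bounds(2)])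
  then show ?thesis using False z by (simp add: interface_value_def)
qed

lemma VBq_tendsto: "(VBq \<longlongrightarrow> interface_value q) (at q within PB)"
proof (cases "q $ 2 = q $ 4")
  case True
  note z = interface_coords(1-8) interface_coords(9)[OF True]
  note ct = coord_tendsto[OF tendsto_ident_at, of q PB]
  show ?thesis
  proof (cases "cr q > 0")
    case True
    \<comment> \<open>For \<open>ay q = 0\<close> the exponential term equals
      \<open>be 0 * cosh x + be 1 * sinh x\<close>, which undoes the subtraction of
      \<open>be\<close>.\<close>
    have "VBq q = VCq q"
      using z by (simp add: VBq_def VB_def VCq_def VC_def VV2_def VV3_def exp_add exp_diff exp_minus cosh_def sinh_def field_simps)
    then show ?thesis
      using tendsto_chambers(3)[OF tendsto_ident_at, of q PB] True z by (simp add: interface_value_def)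
  next
    case False
    note z = z origin_case[OF False]
    have o: "filterlim at' (at_right 0) (at q within PB)"
      using ct(5) eventually_coord_bounds(4)[of q] z by (auto simp: filterlim_at elim: eventually_mono)
    have w: "(bw \<longlongrightarrow> 0) (at q within PB)" using ct(9) z by simp
    note L = origin_kf[OF o w eventually_coord_bounds(5)] origin_be[OF o w eventually_coord_bounds(5)]
    \<comment> \<open>The subtracted \<open>4 / 3 * kap\<close> is restored by the exponential term,
      which tends to \<open>kap * (1 + 1 / 3)\<close>.\<close>
    have "(VBq \<longlongrightarrow> (kap * pi / 2 + alp 0 - 4 / 3 * kap) * (cosh (ax q) * cosh (- ay q))
     + (alp 1 - kap - (- 2 / 3 * kap)) * (sinh (ax q) * cosh (- ay q) + cosh (ax q) * sinh (- ay q)) + (alp 2 - (- 2 / 3 * kap)) * (sinh (ax q) * sinh (- ay q))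
     + kap * (exp (- ay q - ax q) + exp (ax q + - ay q - 2 * at' q) / 3)) (at q within PB)"
      unfolding VBq_def VB_def VV2_def
      by (intro tendsto_add tendsto_diff tendsto_mult tendsto_divide tendsto_const tendsto_exp tendsto_minus tendsto_cosh tendsto_sinh ct L) simp
    then show ?thesis using False z by (simp add: interface_value_def)
  qed
qed (simp add: at_q_within_PB)

lemma VCq_tendsto: "(VCq \<longlongrightarrow> interface_value q) (at q within PC)"
proof (cases "cr q > 0")
  case True
  then show ?thesis
    using tendsto_chambers(5)[OF tendsto_ident_at, of q PC] by (simp add: interface_value_def)
next
  case False
  note z = origin_case[OF False] interface_coords
  note ct = coord_tendsto[OF tendsto_ident_at, of q PC]
  have o: "filterlim cr (at_right 0) (at q within PC)"
    using ct(4) eventually_coord_bounds(7)[of q] z by (auto simp: filterlim_at elim: eventually_mono)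
  note k = origin_kf[OF o tendsto_const, OF always_eventually, OF allI, OF order_refl]
  have "\<forall>\<^sub>F p in at q within PC. 0 \<le> cy p \<and> cy p \<le> cx p \<and> cx p \<le> cr p"
    using eventually_coord_bounds(8) by eventually_elim auto
  \<comment> \<open>\<open>kf 3\<close> comes with three hyperbolic sines; the product of the first
    two is at most \<open>sinh (cr p) ^ 2\<close>, the weight with which it tends to 0.\<close>
  note D = dominated_null[OF k(4) dominated_sinh(3)[OF this]]
  have "((\<lambda>p. kf 0 (cr p) 0 * (cosh (cx p) * cosh (cy p) * cosh (cz p))
     + kf 1 (cr p) 0 * (sinh (cx p) * cosh (cy p) * cosh (cz p) + cosh (cx p) * sinh (cy p) * cosh (cz p) + cosh (cx p) * cosh (cy p) * sinh (cz p))
     + kf 2 (cr p) 0 * (sinh (cx p) * sinh (cy p) * cosh (cz p) + sinh (cx p) * cosh (cy p) * sinh (cz p) + cosh (cx p) * sinh (cy p) * sinh (cz p))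
     + sinh (cx p) * sinh (cy p) * kf 3 (cr p) 0 * sinh (cz p)) \<longlongrightarrow>
     (kap * pi / 2 + alp 0) * (cosh (cx q) * cosh (cy q) * cosh (cz q))
     + (alp 1 - kap) * (sinh (cx q) * cosh (cy q) * cosh (cz q) + cosh (cx q) * sinh (cy q) * cosh (cz q) + cosh (cx q) * cosh (cy q) * sinh (cz q))
     + alp 2 * (sinh (cx q) * sinh (cy q) * cosh (cz q) + sinh (cx q) * cosh (cy q) * sinh (cz q) + cosh (cx q) * sinh (cy q) * sinh (cz q))
     + 0 * sinh (cz q)) (at q within PC)"
    by (intro tendsto_add tendsto_mult tendsto_cosh tendsto_sinh ct k D)
  then show ?thesis
    using False z by (simp add: interface_value_def VCq_eq_Q[abs_def] Q_def mult_ac)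
qed

lemma v_interface: "v q = interface_value q"
proof (rule v_eqI[OF q])
  have "(v_formula \<longlongrightarrow> interface_value q) (at q within PA)" "(v_formula \<longlongrightarrow> interface_value q) (at q within PB)"
    "(v_formula \<longlongrightarrow> interface_value q) (at q within PC)"
    using VAq_tendsto VBq_tendsto VCq_tendsto
    by (auto elim!: Lim_transform_within[OF _ zero_less_one] simp: PA_def PB_def PC_def v_formula_A v_formula_B v_formula_C)
  then show "(v_formula \<longlongrightarrow> interface_value q) (at q within orthant_pos)"
    unfolding orthant_pos_eq at_within_union by (intro filterlim_sup)
  assume "q \<in> orthant_pos"
  then have "cr q > 0" "v_formula q = VAq q"
    using on region_C_D[OF q] coord_bounds(1)[of q] v_formula_A[of q] interface_coords by (auto simp: PA_def)
  then show "v_formula q = interface_value q"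
    using HA_eq_HC(2)[OF interface_coords(1)] by (simp add: interface_value_def)
qed

text \<open>In each chamber the second derivative in one of these directions is twice the chamber
  formula, up to a defect that tends to 0. Hence all adjacent chambers give the same limit, and
  \<open>Lim\<close> is determined.\<close>

lemma second_deriv_interface:
  assumes d: "d \<in> {D1, D2, D3}"
  shows "second_dir_deriv d v q = 2 * interface_value q"
proof (rule second_dir_deriv_eqI[OF q])
  have "(HA d \<longlongrightarrow> 2 * interface_value q) (at q within PA)"
  proof -
    note ct = coord_tendsto[OF tendsto_ident_at, of q PA] and e = eventually_coord_bounds[of q]
    have "((\<lambda>p. VV2 (Th 0 (at' p) (aw p)) (Th 1 (at' p) (aw p)) (Th 2 (at' p) (aw p)) (ax p) (ay p)) \<longlongrightarrow> 0) (at q within PA)"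
      by (rule VV2_Th_tendsto[OF ct(5) e(1) _ _ e(2) ct(7) e(3) ct(8)]) (use ct(6) interface_coords in auto)
    from tendsto_diff[OF VAq_tendsto this, unfolded diff_zero] show ?thesis
      using d VAq_tendsto by (auto simp only: insert_iff empty_iff HA_D[abs_def] intro!: tendsto_mult_left)
  qed
  moreover have "(HB d \<longlongrightarrow> 2 * interface_value q) (at q within PB)"
  proof (cases "q $ 2 = q $ 4")
    case True
    note ct = coord_tendsto[OF tendsto_ident_at, of q PB] and e = eventually_coord_bounds[of q]
    have t0: "at' q \<ge> 0" and w: "(bw \<longlongrightarrow> 0) (at q within PB)" and y: "((\<lambda>p. - ay p) \<longlongrightarrow> 0) (at q within PB)"
      using ct(9) tendsto_minus[OF ct(8)] interface_coords True by auto
    note T = residual_D2_tendsto[OF ct(5) e(4) t0 w e(5) ct(7) e(6) y] residual_D3_tendsto[OF ct(5) e(4) t0 w e(5) ct(7) e(6) y]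
    from tendsto_diff[OF VBq_tendsto T(1), unfolded diff_zero] tendsto_diff[OF VBq_tendsto T(2), unfolded diff_zero] show ?thesis
      using d VBq_tendsto by (auto simp only: insert_iff empty_iff HB_D[abs_def] intro!: tendsto_mult_left)
  qed (simp add: at_q_within_PB)
  moreover have "HC d = (\<lambda>p. 2 * VCq p)"
    using d by (auto simp only: insert_iff empty_iff HC_D)
  with tendsto_mult_left[OF VCq_tendsto, of 2] have "(HC d \<longlongrightarrow> 2 * interface_value q) (at q within PC)"
    by simp
  ultimately have "(HA d \<longlongrightarrow> 2 * interface_value q) (at q within RA)" "(HB d \<longlongrightarrow> 2 * interface_value q) (at q within RB)"
    "(HC d \<longlongrightarrow> 2 * interface_value q) (at q within RC)"
    by (simp_all only: tendsto_within_subset[OF _ R_subset_P(1)] tendsto_within_subset[OF _ R_subset_P(2)] tendsto_within_subset[OF _ R_subset_P(3)])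
  from Lim_transform_within[OF this(1) zero_less_one] Lim_transform_within[OF this(2) zero_less_one] Lim_transform_within[OF this(3) zero_less_one]
  have "(dir_deriv d (dir_deriv d v) \<longlongrightarrow> 2 * interface_value q) (at q within RA)"
    "(dir_deriv d (dir_deriv d v) \<longlongrightarrow> 2 * interface_value q) (at q within RB)"
    "(dir_deriv d (dir_deriv d v) \<longlongrightarrow> 2 * interface_value q) (at q within RC)"
    by (simp_all add: second_deriv_A second_deriv_B second_deriv_C)
  then show "(dir_deriv d (dir_deriv d v) \<longlongrightarrow> 2 * interface_value q) (at q within regular_points)"
    unfolding regular_points_eq at_within_union by (intro filterlim_sup)
qed (use on in \<open>simp add: regular_points_def\<close>)

end

lemma residual_zero:
  assumes "q \<in> region_C" "dvec \<omega> \<in> {D1, D2, D3}" shows "residual \<omega> v q = 0"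
proof (cases "2 * q $ 1 = q $ 4 - q $ 2")
  case True
  then show ?thesis
    by (simp add: residual_def v_interface[OF assms(1)] second_deriv_interface[OF assms(1) _ assms(2)])
next
  case False
  then have "2 * q $ 1 < q $ 4 - q $ 2" using region_C_D(6)[OF assms(1)] by simp
  then show ?thesis
    using assms(2) by (auto simp: residual_def off_interface[OF assms(1)] HC_D)
qed

theorem theorem6p1:
  assumes "\<forall>\<omega>\<in>controls. \<forall>q\<in>region_A. residual \<omega> v q \<ge> 0"
  shows "(\<forall>\<omega>\<in>controls. \<forall>q\<in>region_C. residual \<omega> v q \<ge> 0) \<and>
    (\<forall>q\<in>region_C.
       residual (vector [0, 0, 1, 0, 1]) v q = 0 \<and>
       residual (vector [0, 1, 0, 0, 1]) v q = 0 \<and>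
       residual (vector [0, 1, 1, 1, 0]) v q = 0)"
proof (intro conjI ballI)
  fix \<omega> q assume w: "\<omega> \<in> controls" and q: "q \<in> region_C"
  show "residual \<omega> v q \<ge> 0"
  proof (cases "2 * q $ 1 = q $ 4 - q $ 2")
    case True
    \<comment> \<open>Interface points belong to both regions, so here the hypothesis is already the
      claim, with the same \<open>Lim\<close> on both sides.\<close>
    then have "q \<in> region_A" using q by (simp add: region_A_def region_C_def)
    then show ?thesis using assms w by blast
  next
    case False
    then have "2 * q $ 1 < q $ 4 - q $ 2" using region_C_D(6)[OF q] by simp
    then show ?thesis by (rule residual_nonneg_off_interface[OF assms w q])
  qed
qed (simp_all add: residual_zero D1_def D2_def D3_def)

end
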